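(* There is an absolute constant $C$ such that for every prime $p$ there exist a subset $\mathcal V_4^{bad}\subset\mathbb F_p^4$, the zero set of a nonzero homogeneous polynomial of degree at most $C$, and for each $\boldsymbol b\in\mathbb F_p^4$ a subset $\mathcal V_2^{bad}(\boldsymbol b)\subset\mathbb F_p^2$, the union of the zero sets of at most $C$ nonzero linear homogeneous polynomials in two variables, with the following property. For all $\boldsymbol b\in\mathbb Z^4$ with $\boldsymbol b\bmod p\notin\mathcal V^\Delta$ and all $\boldsymbol h\in\mathbb Z^2$, \[ \mathfrak S(\boldsymbol b,\boldsymbol h,1;p^2)\ll\begin{cases}p^4 & \text{if } \boldsymbol h\equiv(0,0)\pmod p,\\ p^4 & \text{if } (\boldsymbol b\bmod p,\boldsymbol h\bmod p)\in\mathcal V_4^{bad}\times\mathcal V_2^{bad}(\boldsymbol b\bmod p),\\ p^3&\text{otherwise},\end{cases} \] with an absolute implied constant.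
   Context: For integers $a$ and $q\ge1$, $\mathrm{Kl}_2(a;q)=q^{-1/2}\sum^*_{x \bmod q} e\big((ax+\bar{x})/q\big)$ (sum over residues coprime to $q$, $\bar x$ the inverse mod $q$, $e(z)=e^{2\pi iz}$), $e_q(x)=e(x/q)$. For $\boldsymbol b\in\mathbb Z^4$, $\boldsymbol h\in\mathbb Z^2$, \[ \mathfrak S(\boldsymbol b,\boldsymbol h,1;q)=\sum_{\substack{r,s_1,s_2\bmod q\\ (s_1-s_2,q)=1}}\prod_{i=1}^2\Big(e_q(h_is_i)\prod_{j=1}^4\mathrm{Kl}_2\big(s_i(r+b_j);q\big)\Big). \] $\mathcal V^\Delta\subset\mathbb F_p^4$ is the set of $(b_1,\dots,b_4)$ such that for every $i$ the number of $j$ with $b_j=b_i$ is even. *)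

theory Defs
  imports
    "HOL-Analysis.Analysis"
    "HOL-Algebra.Indexed_Polynomials"
    "HOL-Number_Theory.Number_Theory"
begin

text \<open>
  The prime varies inside the statement, so $\mathbf F_p$ is the ring \<^const>\<open>residue_ring\<close>
  on the integers \<open>0, \<dots>, p - 1\<close>, and tuples over it are integer vectors with entries in that
  range. The index types \<open>4\<close> and \<open>2\<close> have elements \<open>1, 2, 3, 4 = 0\<close> and \<open>1, 2 = 0\<close>.
\<close>

definition e_mod :: "nat \<Rightarrow> int \<Rightarrow> complex" where
  "e_mod q x = cis (2 * pi * real_of_int x / real q)"

definition Kl2 :: "int \<Rightarrow> nat \<Rightarrow> complex" where
  "Kl2 a q = of_real (1 / sqrt (real q)) *
     (\<Sum>x \<in> {x \<in> {0..<int q}. coprime x (int q)}. e_mod q (a * x + modular_inverse (int q) x))"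

text \<open>The sum $\mathfrak S(b, h, 1; q)$; only this value of the third argument is needed.\<close>

definition frakS1 :: "int ^ 4 \<Rightarrow> int ^ 2 \<Rightarrow> nat \<Rightarrow> complex" where
  "frakS1 b h q =
     (\<Sum>r \<in> {0..<int q}.
       \<Sum>s \<in> {s :: int ^ 2. (\<forall>i. s $ i \<in> {0..<int q}) \<and> coprime (s $ 1 - s $ 2) (int q)}.
         \<Prod>i\<in>UNIV. e_mod q (h $ i * s $ i) * (\<Prod>j\<in>UNIV. Kl2 (s $ i * (r + b $ j)) q))"

definition affine_space :: "('a, 'r) ring_scheme \<Rightarrow> ('a ^ 'n) set" where
  "affine_space R = {v. \<forall>i. v $ i \<in> carrier R}"

definition reduce_vec :: "nat \<Rightarrow> int ^ 'n \<Rightarrow> int ^ 'n" where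
  "reduce_vec p v = (\<chi> i. v $ i mod int p)"

definition diag_variety :: "nat \<Rightarrow> (int ^ 4) set" where
  "diag_variety p =
     {b \<in> affine_space (residue_ring (int p)). \<forall>i. even (card {j. b $ j = b $ i})}"

text \<open>
  Polynomials in the variables indexed by \<open>'n\<close> are those of \<^theory>\<open>HOL-Algebra.Indexed_Polynomials\<close>:
  functions from monomials (multisets of variables) to coefficients. That theory's
  \<open>indexed_eval\<close> is not evaluation at a point of the coefficient ring.
\<close>

definition poly_at :: "('a, 'r) ring_scheme \<Rightarrow> ('n::finite multiset \<Rightarrow> 'a) \<Rightarrow> 'a ^ 'n \<Rightarrow> 'a" where
  "poly_at R P v =
     (\<Oplus>\<^bsub>R\<^esub>m \<in> {m. P m \<noteq> \<zero>\<^bsub>R\<^esub>}.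
        P m \<otimes>\<^bsub>R\<^esub> (\<Otimes>\<^bsub>R\<^esub>i \<in> UNIV. (v $ i) [^]\<^bsub>R\<^esub> count m i))"

definition zero_set :: "('a, 'r) ring_scheme \<Rightarrow> ('n::finite multiset \<Rightarrow> 'a) \<Rightarrow> ('a ^ 'n) set" where
  "zero_set R P = {v \<in> affine_space R. poly_at R P v = \<zero>\<^bsub>R\<^esub>}"

definition nonzero_homogeneous ::
    "('a, 'r) ring_scheme \<Rightarrow> nat \<Rightarrow> ('n::finite multiset \<Rightarrow> 'a) \<Rightarrow> bool" where
  "nonzero_homogeneous R d P \<longleftrightarrow>
     P \<in> ring.indexed_pset R UNIV (carrier R) \<and>
     P \<noteq> ring.indexed_const R \<zero>\<^bsub>R\<^esub> \<and>
     (\<forall>m. P m \<noteq> \<zero>\<^bsub>R\<^esub> \<longrightarrow> size m = d)"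

end

(*
  Stationary phase modulo p^2, applied to the residues x_ij in the eight Kloosterman sums and to
  r, s_1, s_2, bounds the sum by p^3 times the number of critical points modulo p: writing
  a_j = r + b_j, these are the solutions of
    s_i a_j x_ij^2 = 1,  h_i + sum_j a_j x_ij = 0,  s_1 sum_j x_1j + s_2 sum_j x_2j = 0,  s_1 <> s_2.

  There are O(1) critical points for all b outside V^Delta and all h <> 0, and O(p) for h = 0, so
  both exceptional sets may be taken empty.  Indeed x_2j = tau eta_j x_1j with eta_j = 1 or -1, and
  eliminating tau gives
    h_2 (sum a_j x_j)(sum x_j) + h_1 (sum eta_j a_j x_j)(sum eta_j x_j) = 0,  where x_j = x_1j.
  Since x_j is a constant times (r + b_j)^(-1/2), this is an algebraic equation for r.  Square roots
  of r + beta for different beta are independent over F_p(r), so the equation bounds the number of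
  r unless all coefficients of the mixed products vanish; as some b_j differs from all others, that
  forces h_2 = -h_1 and tau^2 = 1, contradicting s_1 <> s_2.  For fixed r, a nonzero
  value of sum_j a_j x_ij or of s_i sum_j x_ij determines s_i up to 16 choices.
*)

theory Submission
  imports Defs
begin

section \<open>Stationary phase modulo $p^2$\<close>

text \<open>The obstacle is to make the independence of the square roots quantitative and uniform in
  p although some b_j may coincide modulo p. Coinciding b_j are merged first: their x_j agree up to
  sign, so each distinct residue y carries one unknown and integer coefficients m(y), n(y) of
  absolute value at most 4. The isolated b_j has coefficients 1 or -1, which is what prevents total
  cancellation. The merged relation is rationalised by an explicit \<open>resolvent\<close> of
  degree at most 16 in r, which is a multiple of p only if all coefficients of the relation are.

  If exactly one h_i vanishes, or both do, the relation of the overview degenerates. Then sum a_j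
  x_j = 0 is an equation for r by itself, and sum x_j cannot vanish at the same time unless the b_j
  fall into two equal pairs.

  Vanishing of all coefficients is a set of congruences between small integers, the largest at most
  4096 in absolute value; for p > 5000 they become equalities. Smaller primes use the trivial count
  256 p^3, and 5000^3 * 256 < 10^14 explains the final constant.\<close>

lemma e_mod_add: "e_mod q (x + y) = e_mod q x * e_mod q y"
  by (simp add: e_mod_def cis_mult add_divide_distrib algebra_simps)

lemma e_mod_0 [simp]: "e_mod q 0 = 1"
  by (simp add: e_mod_def)

lemma norm_e_mod [simp]: "norm (e_mod q x) = 1"
  by (simp add: e_mod_def)

lemma e_mod_sum: "e_mod q (\<Sum>i\<in>A. f i) = (\<Prod>i\<in>A. e_mod q (f i))"
  by (induction A rule: infinite_finite_induct) (simp_all add: e_mod_add)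

lemma e_mod_eq_1_iff:
  assumes "q > 0"
  shows "e_mod q x = 1 \<longleftrightarrow> int q dvd x"
proof
  assume "e_mod q x = 1"
  then have "cos (2 * pi * real_of_int x / real q) = 1"
    by (simp add: e_mod_def complex_eq_iff)
  then obtain k :: int where "2 * pi * real_of_int x / real q = of_int k * 2 * pi"
    by (auto simp: cos_one_2pi_int)
  then have "real_of_int x = real_of_int (int q * k)"
    using assms by (simp add: field_simps)
  then have "x = int q * k"
    by (simp only: of_int_eq_iff)
  then show "int q dvd x"
    by simp
next
  assume "int q dvd x"
  then obtain k where "x = int q * k" ..
  then have "2 * pi * real_of_int x / real q = 2 * pi * of_int k"
    using assms by simp
  then show "e_mod q x = 1"
    unfolding e_mod_def by (simp only:) (simp add: cis_multiple_2pi)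
qed

lemma e_mod_cong:
  assumes "q > 0" "[x = y] (mod int q)"
  shows "e_mod q x = e_mod q y"
proof -
  have "e_mod q (x - y) = 1"
    using assms by (simp add: e_mod_eq_1_iff cong_iff_dvd_diff)
  then show ?thesis
    using e_mod_add[of q "x - y" y] by simp
qed

lemma e_mod_square:
  assumes "p > 0"
  shows "e_mod (p\<^sup>2) (int p * x) = e_mod p x"
proof -
  have "2 * pi * real_of_int (int p * x) / real (p\<^sup>2) = 2 * pi * real_of_int x / real p"
    using assms by (simp add: power2_eq_square)
  then show ?thesis
    unfolding e_mod_def by (simp only:)
qed

lemma sum_e_mod:
  assumes "p > 0"
  shows "(\<Sum>y\<in>{0..<int p}. e_mod p (a * y)) = (if int p dvd a then of_nat p else 0)"
proof -
  define z where "z = e_mod p a"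
  have pow: "e_mod p (a * int k) = z ^ k" for k
    by (induction k) (simp_all add: z_def e_mod_add algebra_simps)
  have "(\<Sum>y\<in>{0..<int p}. e_mod p (a * y)) = (\<Sum>k<p. e_mod p (a * int k))"
    by (rule sum.reindex_bij_witness[of _ int nat]) auto
  also have "\<dots> = (\<Sum>k<p. z ^ k)"
    by (simp add: pow)
  also have "\<dots> = (if int p dvd a then of_nat p else 0)"
  proof (cases "int p dvd a")
    case True
    then have "z = 1" using assms by (simp add: z_def e_mod_eq_1_iff)
    then show ?thesis using True by simp
  next
    case False
    then have "z \<noteq> 1" using assms by (simp add: z_def e_mod_eq_1_iff)
    moreover have "z ^ p = 1"
      using pow[of p] assms by (simp add: e_mod_eq_1_iff flip: pow)
    ultimately show ?thesis using False by (simp add: geometric_sum)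
  qed
  finally show ?thesis .
qed

section \<open>Kloosterman sums modulo p^2\<close>

lemma sum_residues_square:
  fixes f :: "int \<Rightarrow> 'a::comm_monoid_add"
  assumes "p > 0"
  shows "(\<Sum>x\<in>{0..<int (p\<^sup>2)}. f x) = (\<Sum>x\<in>{0..<int p}. \<Sum>y\<in>{0..<int p}. f (x + int p * y))"
proof -
  have upper: "x + int p * y < int p * int p" if "x < int p" "y < int p" for x y
  proof -
    have "int p * (y + 1) \<le> int p * int p"
      using that assms by (intro mult_left_mono) auto
    then show ?thesis using that by (simp add: algebra_simps)
  qed
  have lower: "z div int p < int p" if "z < int p * int p" for z
    using that assms by (smt (verit) mult_left_mono mult_div_mod_eq of_nat_0_less_iff pos_mod_sign)
  have "(\<Sum>x\<in>{0..<int p}. \<Sum>y\<in>{0..<int p}. f (x + int p * y)) =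
      (\<Sum>(x, y)\<in>{0..<int p} \<times> {0..<int p}. f (x + int p * y))"
    by (rule sum.cartesian_product)
  also have "\<dots> = (\<Sum>x\<in>{0..<int (p\<^sup>2)}. f x)"
    using assms upper lower
    by (intro sum.reindex_bij_witness[of _ "\<lambda>z. (z mod int p, z div int p)" "\<lambda>(x, y). x + int p * y"])
       (auto simp: power2_eq_square pos_imp_zdiv_nonneg_iff)
  finally show ?thesis by simp
qed

text \<open>First-order Taylor expansion of 1/x: the next term carries (p y)^2, so only the linear
  term survives modulo p^2.\<close>

lemma modular_inverse_shift:
  fixes x y :: int
  assumes p: "p > 0" and x: "coprime x (int (p\<^sup>2))"
  defines "I \<equiv> modular_inverse (int (p\<^sup>2))"
  shows "[I (x + int p * y) = I x - int p * y * (I x)\<^sup>2] (mod int (p\<^sup>2))"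
proof -
  define w where "w = I x - int p * y * (I x)\<^sup>2"
  have "[x * I x = 1] (mod int (p\<^sup>2))"
    unfolding I_def using x by (rule cong_modular_inverse1)
  then obtain k where k: "x * I x = 1 + int p ^ 2 * k"
    by (metis cong_iff_lin cong_sym of_nat_power)
  have "(x + int p * y) * w = x * I x + int p * y * I x - int p * y * I x * (x * I x) - int p ^ 2 * (y * I x)\<^sup>2"
    unfolding w_def by (simp add: algebra_simps power2_eq_square)
  also have "\<dots> = 1 + int p ^ 2 * (k - int p * y * I x * k - (y * I x)\<^sup>2)"
    unfolding k by (simp add: algebra_simps power2_eq_square)
  finally have "[(x + int p * y) * w = 1] (mod int (p\<^sup>2))"
    by (simp add: cong_iff_dvd_diff)
  then have "[(x + int p * y) * (w mod int (p\<^sup>2)) = 1] (mod int (p\<^sup>2))"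
    by (simp add: cong_def mod_mult_right_eq)
  then have "I (x + int p * y) = w mod int (p\<^sup>2)"
    unfolding I_def using p by (intro modular_inverse_int_eqI) auto
  then show ?thesis by (simp add: w_def)
qed

text \<open>These are the zeros modulo p of a - x^(-2), the derivative of the phase a x + 1/x. Their
  representatives in 0..p-1 also serve as residues modulo p^2.\<close>

definition inverse_square_roots :: "nat \<Rightarrow> int \<Rightarrow> int set" where
  "inverse_square_roots p a = {x \<in> {0..<int p}. [a * x\<^sup>2 = 1] (mod int p)}"

lemma finite_inverse_square_roots [simp]: "finite (inverse_square_roots p a)"
  unfolding inverse_square_roots_def by (rule finite_subset[of _ "{0..<int p}"]) auto

lemma inverse_square_roots_cong:
  assumes "[a = a'] (mod int p)"
  shows "inverse_square_roots p a = inverse_square_roots p a'"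
  unfolding inverse_square_roots_def
  using cong_scalar_right[OF assms] by (auto intro: cong_trans cong_sym)

lemma coprime_of_inverse_square_root:
  fixes x :: int
  assumes "[a * x\<^sup>2 = 1] (mod m)"
  shows "coprime x m" "coprime a m"
  using cong_imp_coprime[OF cong_sym[OF assms]] by auto

text \<open>Stationary phase is exact here: on the class x + p y the phase is linear in y modulo
  p^2, so the sum over y gives p when x is critical and 0 otherwise. The factor p cancels q^(-1/2) =
  1/p.\<close>

lemma Kl2_square:
  assumes "Factorial_Ring.prime p"
  shows "Kl2 a (p\<^sup>2) = (\<Sum>x\<in>inverse_square_roots p a.
    e_mod (p\<^sup>2) (a * x + modular_inverse (int (p\<^sup>2)) x))"
proof -
  define I where "I = modular_inverse (int (p\<^sup>2))"
  define f where "f x = e_mod (p\<^sup>2) (a * x + I x)" for x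
  have p: "p > 0" using assms prime_gt_0_nat by blast
  have cop: "coprime (x + int p * y) (int (p\<^sup>2)) \<longleftrightarrow> coprime x (int (p\<^sup>2))" for x y
  proof -
    have "[x + int p * y = x] (mod int p)"
      by (simp add: cong_def)
    then show ?thesis
      by (metis coprime_power_right_iff cong_imp_coprime cong_sym of_nat_power zero_less_numeral)
  qed
  have inner: "(\<Sum>y\<in>{0..<int p}. if coprime (x + int p * y) (int (p\<^sup>2)) then f (x + int p * y) else 0)
      = (if [a * x\<^sup>2 = 1] (mod int p) then of_nat p * f x else 0)" for x
  proof (cases "coprime x (int (p\<^sup>2))")
    \<comment> \<open>If p divides x, the class contributes no term, and x is not critical either:
      both sides vanish.\<close>
    case False
    then have "\<not> [a * x\<^sup>2 = 1] (mod int p)"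
      using coprime_of_inverse_square_root(1)[of a x "int p"] by auto
    with False show ?thesis by (simp only: cop) simp
  next
    case True
    then have xI: "[x * I x = 1] (mod int p)"
      unfolding I_def by (metis cong_modular_inverse1 cong_modulus_mult of_nat_mult power2_eq_square)
    have "f (x + int p * y) = f x * e_mod p ((a - (I x)\<^sup>2) * y)" for y
    proof -
      have "[a * (x + int p * y) + I (x + int p * y) =
          (a * x + I x) + int p * ((a - (I x)\<^sup>2) * y)] (mod int (p\<^sup>2))"
      proof -
        have "[a * (x + int p * y) + I (x + int p * y) =
            a * (x + int p * y) + (I x - int p * y * (I x)\<^sup>2)] (mod int (p\<^sup>2))"
          unfolding I_def by (intro cong_add cong_refl modular_inverse_shift p True)
        then show ?thesis by (simp add: algebra_simps)
      qed
      then show ?thesis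
        unfolding f_def using p by (subst e_mod_cong) (auto simp: e_mod_add e_mod_square)
    qed
    then have "(\<Sum>y\<in>{0..<int p}. f (x + int p * y)) =
        f x * (\<Sum>y\<in>{0..<int p}. e_mod p ((a - (I x)\<^sup>2) * y))"
      by (simp add: sum_distrib_left)
    also have "\<dots> = f x * (if int p dvd a - (I x)\<^sup>2 then of_nat p else 0)"
      using p by (simp only: sum_e_mod)
    also have "int p dvd a - (I x)\<^sup>2 \<longleftrightarrow> [a * x\<^sup>2 = 1] (mod int p)"
    proof
      assume "int p dvd a - (I x)\<^sup>2"
      then have "[a * x\<^sup>2 = (I x)\<^sup>2 * x\<^sup>2] (mod int p)"
        by (intro cong_mult) (auto simp: cong_iff_dvd_diff)
      also have "(I x)\<^sup>2 * x\<^sup>2 = (x * I x)\<^sup>2" by (simp add: power_mult_distrib)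
      also have "[(x * I x)\<^sup>2 = 1\<^sup>2] (mod int p)" by (intro cong_pow xI)
      finally show "[a * x\<^sup>2 = 1] (mod int p)" by simp
    next
      assume "[a * x\<^sup>2 = 1] (mod int p)"
      then have "[(a * x\<^sup>2) * (I x)\<^sup>2 = 1 * (I x)\<^sup>2] (mod int p)"
        by (intro cong_mult) auto
      moreover have "[a * (x * I x)\<^sup>2 = a * 1\<^sup>2] (mod int p)" by (intro cong_mult cong_pow xI) auto
      ultimately have "[a = (I x)\<^sup>2] (mod int p)"
        by (simp add: power_mult_distrib mult.assoc) (meson cong_sym cong_trans)
      then show "int p dvd a - (I x)\<^sup>2" by (simp add: cong_iff_dvd_diff)
    qed
    finally show ?thesis using True by (simp only: cop) (simp add: mult.commute)
  qed
  have "(\<Sum>x\<in>{x \<in> {0..<int (p\<^sup>2)}. coprime x (int (p\<^sup>2))}. f x) =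
      (\<Sum>x\<in>{0..<int (p\<^sup>2)}. if coprime x (int (p\<^sup>2)) then f x else 0)"
    by (rule sum.inter_filter) simp
  also have "\<dots> = (\<Sum>x\<in>{0..<int p}. if [a * x\<^sup>2 = 1] (mod int p) then of_nat p * f x else 0)"
    using p by (subst sum_residues_square) (simp_all only: inner)
  also have "\<dots> = (\<Sum>x\<in>inverse_square_roots p a. of_nat p * f x)"
    unfolding inverse_square_roots_def by (rule sum.inter_filter[symmetric]) simp
  finally have "Kl2 a (p\<^sup>2) = of_real (1 / sqrt (real (p\<^sup>2))) * (of_nat p * (\<Sum>x\<in>inverse_square_roots p a. f x))"
    unfolding Kl2_def f_def I_def by (simp only: sum_distrib_left)
  then show ?thesis
    using p by (simp add: f_def I_def)
qed

section \<open>Shifting r and s by multiples of p\<close>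

definition phase :: "nat \<Rightarrow> ('n::finite \<Rightarrow> int) \<Rightarrow> int \<Rightarrow> int \<Rightarrow> int \<Rightarrow> ('n \<Rightarrow> int) \<Rightarrow> int" where
  "phase p b h r s x =
     h * s + (\<Sum>j\<in>UNIV. s * (r + b j) * x j + modular_inverse (int (p\<^sup>2)) (x j))"

definition root_tuples :: "nat \<Rightarrow> ('n::finite \<Rightarrow> int) \<Rightarrow> int \<Rightarrow> int \<Rightarrow> ('n \<Rightarrow> int) set" where
  "root_tuples p b r s = (\<Pi>\<^sub>E j\<in>UNIV. inverse_square_roots p (s * (r + b j)))"

lemma finite_root_tuples [simp]: "finite (root_tuples p b r s)"
  unfolding root_tuples_def by (intro finite_PiE) auto

text \<open>The square roots see r and s only modulo p, so they stay fixed when r and s move by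
  multiples of p; only the explicit dependence of \<open>phase\<close> on r and s has to be
  expanded.\<close>

lemma root_tuples_shift:
  "root_tuples p b (r + int p * \<rho>) (s + int p * \<sigma>) = root_tuples p b r s"
proof -
  have "[(s + int p * \<sigma>) * (r + int p * \<rho> + b j) = s * (r + b j)] (mod int p)" for j
    unfolding cong_iff_lin
    by (rule exI[of _ "- \<sigma> * (r + int p * \<rho> + b j) - s * \<rho>"]) (simp add: algebra_simps)
  then show ?thesis
    unfolding root_tuples_def using inverse_square_roots_cong by metis
qed

lemma Kl2_product:
  fixes b :: "'n::finite \<Rightarrow> int"
  assumes "Factorial_Ring.prime p"
  shows "e_mod (p\<^sup>2) (h * s) * (\<Prod>j\<in>UNIV. Kl2 (s * (r + b j)) (p\<^sup>2)) =
    (\<Sum>x\<in>root_tuples p b r s. e_mod (p\<^sup>2) (phase p b h r s x))"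
  unfolding root_tuples_def phase_def
  by (simp only: Kl2_square[OF assms] e_mod_add e_mod_sum)
     (subst prod_sum_PiE, simp_all add: sum_distrib_left)

text \<open>For fixed x the phase is affine in r and in s separately, so the expansion is finite and
  its mixed term has the factor p^2. The two frequencies are the partial derivatives in r and in
  s.\<close>

lemma phase_shift:
  assumes "p > 0"
  shows "e_mod (p\<^sup>2) (phase p b h (r + int p * \<rho>) (s + int p * \<sigma>) x) =
    e_mod (p\<^sup>2) (phase p b h r s x) * e_mod p ((s * (\<Sum>j\<in>UNIV. x j)) * \<rho>) *
    e_mod p ((h + (\<Sum>j\<in>UNIV. (r + b j) * x j)) * \<sigma>)"
proof -
  have "phase p b h (r + int p * \<rho>) (s + int p * \<sigma>) x =
      phase p b h r s x + int p * ((s * (\<Sum>j\<in>UNIV. x j)) * \<rho>)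
      + int p * ((h + (\<Sum>j\<in>UNIV. (r + b j) * x j)) * \<sigma>)
      + int p ^ 2 * (\<rho> * \<sigma> * (\<Sum>j\<in>UNIV. x j))"
    unfolding phase_def
    by (simp add: algebra_simps power2_eq_square sum.distrib sum_distrib_left)
  then have "[phase p b h (r + int p * \<rho>) (s + int p * \<sigma>) x =
      phase p b h r s x + int p * ((s * (\<Sum>j\<in>UNIV. x j)) * \<rho>)
      + int p * ((h + (\<Sum>j\<in>UNIV. (r + b j) * x j)) * \<sigma>)] (mod int (p\<^sup>2))"
    by (simp add: cong_iff_dvd_diff)
  then show ?thesis
    using assms by (subst e_mod_cong) (auto simp: e_mod_add e_mod_square)
qed

text \<open>Stationarity in s only. The condition coming from r couples the two variables s_1, s_2
  and is imposed in \<open>critical_points\<close>.\<close>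

definition critical_tuples :: "nat \<Rightarrow> ('n::finite \<Rightarrow> int) \<Rightarrow> int \<Rightarrow> int \<Rightarrow> int \<Rightarrow> ('n \<Rightarrow> int) set" where
  "critical_tuples p b h r s =
     {x \<in> root_tuples p b r s. int p dvd h + (\<Sum>j\<in>UNIV. (r + b j) * x j)}"

lemma finite_critical_tuples [simp]: "finite (critical_tuples p b h r s)"
  by (simp add: critical_tuples_def)

lemma sum_phase_shift:
  fixes b :: "'n::finite \<Rightarrow> int"
  assumes "p > 0"
  shows "(\<Sum>\<sigma>\<in>{0..<int p}. \<Sum>x\<in>root_tuples p b (r + int p * \<rho>) (s + int p * \<sigma>).
      e_mod (p\<^sup>2) (phase p b h (r + int p * \<rho>) (s + int p * \<sigma>) x)) =
    of_nat p * (\<Sum>x\<in>critical_tuples p b h r s.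
      e_mod (p\<^sup>2) (phase p b h r s x) * e_mod p ((s * (\<Sum>j\<in>UNIV. x j)) * \<rho>))"
proof -
  have "(\<Sum>\<sigma>\<in>{0..<int p}. \<Sum>x\<in>root_tuples p b (r + int p * \<rho>) (s + int p * \<sigma>).
      e_mod (p\<^sup>2) (phase p b h (r + int p * \<rho>) (s + int p * \<sigma>) x)) =
    (\<Sum>x\<in>root_tuples p b r s. e_mod (p\<^sup>2) (phase p b h r s x) * e_mod p ((s * (\<Sum>j\<in>UNIV. x j)) * \<rho>) *
      (\<Sum>\<sigma>\<in>{0..<int p}. e_mod p ((h + (\<Sum>j\<in>UNIV. (r + b j) * x j)) * \<sigma>)))"
    using assms by (simp only: root_tuples_shift phase_shift sum_distrib_left) (rule sum.swap)
  also have "\<dots> = (\<Sum>x\<in>root_tuples p b r s. if int p dvd h + (\<Sum>j\<in>UNIV. (r + b j) * x j)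
      then of_nat p * (e_mod (p\<^sup>2) (phase p b h r s x) * e_mod p ((s * (\<Sum>j\<in>UNIV. x j)) * \<rho>)) else 0)"
    using assms by (intro sum.cong refl) (simp add: sum_e_mod)
  also have "\<dots> = (\<Sum>x\<in>critical_tuples p b h r s.
      of_nat p * (e_mod (p\<^sup>2) (phase p b h r s x) * e_mod p ((s * (\<Sum>j\<in>UNIV. x j)) * \<rho>)))"
    unfolding critical_tuples_def by (rule sum.inter_filter[symmetric]) simp
  finally show ?thesis by (simp add: sum_distrib_left)
qed

text \<open>The last divisibility is stationarity in the shared variable r. All entries are reduced
  representatives, so the cardinality counts solutions modulo p.\<close>

definition critical_points ::
    "nat \<Rightarrow> ('n::finite \<Rightarrow> int) \<Rightarrow> int \<Rightarrow> int \<Rightarrow> ((int \<times> int \<times> int) \<times> ('n \<Rightarrow> int) \<times> ('n \<Rightarrow> int)) set" where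
  "critical_points p b h h' =
     (SIGMA (r, s, s') : {(r, s, s'). r \<in> {0..<int p} \<and> s \<in> {0..<int p} \<and> s' \<in> {0..<int p} \<and>
         \<not> [s = s'] (mod int p)}.
       {(x, x'). x \<in> critical_tuples p b h r s \<and> x' \<in> critical_tuples p b h' r s' \<and>
         int p dvd s * (\<Sum>j\<in>UNIV. x j) + s' * (\<Sum>j\<in>UNIV. x' j)})"

section \<open>From the exponential sum to the number of critical points\<close>

lemma sum_int_vec_2:
  "(\<Sum>s \<in> {s :: int ^ 2. (\<forall>i. s $ i \<in> A) \<and> Q (s $ 1) (s $ 2)}. f (s $ 1) (s $ 2)) =
   (\<Sum>(s, s') \<in> {(s, s'). s \<in> A \<and> s' \<in> A \<and> Q s s'}. f s s')"
  by (rule sum.reindex_bij_witness[of _ "\<lambda>(s, s'). vector [s, s']" "\<lambda>s. (s $ 1, s $ 2)"])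
     (auto simp: forall_2 vec_eq_iff)

lemma prod_2: "(\<Prod>i\<in>(UNIV::2 set). f i) = f 1 * f 2"
  by (simp add: UNIV_2)

lemma frakS1_eq:
  assumes "Factorial_Ring.prime p"
  shows "frakS1 b h (p\<^sup>2) =
    (\<Sum>r\<in>{0..<int (p\<^sup>2)}. \<Sum>s\<in>{0..<int (p\<^sup>2)}. \<Sum>s'\<in>{0..<int (p\<^sup>2)}.
      if coprime (s - s') (int (p\<^sup>2)) then
        (\<Sum>x\<in>root_tuples p (($) b) r s. e_mod (p\<^sup>2) (phase p (($) b) (h $ 1) r s x)) *
        (\<Sum>x\<in>root_tuples p (($) b) r s'. e_mod (p\<^sup>2) (phase p (($) b) (h $ 2) r s' x))
      else 0)"
proof -
  let ?T = "\<lambda>i r s. \<Sum>x\<in>root_tuples p (($) b) r s. e_mod (p\<^sup>2) (phase p (($) b) (h $ i) r s x)"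
  have *: "(\<Sum>s \<in> {s :: int ^ 2. (\<forall>i. s $ i \<in> {0..<int (p\<^sup>2)}) \<and> coprime (s $ 1 - s $ 2) (int (p\<^sup>2))}.
      ?T 1 r (s $ 1) * ?T 2 r (s $ 2)) =
    (\<Sum>s\<in>{0..<int (p\<^sup>2)}. \<Sum>s'\<in>{0..<int (p\<^sup>2)}.
      if coprime (s - s') (int (p\<^sup>2)) then ?T 1 r s * ?T 2 r s' else 0)" for r
  proof -
    have "(\<Sum>s \<in> {s :: int ^ 2. (\<forall>i. s $ i \<in> {0..<int (p\<^sup>2)}) \<and> coprime (s $ 1 - s $ 2) (int (p\<^sup>2))}.
        ?T 1 r (s $ 1) * ?T 2 r (s $ 2)) =
      (\<Sum>(s, s') \<in> {(s, s'). s \<in> {0..<int (p\<^sup>2)} \<and> s' \<in> {0..<int (p\<^sup>2)} \<and> coprime (s - s') (int (p\<^sup>2))}.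
        ?T 1 r s * ?T 2 r s')"
      by (rule sum_int_vec_2)
    also have "{(s, s'). s \<in> {0..<int (p\<^sup>2)} \<and> s' \<in> {0..<int (p\<^sup>2)} \<and> coprime (s - s') (int (p\<^sup>2))} =
      {z \<in> {0..<int (p\<^sup>2)} \<times> {0..<int (p\<^sup>2)}. coprime (fst z - snd z) (int (p\<^sup>2))}"
      by auto
    also have "(\<Sum>(s, s') \<in> \<dots>. ?T 1 r s * ?T 2 r s') =
      (\<Sum>z\<in>{0..<int (p\<^sup>2)} \<times> {0..<int (p\<^sup>2)}. if coprime (fst z - snd z) (int (p\<^sup>2))
        then case z of (s, s') \<Rightarrow> ?T 1 r s * ?T 2 r s' else 0)"
      by (rule sum.inter_filter) simp
    also have "\<dots> = (\<Sum>(s, s')\<in>{0..<int (p\<^sup>2)} \<times> {0..<int (p\<^sup>2)}.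
        if coprime (s - s') (int (p\<^sup>2)) then ?T 1 r s * ?T 2 r s' else 0)"
      by (intro sum.cong) auto
    finally show ?thesis by (simp only: sum.cartesian_product)
  qed
  show ?thesis
    unfolding frakS1_def prod_2 Kl2_product[OF assms, where b = "($) b"] * ..
qed

text \<open>Both factors depend on the same shift of r, so there is one character sum per pair of
  tuples: multiplied out, the pair has a single frequency and contributes p or 0 times a number of
  modulus 1.\<close>

lemma norm_sum_shifts_le:
  fixes b :: "'n::finite \<Rightarrow> int"
  assumes p: "p > 0"
  shows "norm (\<Sum>\<rho>\<in>{0..<int p}.
      (\<Sum>x\<in>critical_tuples p b h r s.
        e_mod (p\<^sup>2) (phase p b h r s x) * e_mod p ((s * (\<Sum>j\<in>UNIV. x j)) * \<rho>)) *
      (\<Sum>x\<in>critical_tuples p b h' r s'.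
        e_mod (p\<^sup>2) (phase p b h' r s' x) * e_mod p ((s' * (\<Sum>j\<in>UNIV. x j)) * \<rho>)))
    \<le> real p * card {(x, x'). x \<in> critical_tuples p b h r s \<and> x' \<in> critical_tuples p b h' r s' \<and>
         int p dvd s * (\<Sum>j\<in>UNIV. x j) + s' * (\<Sum>j\<in>UNIV. x' j)}"
    (is "norm ?L \<le> real p * card ?Z")
proof -
  define A where "A = critical_tuples p b h r s"
  define A' where "A' = critical_tuples p b h' r s'"
  define C where "C = A \<times> A'"
  define E where "E z = e_mod (p\<^sup>2) (phase p b h r s (fst z)) * e_mod (p\<^sup>2) (phase p b h' r s' (snd z))" for z
  define D where "D z = s * (\<Sum>j\<in>UNIV. fst z j) + s' * (\<Sum>j\<in>UNIV. snd z j)" for z :: "('n \<Rightarrow> int) \<times> ('n \<Rightarrow> int)"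
  have finC: "finite C" by (simp add: C_def A_def A'_def)
  have "?L = (\<Sum>\<rho>\<in>{0..<int p}. \<Sum>z\<in>C. E z * e_mod p (D z * \<rho>))"
    unfolding A_def[symmetric] A'_def[symmetric] C_def E_def D_def sum_product sum.cartesian_product
      split_beta distrib_right e_mod_add
    by (intro sum.cong refl) (simp only: ac_simps)
  also have "\<dots> = (\<Sum>z\<in>C. E z * (\<Sum>\<rho>\<in>{0..<int p}. e_mod p (D z * \<rho>)))"
    unfolding sum_distrib_left by (rule sum.swap)
  also have "\<dots> = (\<Sum>z\<in>C. if int p dvd D z then E z * of_nat p else 0)"
    using p by (intro sum.cong refl) (simp only: sum_e_mod, simp)
  also have "\<dots> = (\<Sum>z\<in>{z \<in> C. int p dvd D z}. E z * of_nat p)"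
    using finC by (rule sum.inter_filter[symmetric])
  also have "norm \<dots> \<le> (\<Sum>z\<in>{z \<in> C. int p dvd D z}. real p)"
    by (intro sum_norm_le) (simp add: E_def norm_mult)
  also have "{z \<in> C. int p dvd D z} = ?Z"
    unfolding C_def A_def A'_def D_def by force
  finally show ?thesis by (simp add: mult.commute)
qed

text \<open>Each of the three shifts, of r, s_1 and s_2, contributes one factor p. The critical
  points themselves are estimated trivially, by the triangle inequality.\<close>

lemma norm_frakS1_le:
  assumes "Factorial_Ring.prime p"
  shows "norm (frakS1 b h (p\<^sup>2)) \<le> real p ^ 3 * card (critical_points p (($) b) (h $ 1) (h $ 2))"
proof -
  have p: "p > 0" using assms prime_gt_0_nat by blast
  define b' where "b' = ($) b"
  define P where "P = {0..<int p}"
  define T where "T h r s = (\<Sum>x\<in>root_tuples p b' r s. e_mod (p\<^sup>2) (phase p b' h r s x))" for h r s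
  define U where "U h r \<rho> s = (\<Sum>x\<in>critical_tuples p b' h r s.
      e_mod (p\<^sup>2) (phase p b' h r s x) * e_mod p ((s * (\<Sum>j\<in>UNIV. x j)) * \<rho>))" for h r \<rho> s
  define Z where "Z r s s' = {(x, x'). x \<in> critical_tuples p b' (h $ 1) r s \<and>
      x' \<in> critical_tuples p b' (h $ 2) r s' \<and>
      int p dvd s * (\<Sum>j\<in>UNIV. x j) + s' * (\<Sum>j\<in>UNIV. x' j)}" for r s s'
  have finZ: "finite (Z r s s')" for r s s'
    unfolding Z_def by (rule finite_subset[of _ "critical_tuples p b' (h $ 1) r s \<times> critical_tuples p b' (h $ 2) r s'"]) auto
  have T: "(\<Sum>\<sigma>\<in>P. T h (r + int p * \<rho>) (s + int p * \<sigma>)) = of_nat p * U h r \<rho> s" for h r \<rho> s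
    unfolding T_def U_def P_def using p by (rule sum_phase_shift)
  have cop: "coprime (s + int p * \<sigma> - (s' + int p * \<sigma>')) (int (p\<^sup>2)) \<longleftrightarrow> \<not> [s = s'] (mod int p)"
    for s \<sigma> s' \<sigma>'
  proof -
    have "coprime z (int (p\<^sup>2)) \<longleftrightarrow> \<not> int p dvd z" for z
    proof -
      have "coprime z (int (p\<^sup>2)) \<longleftrightarrow> coprime (int p) z"
        by (simp add: coprime_commute)
      also have "\<dots> \<longleftrightarrow> \<not> int p dvd z"
      proof
        assume "coprime (int p) z"
        then show "\<not> int p dvd z"
          using assms by (auto dest: coprime_common_divisor[of _ _ "int p"] simp: prime_gt_1_nat)
      next
        assume "\<not> int p dvd z"
        then show "coprime (int p) z"
          using assms by (intro prime_imp_coprime) auto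
      qed
      finally show ?thesis .
    qed
    then have "coprime (s + int p * \<sigma> - (s' + int p * \<sigma>')) (int (p\<^sup>2)) \<longleftrightarrow>
        \<not> int p dvd s + int p * \<sigma> - (s' + int p * \<sigma>')" .
    moreover have "s + int p * \<sigma> - (s' + int p * \<sigma>') = (s - s') + int p * (\<sigma> - \<sigma>')"
      by (simp add: algebra_simps)
    then have "int p dvd s + int p * \<sigma> - (s' + int p * \<sigma>') \<longleftrightarrow> [s = s'] (mod int p)"
      by (simp only: cong_iff_dvd_diff) (simp add: dvd_add_left_iff)
    ultimately show ?thesis by simp
  qed
  have "frakS1 b h (p\<^sup>2) =
      (\<Sum>r\<in>{0..<int (p\<^sup>2)}. \<Sum>s\<in>{0..<int (p\<^sup>2)}. \<Sum>s'\<in>{0..<int (p\<^sup>2)}.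
        if coprime (s - s') (int (p\<^sup>2)) then T (h $ 1) r s * T (h $ 2) r s' else 0)"
    unfolding T_def b'_def using assms by (rule frakS1_eq)
  also have "\<dots> = (\<Sum>r\<in>P. \<Sum>\<rho>\<in>P. \<Sum>s\<in>P. \<Sum>\<sigma>\<in>P. \<Sum>s'\<in>P. \<Sum>\<sigma>'\<in>P.
      if \<not> [s = s'] (mod int p) then
        T (h $ 1) (r + int p * \<rho>) (s + int p * \<sigma>) * T (h $ 2) (r + int p * \<rho>) (s' + int p * \<sigma>')
      else 0)"
    by (simp only: sum_residues_square[OF p] cop P_def)
  also have "\<dots> = (\<Sum>r\<in>P. \<Sum>\<rho>\<in>P. \<Sum>s\<in>P. \<Sum>s'\<in>P. \<Sum>\<sigma>\<in>P. \<Sum>\<sigma>'\<in>P.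
      if \<not> [s = s'] (mod int p) then
        T (h $ 1) (r + int p * \<rho>) (s + int p * \<sigma>) * T (h $ 2) (r + int p * \<rho>) (s' + int p * \<sigma>')
      else 0)"
    by (rule sum.cong[OF refl], rule sum.cong[OF refl], rule sum.cong[OF refl], rule sum.swap)
  \<comment> \<open>The coprimality condition depends on s and s' modulo p only, so the sums over
    the two shifts of s and s' separate into a product.\<close>
  also have "\<dots> = (\<Sum>r\<in>P. \<Sum>\<rho>\<in>P. \<Sum>s\<in>P. \<Sum>s'\<in>P.
      if \<not> [s = s'] (mod int p) then
        (\<Sum>\<sigma>\<in>P. T (h $ 1) (r + int p * \<rho>) (s + int p * \<sigma>)) *
        (\<Sum>\<sigma>'\<in>P. T (h $ 2) (r + int p * \<rho>) (s' + int p * \<sigma>'))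
      else 0)"
    by (intro sum.cong refl) (simp add: sum_product)
  also have "\<dots> = (\<Sum>r\<in>P. \<Sum>\<rho>\<in>P. \<Sum>s\<in>P. \<Sum>s'\<in>P.
      if \<not> [s = s'] (mod int p) then of_nat p ^ 2 * (U (h $ 1) r \<rho> s * U (h $ 2) r \<rho> s') else 0)"
    unfolding T by (intro sum.cong refl) (simp add: power2_eq_square mult_ac)
  \<comment> \<open>The shift of r occurs in both factors and is summed last, after s and s' have
    been fixed.\<close>
  also have "\<dots> = (\<Sum>r\<in>P. \<Sum>s\<in>P. \<Sum>s'\<in>P. \<Sum>\<rho>\<in>P.
      if \<not> [s = s'] (mod int p) then of_nat p ^ 2 * (U (h $ 1) r \<rho> s * U (h $ 2) r \<rho> s') else 0)"
    by (rule sum.cong[OF refl], subst sum.swap, rule sum.cong[OF refl], rule sum.swap)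
  also have "norm \<dots> \<le> (\<Sum>r\<in>P. \<Sum>s\<in>P. \<Sum>s'\<in>P.
      if \<not> [s = s'] (mod int p) then real p ^ 3 * card (Z r s s') else 0)"
  proof (intro sum_norm_le)
    fix r s s'
    have "norm (\<Sum>\<rho>\<in>P. U (h $ 1) r \<rho> s * U (h $ 2) r \<rho> s') \<le> real p * card (Z r s s')"
      unfolding U_def P_def Z_def using p by (rule norm_sum_shifts_le)
    then have "real p ^ 2 * norm (\<Sum>\<rho>\<in>P. U (h $ 1) r \<rho> s * U (h $ 2) r \<rho> s') \<le>
        real p ^ 2 * (real p * card (Z r s s'))"
      by (intro mult_left_mono) auto
    then show "norm (\<Sum>\<rho>\<in>P. if \<not> [s = s'] (mod int p)
          then of_nat p ^ 2 * (U (h $ 1) r \<rho> s * U (h $ 2) r \<rho> s') else 0)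
        \<le> (if \<not> [s = s'] (mod int p) then real p ^ 3 * card (Z r s s') else 0)"
      by (simp add: norm_mult norm_power power2_eq_square power3_eq_cube mult.assoc flip: sum_distrib_left)
  qed
  also have "\<dots> = (\<Sum>z\<in>P \<times> P \<times> P. if \<not> [fst (snd z) = snd (snd z)] (mod int p)
      then real p ^ 3 * card (Z (fst z) (fst (snd z)) (snd (snd z))) else 0)"
    by (simp add: sum.cartesian_product split_beta)
  also have "\<dots> = (\<Sum>z\<in>{z \<in> P \<times> P \<times> P. \<not> [fst (snd z) = snd (snd z)] (mod int p)}.
      real p ^ 3 * card (Z (fst z) (fst (snd z)) (snd (snd z))))"
    by (rule sum.inter_filter[symmetric]) (simp add: P_def)
  also have "{z \<in> P \<times> P \<times> P. \<not> [fst (snd z) = snd (snd z)] (mod int p)} =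
      {(r, s, s'). r \<in> P \<and> s \<in> P \<and> s' \<in> P \<and> \<not> [s = s'] (mod int p)}" (is "_ = ?W")
    by auto
  also have "(\<Sum>z\<in>?W. real p ^ 3 * card (Z (fst z) (fst (snd z)) (snd (snd z)))) =
      real p ^ 3 * real (\<Sum>z\<in>?W. card (Z (fst z) (fst (snd z)) (snd (snd z))))"
    by (simp add: sum_distrib_left)
  also have "(\<Sum>z\<in>?W. card (Z (fst z) (fst (snd z)) (snd (snd z)))) =
      card (SIGMA z : ?W. Z (fst z) (fst (snd z)) (snd (snd z)))"
  proof -
    have "finite ?W" by (rule finite_subset[of _ "P \<times> P \<times> P"]) (auto simp: P_def)
    then show ?thesis using finZ by (subst card_SigmaI) auto
  qed
  also have "(SIGMA z : ?W. Z (fst z) (fst (snd z)) (snd (snd z))) =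
      critical_points p (($) b) (h $ 1) (h $ 2)"
    unfolding critical_points_def Z_def P_def b'_def by auto
  finally show ?thesis .
qed

section \<open>Eliminating square roots of linear polynomials modulo $p$\<close>

text \<open>Since p is a variable, F_p[r] is modelled by integer polynomials modulo the constant
  polynomial p; its being a prime element replaces the absence of zero divisors in F_p[r].\<close>

lemma prime_elem_const_poly_int:
  assumes "Factorial_Ring.prime p"
  shows "prime_elem [:int p:]"
  using assms by (intro lift_prime_elem_poly) auto

lemma poly_dvd_of_const_poly_dvd:
  assumes "[:c:] dvd f"
  shows "(c :: int) dvd poly f r"
  using assms by (auto elim!: dvdE)

lemma not_const_poly_dvd_monic_linear:
  assumes "Factorial_Ring.prime p"
  shows "\<not> [:int p:] dvd [:a, 1:]"
proof
  assume "[:int p:] dvd [:a, 1:]"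
  then have "int p dvd Polynomial.coeff [:a, 1:] 1"
    by (subst (asm) const_poly_dvd_iff) blast
  then show False using assms by (simp add: prime_nat_iff)
qed

text \<open>Lagrange's bound over F_p. The degree is that of the integer lift; leading coefficients
  divisible by p only weaken the bound. A root a is split off by synthetic division, whose remainder
  is divisible by p.\<close>

lemma card_roots_mod_prime:
  assumes p: "Factorial_Ring.prime p" and "\<not> [:int p:] dvd G"
  shows "card {r \<in> {0..<int p}. int p dvd poly G r} \<le> Polynomial.degree G"
  using assms(2)
proof (induction "Polynomial.degree G" arbitrary: G)
  case 0
  then obtain c where c: "G = [:c:]"
    by (metis degree_eq_zeroE)
  with 0 have "\<not> int p dvd c" by simp
  then show ?case by (simp add: c)
next
  case (Suc n)
  show ?case
  proof (cases "\<exists>a\<in>{0..<int p}. int p dvd poly G a")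
    case False
    then have "{r \<in> {0..<int p}. int p dvd poly G r} = {}" by auto
    then show ?thesis by (simp only: card.empty)
  next
    case True
    then obtain a where a: "int p dvd poly G a" by auto
    define Q where "Q = synthetic_div G a"
    have G: "G = [:- a, 1:] * Q + [:poly G a:]"
      unfolding Q_def by (rule synthetic_div_correct'[symmetric])
    have dQ: "Polynomial.degree Q = n"
      using Suc.hyps(2) by (simp add: Q_def degree_synthetic_div)
    have "\<not> [:int p:] dvd Q"
    proof
      assume "[:int p:] dvd Q"
      then have "[:int p:] dvd [:- a, 1:] * Q + [:poly G a:]"
        using a by (intro dvd_add dvd_mult) simp_all
      then show False using Suc.prems G by simp
    qed
    with Suc.hyps(1)[of Q] dQ have IH: "card {r \<in> {0..<int p}. int p dvd poly Q r} \<le> n"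
      by simp
    have "{r \<in> {0..<int p}. int p dvd poly G r} \<subseteq>
        insert (a mod int p) {r \<in> {0..<int p}. int p dvd poly Q r}"
    proof
      fix r assume r: "r \<in> {r \<in> {0..<int p}. int p dvd poly G r}"
      have "poly G r = (r - a) * poly Q r + poly G a"
        by (subst G) (simp add: algebra_simps)
      with r a have "int p dvd (r - a) * poly Q r"
        by (simp add: dvd_add_left_iff)
      then consider "int p dvd r - a" | "int p dvd poly Q r"
        using p by (auto simp: prime_dvd_mult_iff)
      then show "r \<in> insert (a mod int p) {r \<in> {0..<int p}. int p dvd poly Q r}"
        using r by cases (auto simp: mod_eq_dvd_iff[symmetric])
    qed
    moreover have fin: "finite {r \<in> {0..<int p}. int p dvd poly Q r}"
      by (rule finite_subset[of _ "{0..<int p}"]) auto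
    ultimately have "card {r \<in> {0..<int p}. int p dvd poly G r} \<le>
        card (insert (a mod int p) {r \<in> {0..<int p}. int p dvd poly Q r})"
      by (intro card_mono) auto
    also have "\<dots> \<le> Suc (card {r \<in> {0..<int p}. int p dvd poly Q r})"
      by (simp only: card_insert_if[OF fin]) simp
    finally show ?thesis using IH Suc.hyps(2) by simp
  qed
qed

text \<open>The multiplicity of the root $-a$ modulo $p$ is even in $U^2$ and odd in the other term.\<close>

lemma square_eq_two_linear_square:
  fixes U V :: "int poly"
  assumes p: "Factorial_Ring.prime p" and ab: "\<not> [a = b] (mod int p)"
    and "[:int p:] dvd U\<^sup>2 - [:a, 1:] * [:b, 1:] * V\<^sup>2"
  shows "[:int p:] dvd U \<and> [:int p:] dvd V"
  using assms(3)
proof (induction "Polynomial.degree U + Polynomial.degree V" arbitrary: U V rule: less_induct)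
  case less
  define \<pi> where "\<pi> = [:int p:]"
  define A where "A = [:a, 1:]"
  define B where "B = [:b, 1:]"
  have prime: "prime_elem \<pi>"
    unfolding \<pi>_def using p by (rule prime_elem_const_poly_int)
  have notA: "\<not> \<pi> dvd A"
    unfolding \<pi>_def A_def using p by (rule not_const_poly_dvd_monic_linear)
  have pint: "prime_elem (int p)" using p by auto
  have dv: "\<pi> dvd U\<^sup>2 - A * B * V\<^sup>2"
    using less.prems by (simp add: \<pi>_def A_def B_def)
  define U' where "U' = synthetic_div U (- a)"
  define V' where "V' = synthetic_div V (- a)"
  have "int p dvd poly (U\<^sup>2 - A * B * V\<^sup>2) (- a)"
    using dv unfolding \<pi>_def by (rule poly_dvd_of_const_poly_dvd)
  then have "int p dvd (poly U (- a))\<^sup>2" by (simp add: A_def)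
  then have "int p dvd poly U (- a)" using pint by (simp add: prime_elem_dvd_power_iff)
  then obtain k where "poly U (- a) = int p * k" ..
  then have U: "U = A * U' + \<pi> * [:k:]"
    using synthetic_div_correct'[of "- a" U] by (simp add: A_def U'_def \<pi>_def mult.commute)
  have "U\<^sup>2 - A * B * V\<^sup>2 = A * (A * U'\<^sup>2 - B * V\<^sup>2) + \<pi> * (2 * A * U' * [:k:] + \<pi> * [:k:]\<^sup>2)"
    unfolding U by (simp add: power2_eq_square algebra_simps)
  with dv have "\<pi> dvd A * (A * U'\<^sup>2 - B * V\<^sup>2)"
    by (simp only: dvd_add_left_iff dvd_triv_left)
  then have dv2: "\<pi> dvd A * U'\<^sup>2 - B * V\<^sup>2"
    using prime notA by (auto simp: prime_elem_dvd_mult_iff)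
  \<comment> \<open>At -a the factor \<open>A\<close> vanishes while \<open>B\<close> takes the
    value b - a, nonzero modulo p, so \<open>V\<close> has to vanish there as well.\<close>
  have "int p dvd poly (A * U'\<^sup>2 - B * V\<^sup>2) (- a)"
    using dv2 unfolding \<pi>_def by (rule poly_dvd_of_const_poly_dvd)
  then have "int p dvd (a - b) * (poly V (- a))\<^sup>2" by (simp add: A_def B_def algebra_simps)
  then have "int p dvd poly V (- a)"
    using pint ab by (simp add: prime_elem_dvd_mult_iff prime_elem_dvd_power_iff cong_iff_dvd_diff)
  then obtain l where "poly V (- a) = int p * l" ..
  then have V: "V = A * V' + \<pi> * [:l:]"
    using synthetic_div_correct'[of "- a" V] by (simp add: A_def V'_def \<pi>_def mult.commute)
  have "A * U'\<^sup>2 - B * V\<^sup>2 = A * (U'\<^sup>2 - A * B * V'\<^sup>2) + \<pi> * (- B * (2 * A * V' * [:l:] + \<pi> * [:l:]\<^sup>2))"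
    unfolding V by (simp add: power2_eq_square algebra_simps)
  with dv2 have "\<pi> dvd A * (U'\<^sup>2 - A * B * V'\<^sup>2)"
    by (simp only: dvd_add_left_iff dvd_triv_left)
  then have dv3: "\<pi> dvd U'\<^sup>2 - A * B * V'\<^sup>2"
    using prime notA by (auto simp: prime_elem_dvd_mult_iff)
  \<comment> \<open>Descent: the quotients satisfy the original divisibility with smaller total
    degree. If both degrees are zero, synthetic division returns 0 and the claim is
    immediate.\<close>
  have "\<pi> dvd U' \<and> \<pi> dvd V'"
  proof (cases "Polynomial.degree U + Polynomial.degree V = 0")
    case True
    then have "U' = 0" "V' = 0"
      by (auto simp: U'_def V'_def synthetic_div_eq_0_iff)
    then show ?thesis by simp
  next
    case False
    then have "Polynomial.degree U' + Polynomial.degree V' < Polynomial.degree U + Polynomial.degree V"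
      by (auto simp: U'_def V'_def degree_synthetic_div)
    from less.hyps[OF this] dv3 show ?thesis by (simp add: \<pi>_def A_def B_def)
  qed
  then have "\<pi> dvd A * U' + \<pi> * [:k:]" "\<pi> dvd A * V' + \<pi> * [:l:]"
    by (auto intro!: dvd_add dvd_mult simp del: mult_pCons_right)
  then have "\<pi> dvd U" "\<pi> dvd V"
    by (simp_all only: U[symmetric] V[symmetric])
  then show ?case by (simp add: \<pi>_def)
qed

section \<open>Rationalising a relation between four square roots\<close>

text \<open>
  Let $a_k = s w_k^2$. The relation to be rationalised, the left-hand side of \<open>resolvent_dvd_4\<close>, has the
  form $w_4 P + Q$ with $P, Q$ free of $w_4$, and $s (a_4 P^2 - s Q^2)$ equals
  $\alpha + \gamma_{12} s w_1 w_2 + \gamma_{13} s w_1 w_3 + \gamma_{23} s w_2 w_3$: \<open>elim_const\<close> is $\alpha$ and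
  \<open>elim_cross\<close> gives the $\gamma_{ij}$. Moving the two terms with $w_3$ to the other side and squaring
  leaves $E + D s w_1 w_2$, and \<open>elim_norm\<close> is $E^2 - a_1 a_2 D^2$.
\<close>

definition elim_const :: "'a::comm_ring_1 \<Rightarrow> 'a \<Rightarrow> 'a \<Rightarrow> 'a \<Rightarrow> 'a \<Rightarrow> 'a \<Rightarrow> 'a \<Rightarrow> 'a \<Rightarrow> 'a \<Rightarrow> 'a \<Rightarrow> 'a \<Rightarrow> 'a" where
  "elim_const a1 a2 a3 a4 c0 c12 c13 c14 c23 c24 c34 =
     a4 * (c0\<^sup>2 * a1 * a2 * a3 + (c23 * (a2 + a3))\<^sup>2 * a1 + (c13 * (a1 + a3))\<^sup>2 * a2 + (c12 * (a1 + a2))\<^sup>2 * a3)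
     - ((c14 * (a1 + a4))\<^sup>2 * a2 * a3 + (c24 * (a2 + a4))\<^sup>2 * a1 * a3 + (c34 * (a3 + a4))\<^sup>2 * a1 * a2)"

definition elim_cross :: "'a::comm_ring_1 \<Rightarrow> 'a \<Rightarrow> 'a \<Rightarrow> 'a \<Rightarrow> 'a \<Rightarrow> 'a \<Rightarrow> 'a \<Rightarrow> 'a \<Rightarrow> 'a \<Rightarrow> 'a \<Rightarrow> 'a" where
  "elim_cross a1 a2 a3 a4 c0 c12 c13 c14 c23 c24 =
     2 * (a4 * (c0 * (c12 * (a1 + a2)) * a3 + (c23 * (a2 + a3)) * (c13 * (a1 + a3)))
       - (c14 * (a1 + a4)) * (c24 * (a2 + a4)) * a3)"

definition elim_norm :: "'a::comm_ring_1 \<Rightarrow> 'a \<Rightarrow> 'a \<Rightarrow> 'a \<Rightarrow> 'a \<Rightarrow> 'a \<Rightarrow> 'a \<Rightarrow> 'a" where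
  "elim_norm a1 a2 a3 \<alpha> \<gamma>12 \<gamma>13 \<gamma>23 =
     (\<alpha>\<^sup>2 + \<gamma>12\<^sup>2 * a1 * a2 - a3 * (\<gamma>13\<^sup>2 * a1 + \<gamma>23\<^sup>2 * a2))\<^sup>2
     - a1 * a2 * (2 * (\<alpha> * \<gamma>12 - a3 * \<gamma>13 * \<gamma>23))\<^sup>2"

text \<open>The index permutations (2 3) and (1 2 3) carry the first \<open>elim_cross\<close> to
  the other two, which explains the order of their arguments.\<close>

definition resolvent :: "'a::comm_ring_1 \<Rightarrow> 'a \<Rightarrow> 'a \<Rightarrow> 'a \<Rightarrow> 'a \<Rightarrow> 'a \<Rightarrow> 'a \<Rightarrow> 'a \<Rightarrow> 'a \<Rightarrow> 'a \<Rightarrow> 'a \<Rightarrow> 'a" where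
  "resolvent a1 a2 a3 a4 c0 c12 c13 c14 c23 c24 c34 =
     elim_norm a1 a2 a3 (elim_const a1 a2 a3 a4 c0 c12 c13 c14 c23 c24 c34)
       (elim_cross a1 a2 a3 a4 c0 c12 c13 c14 c23 c24)
       (elim_cross a1 a3 a2 a4 c0 c13 c12 c14 c23 c34)
       (elim_cross a2 a3 a1 a4 c0 c23 c12 c24 c13 c34)"

text \<open>\<open>elim_norm\<close> is the product of the four conjugates of the given expression
  under sign changes of w1, w2, w3; grouping them in pairs gives the two factors E + D W and E - D
  W.\<close>

lemma elim_norm_dvd:
  fixes s :: "'a::comm_ring_1"
  assumes a: "a1 = s * w1\<^sup>2" "a2 = s * w2\<^sup>2" "a3 = s * w3\<^sup>2"
  shows "\<alpha> + \<gamma>12 * (s * w1 * w2) + \<gamma>13 * (s * w1 * w3) + \<gamma>23 * (s * w2 * w3) dvd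
    elim_norm a1 a2 a3 \<alpha> \<gamma>12 \<gamma>13 \<gamma>23"
proof -
  let ?W = "s * w1 * w2"
  let ?E = "\<alpha>\<^sup>2 + \<gamma>12\<^sup>2 * a1 * a2 - a3 * (\<gamma>13\<^sup>2 * a1 + \<gamma>23\<^sup>2 * a2)"
  let ?D = "2 * (\<alpha> * \<gamma>12 - a3 * \<gamma>13 * \<gamma>23)"
  have "elim_norm a1 a2 a3 \<alpha> \<gamma>12 \<gamma>13 \<gamma>23 = (?E + ?D * ?W) * (?E - ?D * ?W)"
    unfolding elim_norm_def a by (simp add: power2_eq_square algebra_simps)
  also have "?E + ?D * ?W =
      (\<alpha> + \<gamma>12 * (s * w1 * w2) + \<gamma>13 * (s * w1 * w3) + \<gamma>23 * (s * w2 * w3)) *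
      (\<alpha> + \<gamma>12 * (s * w1 * w2) - \<gamma>13 * (s * w1 * w3) - \<gamma>23 * (s * w2 * w3))"
    unfolding a by (simp add: power2_eq_square algebra_simps)
  finally show ?thesis by (simp only: mult.assoc dvd_triv_left)
qed

lemma resolvent_dvd_4:
  fixes s :: "'a::comm_ring_1"
  assumes a: "a1 = s * w1\<^sup>2" "a2 = s * w2\<^sup>2" "a3 = s * w3\<^sup>2" "a4 = s * w4\<^sup>2"
  shows "c0 * s * w1 * w2 * w3 * w4 + c12 * (a1 + a2) * w3 * w4 + c13 * (a1 + a3) * w2 * w4
    + c14 * (a1 + a4) * w2 * w3 + c23 * (a2 + a3) * w1 * w4 + c24 * (a2 + a4) * w1 * w3
    + c34 * (a3 + a4) * w1 * w2 dvd resolvent a1 a2 a3 a4 c0 c12 c13 c14 c23 c24 c34"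
    (is "?R dvd _")
proof -
  let ?L = "elim_const a1 a2 a3 a4 c0 c12 c13 c14 c23 c24 c34
    + elim_cross a1 a2 a3 a4 c0 c12 c13 c14 c23 c24 * (s * w1 * w2)
    + elim_cross a1 a3 a2 a4 c0 c13 c12 c14 c23 c34 * (s * w1 * w3)
    + elim_cross a2 a3 a1 a4 c0 c23 c12 c24 c13 c34 * (s * w2 * w3)"
  \<comment> \<open>The second factor is, up to s^2, the conjugate under w4 -> -w4. The products c *
    (a + a') are kept as opaque letters so that the expansion stays small.\<close>
  have gen: "a4 * (c0\<^sup>2 * a1 * a2 * a3 + p1\<^sup>2 * a1 + p2\<^sup>2 * a2 + p3\<^sup>2 * a3) - (q1\<^sup>2 * a2 * a3 + q2\<^sup>2 * a1 * a3 + q3\<^sup>2 * a1 * a2)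
    + 2 * (a4 * (c0 * p3 * a3 + p1 * p2) - q1 * q2 * a3) * (s * w1 * w2)
    + 2 * (a4 * (c0 * p2 * a2 + p1 * p3) - q1 * q3 * a2) * (s * w1 * w3)
    + 2 * (a4 * (c0 * p1 * a1 + p2 * p3) - q2 * q3 * a1) * (s * w2 * w3)
    = (c0 * s * w1 * w2 * w3 * w4 + p3 * w3 * w4 + p2 * w2 * w4 + q1 * w2 * w3 + p1 * w1 * w4 + q2 * w1 * w3 + q3 * w1 * w2)
      * (s\<^sup>2 * (w4 * (c0 * s * w1 * w2 * w3 + p1 * w1 + p2 * w2 + p3 * w3) - (q1 * w2 * w3 + q2 * w1 * w3 + q3 * w1 * w2)))"
    for p1 p2 p3 q1 q2 q3
    unfolding a by (simp add: power2_eq_square algebra_simps)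
  have "?L = ?R * (s\<^sup>2 * (w4 * (c0 * s * w1 * w2 * w3 + c23 * (a2 + a3) * w1 + c13 * (a1 + a3) * w2 + c12 * (a1 + a2) * w3)
      - (c14 * (a1 + a4) * w2 * w3 + c24 * (a2 + a4) * w1 * w3 + c34 * (a3 + a4) * w1 * w2)))"
    using gen[of "c23 * (a2 + a3)" "c13 * (a1 + a3)" "c12 * (a1 + a2)" "c14 * (a1 + a4)" "c24 * (a2 + a4)" "c34 * (a3 + a4)"]
    unfolding elim_const_def elim_cross_def by (simp only: ac_simps)
  then have "?R dvd ?L" by (simp only: dvd_triv_left)
  also have "?L dvd resolvent a1 a2 a3 a4 c0 c12 c13 c14 c23 c24 c34"
    unfolding resolvent_def by (rule elim_norm_dvd[OF a(1-3)])
  finally show ?thesis .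
qed

text \<open>Without terms in w4 the element a4 may be arbitrary: the first elimination step then
  produces s * a4 times the square of the relation, which is still a multiple of it.\<close>

lemma resolvent_dvd_3:
  fixes s :: "'a::comm_ring_1"
  assumes a: "a1 = s * w1\<^sup>2" "a2 = s * w2\<^sup>2" "a3 = s * w3\<^sup>2"
  shows "c0 * s * w1 * w2 * w3 + c12 * (a1 + a2) * w3 + c13 * (a1 + a3) * w2 + c23 * (a2 + a3) * w1
    dvd resolvent a1 a2 a3 a4 c0 c12 c13 0 c23 0 0"
    (is "?R dvd _")
proof -
  let ?L = "elim_const a1 a2 a3 a4 c0 c12 c13 0 c23 0 0
    + elim_cross a1 a2 a3 a4 c0 c12 c13 0 c23 0 * (s * w1 * w2)
    + elim_cross a1 a3 a2 a4 c0 c13 c12 0 c23 0 * (s * w1 * w3)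
    + elim_cross a2 a3 a1 a4 c0 c23 c12 0 c13 0 * (s * w2 * w3)"
  have gen: "a4 * (c0\<^sup>2 * a1 * a2 * a3 + p1\<^sup>2 * a1 + p2\<^sup>2 * a2 + p3\<^sup>2 * a3)
    + 2 * (a4 * (c0 * p3 * a3 + p1 * p2)) * (s * w1 * w2)
    + 2 * (a4 * (c0 * p2 * a2 + p1 * p3)) * (s * w1 * w3)
    + 2 * (a4 * (c0 * p1 * a1 + p2 * p3)) * (s * w2 * w3)
    = (c0 * s * w1 * w2 * w3 + p3 * w3 + p2 * w2 + p1 * w1)
      * (s * a4 * (c0 * s * w1 * w2 * w3 + p3 * w3 + p2 * w2 + p1 * w1))"
    for p1 p2 p3
    unfolding a by (simp add: power2_eq_square algebra_simps)
  have "?L = ?R * (s * a4 * ?R)"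
    unfolding gen[of "c23 * (a2 + a3)" "c13 * (a1 + a3)" "c12 * (a1 + a2)", symmetric]
      elim_const_def elim_cross_def by (simp add: ac_simps)
  then have "?R dvd ?L" by (simp only: dvd_triv_left)
  also have "?L dvd resolvent a1 a2 a3 a4 c0 c12 c13 0 c23 0 0"
    unfolding resolvent_def by (rule elim_norm_dvd[OF a])
  finally show ?thesis .
qed

text \<open>Here a3 and a4 are arbitrary and the first elimination gives a3 * a4 times the square of
  the relation. As the last two cross coefficients vanish, no square root of a3 is needed for the
  norm.\<close>

lemma resolvent_dvd_2:
  fixes s :: "'a::comm_ring_1"
  assumes a: "a1 = s * w1\<^sup>2" "a2 = s * w2\<^sup>2"
  shows "c0 * s * w1 * w2 + c12 * (a1 + a2) dvd resolvent a1 a2 a3 a4 c0 c12 0 0 0 0 0"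
    (is "?R dvd _")
proof -
  let ?\<alpha> = "elim_const a1 a2 a3 a4 c0 c12 0 0 0 0 0"
  let ?\<gamma> = "elim_cross a1 a2 a3 a4 c0 c12 0 0 0 0"
  have "?\<alpha> + ?\<gamma> * (s * w1 * w2) = a3 * a4 * ((c0 * s * w1 * w2)\<^sup>2 + (c12 * (a1 + a2))\<^sup>2 + 2 * (c0 * s * w1 * w2) * (c12 * (a1 + a2)))"
    unfolding elim_const_def elim_cross_def by (simp add: a power2_eq_square algebra_simps)
  also have "\<dots> = ?R * (a3 * a4 * ?R)"
    by (simp only: power2_sum[symmetric]) (simp add: power2_eq_square ac_simps)
  finally have "?R dvd ?\<alpha> + ?\<gamma> * (s * w1 * w2)" by (simp only: dvd_triv_left)
  also have "elim_norm a1 a2 a3 \<alpha> \<gamma> 0 0 =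
      (\<alpha> + \<gamma> * (s * w1 * w2)) * ((\<alpha> + \<gamma> * (s * w1 * w2)) * (\<alpha> - \<gamma> * (s * w1 * w2))\<^sup>2)" for \<alpha> \<gamma>
    unfolding a elim_norm_def by (simp add: power2_eq_square algebra_simps)
  then have "?\<alpha> + ?\<gamma> * (s * w1 * w2) dvd elim_norm a1 a2 a3 ?\<alpha> ?\<gamma> 0 0"
    by (simp only: dvd_triv_left)
  also have "elim_norm a1 a2 a3 ?\<alpha> ?\<gamma> 0 0 = resolvent a1 a2 a3 a4 c0 c12 0 0 0 0 0"
    unfolding resolvent_def by (simp add: elim_cross_def)
  finally show ?thesis .
qed

lemma prime_elem_dvd_cancel_2:
  fixes x :: "int poly"
  assumes p: "Factorial_Ring.prime p" "p > 2" and "[:int p:] dvd 2 * x"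
  shows "[:int p:] dvd x"
proof -
  have "\<not> [:int p:] dvd 2"
  proof
    assume "[:int p:] dvd 2"
    then have "int p dvd poly 2 0" by (rule poly_dvd_of_const_poly_dvd)
    then show False using p(2) zdvd_imp_le[of "int p" 2] by simp
  qed
  then show ?thesis
    using prime_elem_const_poly_int[OF p(1)] assms(3) by (simp add: prime_elem_dvd_mult_iff)
qed

text \<open>
  If $E$ and $D$ vanish, then $(\alpha^2 - \gamma_{12}^2 a_1 a_2)^2 = a_3^2 (\gamma_{13}^2 a_1 - \gamma_{23}^2 a_2)^2$;
  taking the root with either sign and combining with $E = 0$ gives equations $U^2 = a_i a_j V^2$.
\<close>

lemma elim_norm_dvd_imp:
  fixes \<alpha> \<gamma>12 \<gamma>13 \<gamma>23 :: "int poly"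
  assumes p: "Factorial_Ring.prime p" "p > 2"
    and b: "\<not> [b1 = b2] (mod int p)" "\<not> [b1 = b3] (mod int p)" "\<not> [b2 = b3] (mod int p)"
    and dvd: "[:int p:] dvd elim_norm [:b1, 1:] [:b2, 1:] [:b3, 1:] \<alpha> \<gamma>12 \<gamma>13 \<gamma>23"
  shows "[:int p:] dvd \<alpha> \<and> [:int p:] dvd \<gamma>12 \<and> [:int p:] dvd \<gamma>13 \<and> [:int p:] dvd \<gamma>23"
proof -
  define \<pi> where "\<pi> = [:int p:]"
  define A1 where "A1 = [:b1, 1:]"
  define A2 where "A2 = [:b2, 1:]"
  define A3 where "A3 = [:b3, 1:]"
  have prime: "prime_elem \<pi>"
    unfolding \<pi>_def using p(1) by (rule prime_elem_const_poly_int)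
  have not: "\<not> \<pi> dvd A1" "\<not> \<pi> dvd A2"
    unfolding \<pi>_def A1_def A2_def using p(1) by (rule not_const_poly_dvd_monic_linear)+
  have two: "\<pi> dvd x" if "\<pi> dvd 2 * x" for x
    using that unfolding \<pi>_def by (rule prime_elem_dvd_cancel_2[OF p])
  have sq12: "\<pi> dvd U \<and> \<pi> dvd V" if "\<pi> dvd U\<^sup>2 - A1 * A2 * V\<^sup>2" for U V
    using that unfolding \<pi>_def A1_def A2_def by (rule square_eq_two_linear_square[OF p(1) b(1)])
  have sq13: "\<pi> dvd U \<and> \<pi> dvd V" if "\<pi> dvd U\<^sup>2 - A1 * A3 * V\<^sup>2" for U V
    using that unfolding \<pi>_def A1_def A3_def by (rule square_eq_two_linear_square[OF p(1) b(2)])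
  have sq23: "\<pi> dvd U \<and> \<pi> dvd V" if "\<pi> dvd U\<^sup>2 - A2 * A3 * V\<^sup>2" for U V
    using that unfolding \<pi>_def A2_def A3_def by (rule square_eq_two_linear_square[OF p(1) b(3)])
  define E where "E = \<alpha>\<^sup>2 + \<gamma>12\<^sup>2 * A1 * A2 - A3 * (\<gamma>13\<^sup>2 * A1 + \<gamma>23\<^sup>2 * A2)"
  define D where "D = \<alpha> * \<gamma>12 - A3 * \<gamma>13 * \<gamma>23"
  have "\<pi> dvd E\<^sup>2 - A1 * A2 * (2 * D)\<^sup>2"
    using dvd unfolding elim_norm_def \<pi>_def A1_def A2_def A3_def E_def D_def .
  then have E: "\<pi> dvd E" and D: "\<pi> dvd D"
    using sq12 two by blast+
  define M where "M = \<alpha>\<^sup>2 - \<gamma>12\<^sup>2 * A1 * A2"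
  define Z where "Z = A3 * (\<gamma>13\<^sup>2 * A1 - \<gamma>23\<^sup>2 * A2)"
  have "(M - Z) * (M + Z) = E * (\<alpha>\<^sup>2 + \<gamma>12\<^sup>2 * A1 * A2 + A3 * (\<gamma>13\<^sup>2 * A1 + \<gamma>23\<^sup>2 * A2))
      - D * (4 * A1 * A2 * (\<alpha> * \<gamma>12 + A3 * \<gamma>13 * \<gamma>23))"
    unfolding M_def Z_def E_def D_def by (simp add: power2_eq_square algebra_simps)
  moreover have "\<pi> dvd E * (\<alpha>\<^sup>2 + \<gamma>12\<^sup>2 * A1 * A2 + A3 * (\<gamma>13\<^sup>2 * A1 + \<gamma>23\<^sup>2 * A2))
      - D * (4 * A1 * A2 * (\<alpha> * \<gamma>12 + A3 * \<gamma>13 * \<gamma>23))"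
    by (intro dvd_diff dvd_mult2 E D)
  ultimately have "\<pi> dvd (M - Z) * (M + Z)" by (simp only:)
  then consider (minus) "\<pi> dvd M - Z" | (plus) "\<pi> dvd M + Z"
    using prime by (auto simp: prime_elem_dvd_mult_iff)
  then have "\<pi> dvd \<alpha> \<and> \<pi> dvd \<gamma>12 \<and> \<pi> dvd \<gamma>13 \<and> \<pi> dvd \<gamma>23"
  proof cases
    case minus
    have "E + (M - Z) = 2 * (\<alpha>\<^sup>2 - A1 * A3 * \<gamma>13\<^sup>2)"
      unfolding M_def Z_def E_def by (simp add: power2_eq_square algebra_simps)
    with dvd_add[OF E minus] have "\<pi> dvd \<alpha>\<^sup>2 - A1 * A3 * \<gamma>13\<^sup>2" by - (rule two, simp only:)
    then have 1: "\<pi> dvd \<alpha> \<and> \<pi> dvd \<gamma>13" by (rule sq13)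
    \<comment> \<open>The extra factor \<open>A1\<close> turns A1 * g12^2 - A3 * g23^2, with g the
      cross coefficients, into the shape U^2 - A1 * A3 * V^2 required by
      \<open>sq13\<close>.\<close>
    have "A1 * (E - (M - Z)) = 2 * (A2 * ((A1 * \<gamma>12)\<^sup>2 - A1 * A3 * \<gamma>23\<^sup>2))"
      unfolding M_def Z_def E_def by (simp add: power2_eq_square algebra_simps)
    with dvd_mult[OF dvd_diff[OF E minus], of A1] have "\<pi> dvd A2 * ((A1 * \<gamma>12)\<^sup>2 - A1 * A3 * \<gamma>23\<^sup>2)"
      by - (rule two, simp only:)
    then have "\<pi> dvd (A1 * \<gamma>12)\<^sup>2 - A1 * A3 * \<gamma>23\<^sup>2"
      using prime not by (simp only: prime_elem_dvd_mult_iff) simp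
    then have "\<pi> dvd A1 * \<gamma>12 \<and> \<pi> dvd \<gamma>23" by (rule sq13)
    then show ?thesis
      using 1 prime not by (simp only: prime_elem_dvd_mult_iff) simp
  next
    case plus
    have "E + (M + Z) = 2 * (\<alpha>\<^sup>2 - A2 * A3 * \<gamma>23\<^sup>2)"
      unfolding M_def Z_def E_def by (simp add: power2_eq_square algebra_simps)
    with dvd_add[OF E plus] have "\<pi> dvd \<alpha>\<^sup>2 - A2 * A3 * \<gamma>23\<^sup>2" by - (rule two, simp only:)
    then have 1: "\<pi> dvd \<alpha> \<and> \<pi> dvd \<gamma>23" by (rule sq23)
    have "A2 * (E - (M + Z)) = 2 * (A1 * ((A2 * \<gamma>12)\<^sup>2 - A2 * A3 * \<gamma>13\<^sup>2))"
      unfolding M_def Z_def E_def by (simp add: power2_eq_square algebra_simps)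
    with dvd_mult[OF dvd_diff[OF E plus], of A2] have "\<pi> dvd A1 * ((A2 * \<gamma>12)\<^sup>2 - A2 * A3 * \<gamma>13\<^sup>2)"
      by - (rule two, simp only:)
    then have "\<pi> dvd (A2 * \<gamma>12)\<^sup>2 - A2 * A3 * \<gamma>13\<^sup>2"
      using prime not by (simp only: prime_elem_dvd_mult_iff) simp
    then have "\<pi> dvd A2 * \<gamma>12 \<and> \<pi> dvd \<gamma>13" by (rule sq23)
    then show ?thesis
      using 1 prime not by (simp only: prime_elem_dvd_mult_iff) simp
  qed
  then show ?thesis by (simp add: \<pi>_def)
qed

text \<open>Multiplying the diagonal relation by x and using the mixed products to remove the other
  two terms leaves u * x^3; likewise for y and z.\<close>

lemma prime_dvd_three_squares:
  fixes x y z :: "'a::idom"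
  assumes p: "prime_elem p" and "p dvd x * y" "p dvd x * z" "p dvd y * z"
    and sq: "p dvd u * x\<^sup>2 + v * y\<^sup>2 + w * z\<^sup>2"
    and uvw: "\<not> p dvd u" "\<not> p dvd v" "\<not> p dvd w"
  shows "p dvd x \<and> p dvd y \<and> p dvd z"
proof -
  have "p dvd x * (u * x\<^sup>2 + v * y\<^sup>2 + w * z\<^sup>2) - (v * y * (x * y) + w * z * (x * z))"
    "p dvd y * (u * x\<^sup>2 + v * y\<^sup>2 + w * z\<^sup>2) - (u * x * (x * y) + w * z * (y * z))"
    "p dvd z * (u * x\<^sup>2 + v * y\<^sup>2 + w * z\<^sup>2) - (u * x * (x * z) + v * y * (y * z))"
    using assms by (auto intro!: dvd_diff dvd_add dvd_mult)
  moreover have "x * (u * x\<^sup>2 + v * y\<^sup>2 + w * z\<^sup>2) - (v * y * (x * y) + w * z * (x * z)) = u * x ^ 3"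
    "y * (u * x\<^sup>2 + v * y\<^sup>2 + w * z\<^sup>2) - (u * x * (x * y) + w * z * (y * z)) = v * y ^ 3"
    "z * (u * x\<^sup>2 + v * y\<^sup>2 + w * z\<^sup>2) - (u * x * (x * z) + v * y * (y * z)) = w * z ^ 3"
    by (simp_all add: power2_eq_square power3_eq_cube algebra_simps)
  ultimately have "p dvd u * x ^ 3" "p dvd v * y ^ 3" "p dvd w * z ^ 3" by (simp_all only:)
  then show ?thesis
    using p uvw by (auto simp: prime_elem_dvd_mult_iff dest: prime_elem_dvd_power)
qed

text \<open>Lagrange's bound for the monic quartic with the four roots to be avoided; more than four
  residues are available.\<close>

lemma exists_nonroot_mod_prime:
  assumes p: "Factorial_Ring.prime p" "p > 4"
  shows "\<exists>r. \<not> int p dvd b1 + r \<and> \<not> int p dvd b2 + r \<and> \<not> int p dvd b3 + r \<and> \<not> int p dvd b4 + r"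
proof (rule ccontr)
  define G where "G = [:b1, 1:] * [:b2, 1:] * [:b3, 1:] * [:b4, 1:]"
  assume "\<not> ?thesis"
  then have "int p dvd b1 + r \<or> int p dvd b2 + r \<or> int p dvd b3 + r \<or> int p dvd b4 + r" for r
    by blast
  then have "int p dvd (b1 + r) * (b2 + r) * (b3 + r) * (b4 + r)" for r
    by (meson dvd_mult dvd_mult2)
  moreover have "poly G r = (b1 + r) * (b2 + r) * (b3 + r) * (b4 + r)" for r
    unfolding G_def poly_mult by simp
  ultimately have "int p dvd poly G r" for r by (simp only:)
  then have "{r \<in> {0..<int p}. int p dvd poly G r} = {0..<int p}" by blast
  moreover have "\<not> [:int p:] dvd G"
    unfolding G_def prime_elem_dvd_mult_iff[OF prime_elem_const_poly_int[OF p(1)]]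
    using not_const_poly_dvd_monic_linear[OF p(1)] by blast
  then have "card {r \<in> {0..<int p}. int p dvd poly G r} \<le> Polynomial.degree G"
    by (rule card_roots_mod_prime[OF p(1)])
  moreover have "Polynomial.degree G = 4"
    by (simp add: G_def)
  ultimately show False using p(2) by simp
qed

text \<open>The coefficients are isolated one after the other at the roots of $a_4$, $a_3$ and $a_1$.\<close>

lemma elim_coeffs_dvd_imp:
  fixes b1 b2 b3 b4 c0 c12 c13 c14 c23 c24 c34 :: int
  assumes p: "Factorial_Ring.prime p" "p > 4"
    and b: "\<not> [b1 = b2] (mod int p)" "\<not> [b1 = b3] (mod int p)" "\<not> [b1 = b4] (mod int p)"
      "\<not> [b2 = b3] (mod int p)" "\<not> [b2 = b4] (mod int p)" "\<not> [b3 = b4] (mod int p)"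
    and const: "\<And>r. int p dvd elim_const (b1 + r) (b2 + r) (b3 + r) (b4 + r) c0 c12 c13 c14 c23 c24 c34"
    and cross12: "\<And>r. int p dvd elim_cross (b1 + r) (b2 + r) (b3 + r) (b4 + r) c0 c12 c13 c14 c23 c24"
    and cross13: "\<And>r. int p dvd elim_cross (b1 + r) (b3 + r) (b2 + r) (b4 + r) c0 c13 c12 c14 c23 c34"
    and cross23: "\<And>r. int p dvd elim_cross (b2 + r) (b3 + r) (b1 + r) (b4 + r) c0 c23 c12 c24 c13 c34"
  shows "int p dvd c0 \<and> int p dvd c12 \<and> int p dvd c13 \<and> int p dvd c14 \<and> int p dvd c23 \<and> int p dvd c24 \<and> int p dvd c34"
proof -
  have pe: "prime_elem (int p)" using p(1) by auto
  have two: "\<not> int p dvd 2" using p(2) zdvd_imp_le[of "int p" 2] by auto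
  have diff: "\<not> int p dvd b1 - b2" "\<not> int p dvd b1 - b3" "\<not> int p dvd b1 - b4"
      "\<not> int p dvd b2 - b3" "\<not> int p dvd b2 - b4" "\<not> int p dvd b3 - b4"
    using b by (simp_all add: cong_iff_dvd_diff)
  have diff': "\<not> int p dvd b2 - b1" "\<not> int p dvd b3 - b1" "\<not> int p dvd b4 - b1"
      "\<not> int p dvd b3 - b2" "\<not> int p dvd b4 - b2" "\<not> int p dvd b4 - b3"
    using diff by (simp_all add: dvd_diff_commute)
  note mult = prime_elem_dvd_mult_iff[OF pe]
  \<comment> \<open>At r = -b4 each cross coefficient becomes a product of two of c14, c24, c34
    times a unit modulo p, and the constant coefficient becomes a diagonal form in their
    squares.\<close>
  have "int p dvd c14 \<and> int p dvd c24 \<and> int p dvd c34"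
  proof (rule prime_dvd_three_squares[OF pe])
    show "int p dvd c14 * c24"
      using cross12[of "- b4"] two diff by (simp add: elim_cross_def mult)
    show "int p dvd c14 * c34"
      using cross13[of "- b4"] two diff by (simp add: elim_cross_def mult)
    show "int p dvd c24 * c34"
      using cross23[of "- b4"] two diff by (simp add: elim_cross_def mult)
    define d1 where "d1 = b1 - b4"
    define d2 where "d2 = b2 - b4"
    define d3 where "d3 = b3 - b4"
    have "int p dvd - ((d1\<^sup>2 * d2 * d3) * c14\<^sup>2 + (d2\<^sup>2 * d1 * d3) * c24\<^sup>2 + (d3\<^sup>2 * d1 * d2) * c34\<^sup>2)"
      using const[of "- b4"] unfolding elim_const_def
      by (simp add: d1_def[symmetric] d2_def[symmetric] d3_def[symmetric] power_mult_distrib mult_ac)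
    then show "int p dvd (d1\<^sup>2 * d2 * d3) * c14\<^sup>2 + (d2\<^sup>2 * d1 * d3) * c24\<^sup>2 + (d3\<^sup>2 * d1 * d2) * c34\<^sup>2"
      by (simp only: dvd_minus_iff)
    show "\<not> int p dvd d1\<^sup>2 * d2 * d3" "\<not> int p dvd d2\<^sup>2 * d1 * d3" "\<not> int p dvd d3\<^sup>2 * d1 * d2"
      using diff by (simp_all add: d1_def d2_def d3_def mult power2_eq_square)
  qed
  then obtain k14 k24 k34 where c4: "c14 = int p * k14" "c24 = int p * k24" "c34 = int p * k34"
    by (auto elim!: dvdE)
  have const': "int p dvd (b4 + r) * (c0\<^sup>2 * (b1 + r) * (b2 + r) * (b3 + r) + (c23 * ((b2 + r) + (b3 + r)))\<^sup>2 * (b1 + r)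
      + (c13 * ((b1 + r) + (b3 + r)))\<^sup>2 * (b2 + r) + (c12 * ((b1 + r) + (b2 + r)))\<^sup>2 * (b3 + r))" for r
  proof -
    have "int p dvd (c14 * ((b1 + r) + (b4 + r)))\<^sup>2 * (b2 + r) * (b3 + r)
       + (c24 * ((b2 + r) + (b4 + r)))\<^sup>2 * (b1 + r) * (b3 + r) + (c34 * ((b3 + r) + (b4 + r)))\<^sup>2 * (b1 + r) * (b2 + r)"
      unfolding c4 by (simp only: power2_eq_square mult.assoc) (intro dvd_add dvd_triv_left)
    with const[of r] show ?thesis unfolding elim_const_def by (simp only: dvd_diff_left_iff)
  qed
  \<comment> \<open>Only two unknowns remain at r = -b3; the third entry is set to 0, with weight
    1.\<close>
  have "int p dvd c23 \<and> int p dvd c13 \<and> int p dvd (0::int)"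
  proof (rule prime_dvd_three_squares[OF pe])
    define d1 where "d1 = b1 - b3"
    define d2 where "d2 = b2 - b3"
    define d4 where "d4 = b4 - b3"
    have d: "\<not> int p dvd d1" "\<not> int p dvd d2" "\<not> int p dvd d4"
      using diff diff' by (simp_all add: d1_def d2_def d4_def)
    have "int p dvd 2 * (d4 * ((c23 * d2) * (c13 * d1)))"
      using cross12[of "- b3"] by (simp add: elim_cross_def d1_def d2_def d4_def)
    then show "int p dvd c23 * c13" using two d by (simp add: mult)
    have "int p dvd d4 * ((c23 * d2)\<^sup>2 * d1 + (c13 * d1)\<^sup>2 * d2)"
      using const'[of "- b3"] by (simp add: d1_def d2_def d4_def)
    then have "int p dvd (c23 * d2)\<^sup>2 * d1 + (c13 * d1)\<^sup>2 * d2"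
      using d by (simp only: mult) simp
    then show "int p dvd (d2\<^sup>2 * d1) * c23\<^sup>2 + (d1\<^sup>2 * d2) * c13\<^sup>2 + 1 * 0\<^sup>2"
      by (simp add: power_mult_distrib mult_ac)
    show "\<not> int p dvd d2\<^sup>2 * d1" "\<not> int p dvd d1\<^sup>2 * d2" using d by (simp_all add: mult power2_eq_square)
    show "\<not> int p dvd 1" using p(2) by simp
  qed simp_all
  then obtain k13 k23 where c3: "c13 = int p * k13" "c23 = int p * k23"
    by (auto elim!: dvdE)
  have const'': "int p dvd (b4 + r) * (c0\<^sup>2 * (b1 + r) * (b2 + r) * (b3 + r)
      + (c12 * ((b1 + r) + (b2 + r)))\<^sup>2 * (b3 + r))" for r
  proof -
    have "int p dvd (b4 + r) * ((c23 * ((b2 + r) + (b3 + r)))\<^sup>2 * (b1 + r)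
      + (c13 * ((b1 + r) + (b3 + r)))\<^sup>2 * (b2 + r))"
      unfolding c3 by (simp only: power2_eq_square mult.assoc) (intro dvd_mult dvd_add dvd_triv_left)
    moreover have "(b4 + r) * (x + y1 + y2 + z) - (b4 + r) * (y1 + y2) = (b4 + r) * (x + z)" for x y1 y2 z
      by (simp add: algebra_simps)
    ultimately show ?thesis using dvd_diff[OF const'[of r]] by metis
  qed
  \<comment> \<open>At r = -b1 the term with c0 vanishes, and so does one summand of (b1 + r) + (b2
    + r); what remains is c12^2 times a unit.\<close>
  have c12: "int p dvd c12"
    using const''[of "- b1"] diff diff' by (simp add: mult power2_eq_square)
  then obtain k12 where k12: "c12 = int p * k12" ..
  \<comment> \<open>The term with c0 contains all four linear factors and vanishes at each of their
    roots, so c0 is read off at a point that is none of them.\<close>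
  obtain r where r: "\<not> int p dvd b1 + r" "\<not> int p dvd b2 + r" "\<not> int p dvd b3 + r" "\<not> int p dvd b4 + r"
    using exists_nonroot_mod_prime[OF p] by blast
  have "int p dvd (c12 * ((b1 + r) + (b2 + r)))\<^sup>2 * (b3 + r)"
    using c12 by (simp add: power2_eq_square)
  moreover have "int p dvd c0\<^sup>2 * (b1 + r) * (b2 + r) * (b3 + r) + (c12 * ((b1 + r) + (b2 + r)))\<^sup>2 * (b3 + r)"
    using const''[of r] r by (simp only: mult) simp
  ultimately have "int p dvd c0\<^sup>2 * (b1 + r) * (b2 + r) * (b3 + r)"
    by (simp only: dvd_add_left_iff)
  then have "int p dvd c0" using r by (simp add: mult power2_eq_square)
  then show ?thesis using c12 c3 c4 by simp
qed

section \<open>The resolvent as a polynomial in r\<close>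

lemma poly_resolvent:
  "poly (resolvent [:b1, 1:] [:b2, 1:] [:b3, 1:] [:b4, 1:] [:c0:] [:c12:] [:c13:] [:c14:] [:c23:] [:c24:] [:c34:]) r =
   resolvent (b1 + r) (b2 + r) (b3 + r) (b4 + r) c0 c12 c13 c14 c23 c24 (c34 :: int)"
  unfolding resolvent_def elim_norm_def elim_const_def elim_cross_def
    poly_add poly_diff poly_mult poly_power poly_numeral
  by (simp only: poly_pCons poly_0 mult_zero_right add_0_right mult_1_right)

text \<open>\<open>elim_const\<close> has degree at most 4 and \<open>elim_cross\<close> at most 3;
  hence the two terms whose difference is \<open>elim_norm\<close> both have degree at most
  16.\<close>

lemma degree_resolvent_le:
  "Polynomial.degree (resolvent [:b1, 1:] [:b2, 1:] [:b3, 1:] [:b4, 1:]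
     [:c0:] [:c12:] [:c13:] [:c14:] [:c23:] [:c24:] [:c34 :: int:]) \<le> 16"
proof -
  have mult: "Polynomial.degree (f * g) \<le> m + n"
    if "Polynomial.degree f \<le> m" "Polynomial.degree g \<le> n" for f g :: "int poly" and m n
    using that degree_mult_le[of f g] by linarith
  have power: "Polynomial.degree (f ^ k) \<le> m * k"
    if "Polynomial.degree f \<le> m" for f :: "int poly" and m k
    using that degree_power_le[of f k] by (meson mult_le_mono1 order_trans)
  have add: "Polynomial.degree (f + g) \<le> max m n"
    if "Polynomial.degree f \<le> m" "Polynomial.degree g \<le> n" for f g :: "int poly" and m n
    using that by (intro degree_add_le) auto
  have diff: "Polynomial.degree (f - g) \<le> max m n"
    if "Polynomial.degree f \<le> m" "Polynomial.degree g \<le> n" for f g :: "int poly" and m n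
    using that by (intro degree_diff_le) auto
  have lin: "Polynomial.degree [:b, 1:] \<le> 1" for b :: int by simp
  have const: "Polynomial.degree [:c:] \<le> 0" for c :: int by simp
  have two: "Polynomial.degree (2 :: int poly) \<le> 0" by simp
  show ?thesis
    unfolding resolvent_def elim_norm_def elim_const_def elim_cross_def
    by (rule order_trans, (rule add diff mult power lin const two)+, simp)
qed

text \<open>The quantitative form of the independence of the square roots: if the resolvent were
  zero in F_p[r], the elimination could be undone step by step and every coefficient would be
  zero.\<close>

lemma card_resolvent_roots_le:
  assumes p: "Factorial_Ring.prime p" "p > 4"
    and b: "\<not> [b1 = b2] (mod int p)" "\<not> [b1 = b3] (mod int p)" "\<not> [b1 = b4] (mod int p)"
      "\<not> [b2 = b3] (mod int p)" "\<not> [b2 = b4] (mod int p)" "\<not> [b3 = b4] (mod int p)"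
    and c: "\<not> (int p dvd c0 \<and> int p dvd c12 \<and> int p dvd c13 \<and> int p dvd c14 \<and> int p dvd c23 \<and> int p dvd c24 \<and> int p dvd c34)"
  shows "card {r \<in> {0..<int p}. int p dvd resolvent (b1 + r) (b2 + r) (b3 + r) (b4 + r) c0 c12 c13 c14 c23 c24 c34} \<le> 16"
proof -
  define G where "G = resolvent [:b1, 1:] [:b2, 1:] [:b3, 1:] [:b4, 1:] [:c0:] [:c12:] [:c13:] [:c14:] [:c23:] [:c24:] [:c34:]"
  have "\<not> [:int p:] dvd G"
  proof
    assume "[:int p:] dvd G"
    then have "[:int p:] dvd elim_norm [:b1, 1:] [:b2, 1:] [:b3, 1:]
      (elim_const [:b1, 1:] [:b2, 1:] [:b3, 1:] [:b4, 1:] [:c0:] [:c12:] [:c13:] [:c14:] [:c23:] [:c24:] [:c34:])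
      (elim_cross [:b1, 1:] [:b2, 1:] [:b3, 1:] [:b4, 1:] [:c0:] [:c12:] [:c13:] [:c14:] [:c23:] [:c24:])
      (elim_cross [:b1, 1:] [:b3, 1:] [:b2, 1:] [:b4, 1:] [:c0:] [:c13:] [:c12:] [:c14:] [:c23:] [:c34:])
      (elim_cross [:b2, 1:] [:b3, 1:] [:b1, 1:] [:b4, 1:] [:c0:] [:c23:] [:c12:] [:c24:] [:c13:] [:c34:])"
      by (simp only: G_def resolvent_def)
    from elim_norm_dvd_imp[OF p(1) _ b(1,2,4) this] p(2)
    have *: "[:int p:] dvd elim_const [:b1, 1:] [:b2, 1:] [:b3, 1:] [:b4, 1:] [:c0:] [:c12:] [:c13:] [:c14:] [:c23:] [:c24:] [:c34:]"
      "[:int p:] dvd elim_cross [:b1, 1:] [:b2, 1:] [:b3, 1:] [:b4, 1:] [:c0:] [:c12:] [:c13:] [:c14:] [:c23:] [:c24:]"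
      "[:int p:] dvd elim_cross [:b1, 1:] [:b3, 1:] [:b2, 1:] [:b4, 1:] [:c0:] [:c13:] [:c12:] [:c14:] [:c23:] [:c34:]"
      "[:int p:] dvd elim_cross [:b2, 1:] [:b3, 1:] [:b1, 1:] [:b4, 1:] [:c0:] [:c23:] [:c12:] [:c24:] [:c13:] [:c34:]"
      by linarith+
    have const: "poly (elim_const [:b1, 1:] [:b2, 1:] [:b3, 1:] [:b4, 1:] [:c0:] [:c12:] [:c13:] [:c14:] [:c23:] [:c24:] [:c34:]) r =
        elim_const (b1 + r) (b2 + r) (b3 + r) (b4 + r) c0 c12 c13 c14 c23 c24 c34" for r
      unfolding elim_const_def poly_add poly_diff poly_mult poly_power
      by (simp only: poly_pCons poly_0 mult_zero_right add_0_right mult_1_right)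
    have cross: "poly (elim_cross [:b1, 1:] [:b2, 1:] [:b3, 1:] [:b4, 1:] [:c0:] [:c12:] [:c13:] [:c14:] [:c23:] [:c24:]) r =
        elim_cross (b1 + r) (b2 + r) (b3 + r) (b4 + r) c0 c12 c13 c14 c23 c24" for r b1 b2 b3 b4 c0 c12 c13 c14 c23 c24 :: int
      unfolding elim_cross_def poly_add poly_diff poly_mult poly_numeral
      by (simp only: poly_pCons poly_0 mult_zero_right add_0_right mult_1_right)
    from c show False
      using elim_coeffs_dvd_imp[OF p b]
        *[THEN poly_dvd_of_const_poly_dvd, unfolded const cross] by blast
  qed
  then have "card {r \<in> {0..<int p}. int p dvd poly G r} \<le> Polynomial.degree G"
    by (rule card_roots_mod_prime[OF p(1)])
  also have "\<dots> \<le> 16" unfolding G_def by (rule degree_resolvent_le)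
  finally show ?thesis unfolding G_def poly_resolvent .
qed

section \<open>Quadratic relations between inverse square roots\<close>

lemma resolvent_cong:
  fixes a1 a2 a3 a4 :: int
  assumes "[a1 = a1'] (mod m)" "[a2 = a2'] (mod m)" "[a3 = a3'] (mod m)" "[a4 = a4'] (mod m)"
  shows "[resolvent a1 a2 a3 a4 c0 c12 c13 c14 c23 c24 c34 = resolvent a1' a2' a3' a4' c0 c12 c13 c14 c23 c24 c34] (mod m)"
  unfolding resolvent_def elim_norm_def elim_const_def elim_cross_def
  by (intro cong_add cong_diff cong_mult cong_pow cong_refl assms)

lemma cong_dvd_transfer:
  fixes x y :: int
  assumes "[x = y] (mod m)" "m dvd x"
  shows "m dvd y"
  using assms cong_dvd_iff by blast

text \<open>With w_i = a_i v_i one has s w_i^2 = a_i, so inverse square roots turn into square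
  roots. Multiplication by s^2 w1 w2 w3 w4 makes all diagonal terms proportional to s w1 w2 w3 w4,
  which is why only the sum of the diagonal coefficients enters the resolvent.\<close>

lemma resolvent_root_4:
  fixes s a1 a2 a3 a4 :: int
  assumes v: "[s * a1 * v1\<^sup>2 = 1] (mod m)" "[s * a2 * v2\<^sup>2 = 1] (mod m)"
      "[s * a3 * v3\<^sup>2 = 1] (mod m)" "[s * a4 * v4\<^sup>2 = 1] (mod m)"
    and F: "m dvd c11 * a1 * v1\<^sup>2 + c22 * a2 * v2\<^sup>2 + c33 * a3 * v3\<^sup>2 + c44 * a4 * v4\<^sup>2
      + c12 * (a1 + a2) * v1 * v2 + c13 * (a1 + a3) * v1 * v3 + c14 * (a1 + a4) * v1 * v4
      + c23 * (a2 + a3) * v2 * v3 + c24 * (a2 + a4) * v2 * v4 + c34 * (a3 + a4) * v3 * v4" (is "m dvd ?F")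
  shows "m dvd resolvent a1 a2 a3 a4 (c11 + c22 + c33 + c44) c12 c13 c14 c23 c24 c34"
proof -
  define w1 where "w1 = a1 * v1"
  define w2 where "w2 = a2 * v2"
  define w3 where "w3 = a3 * v3"
  define w4 where "w4 = a4 * v4"
  define e1 where "e1 = s * a1 * v1\<^sup>2"
  define e2 where "e2 = s * a2 * v2\<^sup>2"
  define e3 where "e3 = s * a3 * v3\<^sup>2"
  define e4 where "e4 = s * a4 * v4\<^sup>2"
  have e: "[e1 = 1] (mod m)" "[e2 = 1] (mod m)" "[e3 = 1] (mod m)" "[e4 = 1] (mod m)"
    using v by (simp_all only: e1_def e2_def e3_def e4_def)
  have "[a1 * e1 = a1 * 1] (mod m)" "[a2 * e2 = a2 * 1] (mod m)"
    "[a3 * e3 = a3 * 1] (mod m)" "[a4 * e4 = a4 * 1] (mod m)"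
    by (intro cong_mult cong_refl e)+
  then have a: "[s * w1\<^sup>2 = a1] (mod m)" "[s * w2\<^sup>2 = a2] (mod m)" "[s * w3\<^sup>2 = a3] (mod m)" "[s * w4\<^sup>2 = a4] (mod m)"
    by (simp_all add: w1_def w2_def w3_def w4_def e1_def e2_def e3_def e4_def power2_eq_square mult_ac)
  have "m dvd s\<^sup>2 * w1 * w2 * w3 * w4 * ?F" using F by (rule dvd_mult)
  also have "s\<^sup>2 * w1 * w2 * w3 * w4 * ?F = (c11 * e1 + c22 * e2 + c33 * e3 + c44 * e4) * s * w1 * w2 * w3 * w4
      + c12 * (a1 + a2) * (e1 * e2 * w3 * w4) + c13 * (a1 + a3) * (e1 * e3 * w2 * w4)
      + c14 * (a1 + a4) * (e1 * e4 * w2 * w3) + c23 * (a2 + a3) * (e2 * e3 * w1 * w4)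
      + c24 * (a2 + a4) * (e2 * e4 * w1 * w3) + c34 * (a3 + a4) * (e3 * e4 * w1 * w2)"
    unfolding w1_def w2_def w3_def w4_def e1_def e2_def e3_def e4_def
    by (simp add: power2_eq_square algebra_simps)
  finally have "m dvd \<dots>" .
  moreover have "[(c11 * e1 + c22 * e2 + c33 * e3 + c44 * e4) * s * w1 * w2 * w3 * w4
      + c12 * (a1 + a2) * (e1 * e2 * w3 * w4) + c13 * (a1 + a3) * (e1 * e3 * w2 * w4)
      + c14 * (a1 + a4) * (e1 * e4 * w2 * w3) + c23 * (a2 + a3) * (e2 * e3 * w1 * w4)
      + c24 * (a2 + a4) * (e2 * e4 * w1 * w3) + c34 * (a3 + a4) * (e3 * e4 * w1 * w2) =
      (c11 * 1 + c22 * 1 + c33 * 1 + c44 * 1) * s * w1 * w2 * w3 * w4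
      + c12 * (s * w1\<^sup>2 + s * w2\<^sup>2) * (1 * 1 * w3 * w4) + c13 * (s * w1\<^sup>2 + s * w3\<^sup>2) * (1 * 1 * w2 * w4)
      + c14 * (s * w1\<^sup>2 + s * w4\<^sup>2) * (1 * 1 * w2 * w3) + c23 * (s * w2\<^sup>2 + s * w3\<^sup>2) * (1 * 1 * w1 * w4)
      + c24 * (s * w2\<^sup>2 + s * w4\<^sup>2) * (1 * 1 * w1 * w3) + c34 * (s * w3\<^sup>2 + s * w4\<^sup>2) * (1 * 1 * w1 * w2)] (mod m)"
    by (intro cong_add cong_mult e a[THEN cong_sym] cong_refl)
  ultimately have "m dvd (c11 * 1 + c22 * 1 + c33 * 1 + c44 * 1) * s * w1 * w2 * w3 * w4
      + c12 * (s * w1\<^sup>2 + s * w2\<^sup>2) * (1 * 1 * w3 * w4) + c13 * (s * w1\<^sup>2 + s * w3\<^sup>2) * (1 * 1 * w2 * w4)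
      + c14 * (s * w1\<^sup>2 + s * w4\<^sup>2) * (1 * 1 * w2 * w3) + c23 * (s * w2\<^sup>2 + s * w3\<^sup>2) * (1 * 1 * w1 * w4)
      + c24 * (s * w2\<^sup>2 + s * w4\<^sup>2) * (1 * 1 * w1 * w3) + c34 * (s * w3\<^sup>2 + s * w4\<^sup>2) * (1 * 1 * w1 * w2)"
    by (rule cong_dvd_transfer[rotated])
  then have "m dvd (c11 + c22 + c33 + c44) * s * w1 * w2 * w3 * w4
      + c12 * (s * w1\<^sup>2 + s * w2\<^sup>2) * w3 * w4 + c13 * (s * w1\<^sup>2 + s * w3\<^sup>2) * w2 * w4
      + c14 * (s * w1\<^sup>2 + s * w4\<^sup>2) * w2 * w3 + c23 * (s * w2\<^sup>2 + s * w3\<^sup>2) * w1 * w4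
      + c24 * (s * w2\<^sup>2 + s * w4\<^sup>2) * w1 * w3 + c34 * (s * w3\<^sup>2 + s * w4\<^sup>2) * w1 * w2"
    by (simp only: mult_1_right mult_1 mult.assoc)
  also have "\<dots> dvd resolvent (s * w1\<^sup>2) (s * w2\<^sup>2) (s * w3\<^sup>2) (s * w4\<^sup>2) (c11 + c22 + c33 + c44) c12 c13 c14 c23 c24 c34"
    by (intro resolvent_dvd_4 refl)
  finally show ?thesis
    by (rule cong_dvd_transfer[OF resolvent_cong[OF a]])
qed

lemma resolvent_root_3:
  fixes s a1 a2 a3 a4 :: int
  assumes v: "[s * a1 * v1\<^sup>2 = 1] (mod m)" "[s * a2 * v2\<^sup>2 = 1] (mod m)" "[s * a3 * v3\<^sup>2 = 1] (mod m)"
    and F: "m dvd c11 * a1 * v1\<^sup>2 + c22 * a2 * v2\<^sup>2 + c33 * a3 * v3\<^sup>2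
      + c12 * (a1 + a2) * v1 * v2 + c13 * (a1 + a3) * v1 * v3 + c23 * (a2 + a3) * v2 * v3" (is "m dvd ?F")
  shows "m dvd resolvent a1 a2 a3 a4 (c11 + c22 + c33) c12 c13 0 c23 0 0"
proof -
  define w1 where "w1 = a1 * v1"
  define w2 where "w2 = a2 * v2"
  define w3 where "w3 = a3 * v3"
  define e1 where "e1 = s * a1 * v1\<^sup>2"
  define e2 where "e2 = s * a2 * v2\<^sup>2"
  define e3 where "e3 = s * a3 * v3\<^sup>2"
  have e: "[e1 = 1] (mod m)" "[e2 = 1] (mod m)" "[e3 = 1] (mod m)"
    using v by (simp_all only: e1_def e2_def e3_def)
  have "[a1 * e1 = a1 * 1] (mod m)" "[a2 * e2 = a2 * 1] (mod m)" "[a3 * e3 = a3 * 1] (mod m)"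
    by (intro cong_mult cong_refl e)+
  then have a: "[s * w1\<^sup>2 = a1] (mod m)" "[s * w2\<^sup>2 = a2] (mod m)" "[s * w3\<^sup>2 = a3] (mod m)"
    by (simp_all add: w1_def w2_def w3_def e1_def e2_def e3_def power2_eq_square mult_ac)
  have "m dvd s\<^sup>2 * w1 * w2 * w3 * ?F" using F by (rule dvd_mult)
  also have "s\<^sup>2 * w1 * w2 * w3 * ?F = (c11 * e1 + c22 * e2 + c33 * e3) * s * w1 * w2 * w3
      + c12 * (a1 + a2) * (e1 * e2 * w3) + c13 * (a1 + a3) * (e1 * e3 * w2)
      + c23 * (a2 + a3) * (e2 * e3 * w1)"
    unfolding w1_def w2_def w3_def e1_def e2_def e3_def
    by (simp add: power2_eq_square algebra_simps)
  finally have "m dvd \<dots>" .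
  moreover have "[(c11 * e1 + c22 * e2 + c33 * e3) * s * w1 * w2 * w3
      + c12 * (a1 + a2) * (e1 * e2 * w3) + c13 * (a1 + a3) * (e1 * e3 * w2)
      + c23 * (a2 + a3) * (e2 * e3 * w1) =
      (c11 * 1 + c22 * 1 + c33 * 1) * s * w1 * w2 * w3
      + c12 * (s * w1\<^sup>2 + s * w2\<^sup>2) * (1 * 1 * w3) + c13 * (s * w1\<^sup>2 + s * w3\<^sup>2) * (1 * 1 * w2)
      + c23 * (s * w2\<^sup>2 + s * w3\<^sup>2) * (1 * 1 * w1)] (mod m)"
    by (intro cong_add cong_mult e a[THEN cong_sym] cong_refl)
  ultimately have "m dvd (c11 * 1 + c22 * 1 + c33 * 1) * s * w1 * w2 * w3
      + c12 * (s * w1\<^sup>2 + s * w2\<^sup>2) * (1 * 1 * w3) + c13 * (s * w1\<^sup>2 + s * w3\<^sup>2) * (1 * 1 * w2)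
      + c23 * (s * w2\<^sup>2 + s * w3\<^sup>2) * (1 * 1 * w1)"
    by (rule cong_dvd_transfer[rotated])
  then have "m dvd (c11 + c22 + c33) * s * w1 * w2 * w3
      + c12 * (s * w1\<^sup>2 + s * w2\<^sup>2) * w3 + c13 * (s * w1\<^sup>2 + s * w3\<^sup>2) * w2
      + c23 * (s * w2\<^sup>2 + s * w3\<^sup>2) * w1"
    by (simp only: mult_1_right mult_1)
  also have "\<dots> dvd resolvent (s * w1\<^sup>2) (s * w2\<^sup>2) (s * w3\<^sup>2) a4 (c11 + c22 + c33) c12 c13 0 c23 0 0"
    by (intro resolvent_dvd_3 refl)
  finally show ?thesis
    by (rule cong_dvd_transfer[OF resolvent_cong[OF a cong_refl]])
qed

lemma resolvent_root_2:
  fixes s a1 a2 a3 a4 :: int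
  assumes v: "[s * a1 * v1\<^sup>2 = 1] (mod m)" "[s * a2 * v2\<^sup>2 = 1] (mod m)"
    and F: "m dvd c11 * a1 * v1\<^sup>2 + c22 * a2 * v2\<^sup>2 + c12 * (a1 + a2) * v1 * v2" (is "m dvd ?F")
  shows "m dvd resolvent a1 a2 a3 a4 (c11 + c22) c12 0 0 0 0 0"
proof -
  define w1 where "w1 = a1 * v1"
  define w2 where "w2 = a2 * v2"
  define e1 where "e1 = s * a1 * v1\<^sup>2"
  define e2 where "e2 = s * a2 * v2\<^sup>2"
  have e: "[e1 = 1] (mod m)" "[e2 = 1] (mod m)"
    using v by (simp_all only: e1_def e2_def)
  have "[a1 * e1 = a1 * 1] (mod m)" "[a2 * e2 = a2 * 1] (mod m)"
    by (intro cong_mult cong_refl e)+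
  then have a: "[s * w1\<^sup>2 = a1] (mod m)" "[s * w2\<^sup>2 = a2] (mod m)"
    by (simp_all add: w1_def w2_def e1_def e2_def power2_eq_square mult_ac)
  have "m dvd s\<^sup>2 * w1 * w2 * ?F" using F by (rule dvd_mult)
  also have "s\<^sup>2 * w1 * w2 * ?F = (c11 * e1 + c22 * e2) * s * w1 * w2 + c12 * (a1 + a2) * (e1 * e2)"
    unfolding w1_def w2_def e1_def e2_def
    by (simp add: power2_eq_square algebra_simps)
  finally have "m dvd \<dots>" .
  moreover have "[(c11 * e1 + c22 * e2) * s * w1 * w2 + c12 * (a1 + a2) * (e1 * e2) =
      (c11 * 1 + c22 * 1) * s * w1 * w2 + c12 * (s * w1\<^sup>2 + s * w2\<^sup>2) * (1 * 1)] (mod m)"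
    by (intro cong_add cong_mult e a[THEN cong_sym] cong_refl)
  ultimately have "m dvd (c11 * 1 + c22 * 1) * s * w1 * w2 + c12 * (s * w1\<^sup>2 + s * w2\<^sup>2) * (1 * 1)"
    by (rule cong_dvd_transfer[rotated])
  then have "m dvd (c11 + c22) * s * w1 * w2 + c12 * (s * w1\<^sup>2 + s * w2\<^sup>2)"
    by (simp only: mult_1_right mult_1)
  also have "\<dots> dvd resolvent (s * w1\<^sup>2) (s * w2\<^sup>2) a3 a4 (c11 + c22) c12 0 0 0 0 0"
    by (intro resolvent_dvd_2 refl)
  finally show ?thesis
    by (rule cong_dvd_transfer[OF resolvent_cong[OF a cong_refl cong_refl]])
qed

lemma not_cong_of_residues:
  assumes "x \<in> {0..<m}" "y \<in> {0..<m}" "x \<noteq> y"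
  shows "\<not> [x = y] (mod (m :: int))"
  using assms by (auto simp: cong_def)

text \<open>
  If \<open>B\<close> has fewer than four elements, the missing linear polynomials are filled in by arbitrary
  residues, whose square roots need not exist modulo \<open>p\<close>; their coefficients are zero.
\<close>

lemma card_relation_roots_le:
  assumes p: "Factorial_Ring.prime p" "p > 4" and B: "B \<subseteq> {0..<int p}" "card B \<in> {2, 3, 4}"
    and sym: "\<And>x y. c x y = c y x"
    and c: "\<not> (int p dvd (\<Sum>x\<in>B. c x x) \<and> (\<forall>x\<in>B. \<forall>y\<in>B. x \<noteq> y \<longrightarrow> int p dvd c x y))"
  shows "card {r \<in> {0..<int p}. \<exists>s v. (\<forall>x\<in>B. [s * (x + r) * (v x)\<^sup>2 = 1] (mod int p)) \<and>
    int p dvd (\<Sum>x\<in>B. \<Sum>y\<in>B. c x y * (x + r) * v x * v y)} \<le> 16" (is "card ?S \<le> 16")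
proof -
  have "finite B" using B(1) by (rule finite_subset) simp
  have pick: "\<exists>x\<in>{0..<int p}. x \<notin> C" if "card C \<le> 3" "finite C" for C
  proof (rule ccontr)
    assume "\<not> ?thesis"
    then have "{0..<int p} \<subseteq> C" by blast
    from card_mono[OF that(2) this] that(1) p(2) show False by simp
  qed
  \<comment> \<open>The three sizes of \<open>B\<close> differ only in the coefficients handed to
    the resolvent; the count is the same once these are nonzero and every r in question is a
    root.\<close>
  have bound: "card ?S \<le> 16"
    if b: "b1 \<in> {0..<int p}" "b2 \<in> {0..<int p}" "b3 \<in> {0..<int p}" "b4 \<in> {0..<int p}"
      "b1 \<noteq> b2" "b1 \<noteq> b3" "b1 \<noteq> b4" "b2 \<noteq> b3" "b2 \<noteq> b4" "b3 \<noteq> b4"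
      and nz: "\<not> (int p dvd c0 \<and> int p dvd c12 \<and> int p dvd c13 \<and> int p dvd c14 \<and> int p dvd c23 \<and> int p dvd c24 \<and> int p dvd c34)"
      and root: "\<And>r s v. \<forall>x\<in>B. [s * (x + r) * (v x)\<^sup>2 = 1] (mod int p) \<Longrightarrow>
        int p dvd (\<Sum>x\<in>B. \<Sum>y\<in>B. c x y * (x + r) * v x * v y) \<Longrightarrow>
        int p dvd resolvent (b1 + r) (b2 + r) (b3 + r) (b4 + r) c0 c12 c13 c14 c23 c24 c34"
    for b1 b2 b3 b4 c0 c12 c13 c14 c23 c24 c34
  proof -
    let ?T = "{r \<in> {0..<int p}. int p dvd resolvent (b1 + r) (b2 + r) (b3 + r) (b4 + r) c0 c12 c13 c14 c23 c24 c34}"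
    have "?S \<subseteq> ?T" using root by blast
    moreover have "finite ?T" by (rule finite_subset[of _ "{0..<int p}"]) auto
    ultimately have "card ?S \<le> card ?T" by (rule card_mono[rotated])
    also have "card ?T \<le> 16"
      using b nz by (intro card_resolvent_roots_le p not_cong_of_residues) auto
    finally show ?thesis .
  qed
  from B(2) consider "card B = 2" | "card B = 3" | "card B = 4" by auto
  then show ?thesis
  proof cases
    case 1
    then obtain b1 b2 where b: "B = {b1, b2}" "b1 \<noteq> b2" by (auto simp: card_2_iff)
    obtain b3 where b3: "b3 \<in> {0..<int p}" "b3 \<notin> {b1, b2}"
      using pick[of "{b1, b2}"] b(2) by auto
    obtain b4 where b4: "b4 \<in> {0..<int p}" "b4 \<notin> {b1, b2, b3}"
      using pick[of "{b1, b2, b3}"] b(2) b3 by (auto simp: card_insert_if)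
    show ?thesis
    proof (rule bound[of b1 b2 b3 b4 "c b1 b1 + c b2 b2" "c b1 b2" 0 0 0 0 0])
      show "\<not> (int p dvd c b1 b1 + c b2 b2 \<and> int p dvd c b1 b2 \<and> int p dvd 0 \<and> int p dvd 0 \<and>
          int p dvd 0 \<and> int p dvd 0 \<and> int p dvd 0)"
        using c b sym[of b2 b1] by auto
    next
      fix r s v
      assume v: "\<forall>x\<in>B. [s * (x + r) * (v x)\<^sup>2 = 1] (mod int p)"
        and F: "int p dvd (\<Sum>x\<in>B. \<Sum>y\<in>B. c x y * (x + r) * v x * v y)"
      have "(\<Sum>x\<in>B. \<Sum>y\<in>B. c x y * (x + r) * v x * v y) =
        c b1 b1 * (b1 + r) * (v b1)\<^sup>2 + c b2 b2 * (b2 + r) * (v b2)\<^sup>2 + c b1 b2 * ((b1 + r) + (b2 + r)) * v b1 * v b2"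
        using b by (simp add: sym[of b2 b1] power2_eq_square algebra_simps)
      with F show "int p dvd resolvent (b1 + r) (b2 + r) (b3 + r) (b4 + r) (c b1 b1 + c b2 b2) (c b1 b2) 0 0 0 0 0"
        using v b by (intro resolvent_root_2[where s = s and ?v1.0 = "v b1" and ?v2.0 = "v b2"]) auto
    qed (use b b3 b4 B(1) in auto)
  next
    case 2
    then obtain b1 b2 b3 where b: "B = {b1, b2, b3}" "b1 \<noteq> b2" "b1 \<noteq> b3" "b2 \<noteq> b3"
      by (auto simp: card_3_iff)
    obtain b4 where b4: "b4 \<in> {0..<int p}" "b4 \<notin> {b1, b2, b3}"
      using pick[of "{b1, b2, b3}"] b by auto
    show ?thesis
    proof (rule bound[of b1 b2 b3 b4 "c b1 b1 + c b2 b2 + c b3 b3" "c b1 b2" "c b1 b3" 0 "c b2 b3" 0 0])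
      show "\<not> (int p dvd c b1 b1 + c b2 b2 + c b3 b3 \<and> int p dvd c b1 b2 \<and> int p dvd c b1 b3 \<and> int p dvd 0 \<and>
          int p dvd c b2 b3 \<and> int p dvd 0 \<and> int p dvd 0)"
        using c b sym[of b2 b1] sym[of b3 b1] sym[of b3 b2] by (auto simp: add.assoc)
    next
      fix r s v
      assume v: "\<forall>x\<in>B. [s * (x + r) * (v x)\<^sup>2 = 1] (mod int p)"
        and F: "int p dvd (\<Sum>x\<in>B. \<Sum>y\<in>B. c x y * (x + r) * v x * v y)"
      have "(\<Sum>x\<in>B. \<Sum>y\<in>B. c x y * (x + r) * v x * v y) =
        c b1 b1 * (b1 + r) * (v b1)\<^sup>2 + c b2 b2 * (b2 + r) * (v b2)\<^sup>2 + c b3 b3 * (b3 + r) * (v b3)\<^sup>2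
        + c b1 b2 * ((b1 + r) + (b2 + r)) * v b1 * v b2 + c b1 b3 * ((b1 + r) + (b3 + r)) * v b1 * v b3
        + c b2 b3 * ((b2 + r) + (b3 + r)) * v b2 * v b3"
        using b by (simp add: sym[of b2 b1] sym[of b3 b1] sym[of b3 b2] power2_eq_square algebra_simps)
      with F show "int p dvd resolvent (b1 + r) (b2 + r) (b3 + r) (b4 + r)
          (c b1 b1 + c b2 b2 + c b3 b3) (c b1 b2) (c b1 b3) 0 (c b2 b3) 0 0"
        using v b by (intro resolvent_root_3[where s = s and ?v1.0 = "v b1" and ?v2.0 = "v b2" and ?v3.0 = "v b3"]) auto
    qed (use b b4 B(1) in auto)
  next
    case 3
    then have "card B = Suc 3" by simp
    from card_eq_SucD[OF this] obtain b1 C where C: "B = insert b1 C" "b1 \<notin> C" "card C = 3"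
      by blast
    then obtain b2 b3 b4 where "C = {b2, b3, b4}" "b2 \<noteq> b3" "b2 \<noteq> b4" "b3 \<noteq> b4"
      by (auto simp: card_3_iff)
    with C have b: "B = {b1, b2, b3, b4}" "b1 \<noteq> b2" "b1 \<noteq> b3" "b1 \<noteq> b4" "b2 \<noteq> b3" "b2 \<noteq> b4" "b3 \<noteq> b4"
      by auto
    show ?thesis
    proof (rule bound[of b1 b2 b3 b4 "c b1 b1 + c b2 b2 + c b3 b3 + c b4 b4"
          "c b1 b2" "c b1 b3" "c b1 b4" "c b2 b3" "c b2 b4" "c b3 b4"])
      show "\<not> (int p dvd c b1 b1 + c b2 b2 + c b3 b3 + c b4 b4 \<and> int p dvd c b1 b2 \<and> int p dvd c b1 b3 \<and>
          int p dvd c b1 b4 \<and> int p dvd c b2 b3 \<and> int p dvd c b2 b4 \<and> int p dvd c b3 b4)"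
        using c b sym[of b2 b1] sym[of b3 b1] sym[of b4 b1] sym[of b3 b2] sym[of b4 b2] sym[of b4 b3]
        by (auto simp: add.assoc)
    next
      fix r s v
      assume v: "\<forall>x\<in>B. [s * (x + r) * (v x)\<^sup>2 = 1] (mod int p)"
        and F: "int p dvd (\<Sum>x\<in>B. \<Sum>y\<in>B. c x y * (x + r) * v x * v y)"
      have "(\<Sum>x\<in>B. \<Sum>y\<in>B. c x y * (x + r) * v x * v y) =
        c b1 b1 * (b1 + r) * (v b1)\<^sup>2 + c b2 b2 * (b2 + r) * (v b2)\<^sup>2 + c b3 b3 * (b3 + r) * (v b3)\<^sup>2
        + c b4 b4 * (b4 + r) * (v b4)\<^sup>2
        + c b1 b2 * ((b1 + r) + (b2 + r)) * v b1 * v b2 + c b1 b3 * ((b1 + r) + (b3 + r)) * v b1 * v b3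
        + c b1 b4 * ((b1 + r) + (b4 + r)) * v b1 * v b4 + c b2 b3 * ((b2 + r) + (b3 + r)) * v b2 * v b3
        + c b2 b4 * ((b2 + r) + (b4 + r)) * v b2 * v b4 + c b3 b4 * ((b3 + r) + (b4 + r)) * v b3 * v b4"
        using b by (simp add: sym[of b2 b1] sym[of b3 b1] sym[of b4 b1] sym[of b3 b2] sym[of b4 b2] sym[of b4 b3]
            power2_eq_square algebra_simps)
      with F show "int p dvd resolvent (b1 + r) (b2 + r) (b3 + r) (b4 + r)
          (c b1 b1 + c b2 b2 + c b3 b3 + c b4 b4) (c b1 b2) (c b1 b3) (c b1 b4) (c b2 b3) (c b2 b4) (c b3 b4)"
        using v b by (intro resolvent_root_4[where s = s and ?v1.0 = "v b1" and ?v2.0 = "v b2" and ?v3.0 = "v b3"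
              and ?v4.0 = "v b4"]) auto
    qed (use b B(1) in auto)
  qed
qed

section \<open>Counting the critical points\<close>

lemma square_cong_imp_sign:
  fixes u v :: int
  assumes "Factorial_Ring.prime p" and "[u\<^sup>2 = v\<^sup>2] (mod int p)"
  shows "\<exists>e\<in>{1, -1}. [u = e * v] (mod int p)"
proof -
  have "int p dvd (u - v) * (u + v)"
    using assms(2) by (simp add: cong_iff_dvd_diff power2_eq_square algebra_simps)
  then have "int p dvd u - v \<or> int p dvd u + v"
    using assms(1) by (simp add: prime_dvd_mult_iff)
  then show ?thesis by (auto simp: cong_iff_dvd_diff)
qed

lemma not_dvd_of_cong_1:
  assumes "Factorial_Ring.prime p" "[x * y = 1] (mod int p)"
  shows "\<not> int p dvd x" "\<not> int p dvd y"
proof -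
  have "\<not> int p dvd x * y"
  proof
    assume "int p dvd x * y"
    then have "int p dvd 1" using assms(2) by (rule cong_dvd_transfer[rotated])
    then show False using assms(1) by (simp add: prime_nat_iff)
  qed
  then show "\<not> int p dvd x" "\<not> int p dvd y" by auto
qed

lemma cong_cancel_prime:
  assumes "Factorial_Ring.prime p" "\<not> int p dvd a" "[a * x = a * y] (mod int p)"
  shows "[x = y] (mod int p)"
proof -
  have "int p dvd a * (x - y)"
    using assms(3) by (simp add: cong_iff_dvd_diff algebra_simps)
  then show ?thesis
    using assms(1,2) by (simp add: prime_dvd_mult_iff cong_iff_dvd_diff)
qed

definition sign_vectors :: "('n::finite \<Rightarrow> int) set" where
  "sign_vectors = (\<Pi>\<^sub>E j\<in>UNIV. {1, -1})"

lemma finite_sign_vectors [simp]: "finite (sign_vectors :: ('n::finite \<Rightarrow> int) set)"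
  unfolding sign_vectors_def by (intro finite_PiE) auto

lemma card_sign_vectors: "card (sign_vectors :: (4 \<Rightarrow> int) set) = 16"
  unfolding sign_vectors_def by (simp add: card_PiE power4_eq_xxxx)

lemma sign_vectors_iff: "\<epsilon> \<in> sign_vectors \<longleftrightarrow> (\<forall>j. \<epsilon> j = 1 \<or> \<epsilon> j = -1)"
  by (auto simp: sign_vectors_def PiE_iff)

text \<open>The two equations give (x'_j / x_j)^2 = s / s', which does not depend on j, so the
  ratios agree up to sign.\<close>

lemma solution_ratio:
  fixes x x' :: "4 \<Rightarrow> int"
  assumes p: "Factorial_Ring.prime p"
    and x: "\<And>j. [s * a j * (x j)\<^sup>2 = 1] (mod int p)"
    and x': "\<And>j. [s' * a j * (x' j)\<^sup>2 = 1] (mod int p)"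
  shows "\<exists>\<tau>. \<exists>\<eta>\<in>sign_vectors. (\<forall>j. [x' j = \<tau> * \<eta> j * x j] (mod int p)) \<and> [s' * \<tau>\<^sup>2 = s] (mod int p)"
proof -
  have nd: "\<not> int p dvd s' * a j" "\<not> int p dvd a j" "\<not> int p dvd s'" "\<not> int p dvd x j" for j
    using not_dvd_of_cong_1[OF p x[of j]] not_dvd_of_cong_1[OF p x'[of j]]
    by (auto simp: power2_eq_square)
  have sq: "[s' * (x' j)\<^sup>2 = s * (x j)\<^sup>2] (mod int p)" for j
  proof -
    have "[s' * a j * (x' j)\<^sup>2 = s * a j * (x j)\<^sup>2] (mod int p)"
      by (rule cong_trans[OF x' cong_sym[OF x]])
    then have "[a j * (s' * (x' j)\<^sup>2) = a j * (s * (x j)\<^sup>2)] (mod int p)"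
      by (simp only: ac_simps)
    then show ?thesis by (rule cong_cancel_prime[OF p nd(2)])
  qed
  have "coprime (int p) (x 1)"
    using p nd(4)[of 1] by (intro prime_imp_coprime) auto
  then have y: "[x 1 * modular_inverse (int p) (x 1) = 1] (mod int p)"
    by (intro cong_modular_inverse1) (simp only: coprime_commute)
  define y where "y = modular_inverse (int p) (x 1)"
  note y = y[folded y_def]
  \<comment> \<open>The common ratio is normalised at index 1; any other index would do.\<close>
  define \<tau> where "\<tau> = x' 1 * y"
  have "[(s' * (x' 1)\<^sup>2) * y\<^sup>2 = (s * (x 1)\<^sup>2) * y\<^sup>2] (mod int p)"
    by (intro cong_mult sq cong_refl)
  also have "(s * (x 1)\<^sup>2) * y\<^sup>2 = s * (x 1 * y)\<^sup>2" by (simp add: power_mult_distrib)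
  also have "[s * (x 1 * y)\<^sup>2 = s * 1\<^sup>2] (mod int p)" by (intro cong_mult cong_pow y cong_refl)
  finally have \<tau>: "[s' * \<tau>\<^sup>2 = s] (mod int p)"
    by (simp add: \<tau>_def power_mult_distrib mult_ac)
  have "\<exists>e\<in>{1, -1}. [x' j = e * (\<tau> * x j)] (mod int p)" for j
  proof (rule square_cong_imp_sign[OF p])
    have "[s' * (x' j)\<^sup>2 = (s' * \<tau>\<^sup>2) * (x j)\<^sup>2] (mod int p)"
      by (rule cong_trans[OF sq cong_sym[OF cong_mult[OF \<tau> cong_refl]]])
    then have "[s' * (x' j)\<^sup>2 = s' * (\<tau> * x j)\<^sup>2] (mod int p)"
      by (simp add: power_mult_distrib mult.assoc)
    then show "[(x' j)\<^sup>2 = (\<tau> * x j)\<^sup>2] (mod int p)"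
      by (rule cong_cancel_prime[OF p nd(3)])
  qed
  then obtain \<eta> where \<eta>: "\<And>j. \<eta> j \<in> {1, -1}" "\<And>j. [x' j = \<eta> j * (\<tau> * x j)] (mod int p)"
    by metis
  have "\<eta> \<in> sign_vectors" using \<eta>(1) by (auto simp: sign_vectors_iff)
  moreover have "[x' j = \<tau> * \<eta> j * x j] (mod int p)" for j
    using \<eta>(2)[of j] by (simp add: ac_simps)
  ultimately show ?thesis using \<tau> by blast
qed

text \<open>Indices with the same residue of \<open>b j\<close> satisfy the same quadratic
  congruence, so their x j agree up to sign. \<open>v\<close> takes the value at a chosen
  representative index, which reduces the unknowns to one per residue.\<close>

lemma solution_grouping:
  fixes x :: "4 \<Rightarrow> int"
  assumes p: "Factorial_Ring.prime p"
    and x: "\<And>j. [s * (r + b j) * (x j)\<^sup>2 = 1] (mod int p)"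
  shows "\<exists>\<epsilon>\<in>sign_vectors. \<exists>v. (\<forall>j. [x j = \<epsilon> j * v (b j mod int p)] (mod int p)) \<and>
    (\<forall>\<beta>\<in>range (\<lambda>j. b j mod int p). [s * (\<beta> + r) * (v \<beta>)\<^sup>2 = 1] (mod int p))"
proof -
  define rep where "rep \<beta> = (SOME j. b j mod int p = \<beta>)" for \<beta>
  have rep: "b (rep (b j mod int p)) mod int p = b j mod int p" for j
    unfolding rep_def by (rule someI) (rule refl)
  define v where "v \<beta> = x (rep \<beta>)" for \<beta>
  have v: "[s * (b j mod int p + r) * (v (b j mod int p))\<^sup>2 = 1] (mod int p)" for j
  proof -
    have "[s * (b j mod int p + r) * (v (b j mod int p))\<^sup>2 =
        s * (r + b (rep (b j mod int p))) * (v (b j mod int p))\<^sup>2] (mod int p)"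
    proof (intro cong_mult cong_refl)
      have "[b j mod int p = b (rep (b j mod int p))] (mod int p)"
        using rep[of j] by (simp add: cong_def)
      then have "[b j mod int p + r = b (rep (b j mod int p)) + r] (mod int p)"
        by (intro cong_add cong_refl)
      then show "[b j mod int p + r = r + b (rep (b j mod int p))] (mod int p)"
        by (simp only: add.commute)
    qed
    also have "[s * (r + b (rep (b j mod int p))) * (v (b j mod int p))\<^sup>2 = 1] (mod int p)"
      unfolding v_def by (rule x)
    finally show ?thesis .
  qed
  have "\<exists>e\<in>{1, -1}. [x j = e * v (b j mod int p)] (mod int p)" for j
  proof (rule square_cong_imp_sign[OF p])
    let ?c = "s * (b j mod int p + r)"
    have "[b j mod int p + r = r + b j] (mod int p)"
      by (simp add: cong_def mod_simps add.commute)
    then have "[?c * (x j)\<^sup>2 = s * (r + b j) * (x j)\<^sup>2] (mod int p)"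
      by (intro cong_mult cong_refl)
    then have "[?c * (x j)\<^sup>2 = ?c * (v (b j mod int p))\<^sup>2] (mod int p)"
      by (rule cong_trans[OF cong_trans[OF _ x] cong_sym[OF v]])
    then show "[(x j)\<^sup>2 = (v (b j mod int p))\<^sup>2] (mod int p)"
      by (rule cong_cancel_prime[OF p not_dvd_of_cong_1(1)[OF p v]])
  qed
  then obtain \<epsilon> where \<epsilon>: "\<And>j. \<epsilon> j \<in> {1, -1}" "\<And>j. [x j = \<epsilon> j * v (b j mod int p)] (mod int p)"
    by metis
  have "\<epsilon> \<in> sign_vectors" using \<epsilon>(1) by (auto simp: sign_vectors_iff)
  with \<epsilon>(2) v show ?thesis by blast
qed

section \<open>Fibres and pairings of four indices\<close>

lemma card_filter_4: "card {j :: 4. P j} = of_bool (P 1) + of_bool (P 2) + of_bool (P 3) + of_bool (P 4)"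
proof -
  have "card {j :: 4. P j} = (\<Sum>j\<in>{j \<in> UNIV. P j}. 1)" by simp
  also have "\<dots> = (\<Sum>j\<in>UNIV. if P j then 1 else 0)" by (rule sum.inter_filter) simp
  finally show ?thesis unfolding sum_4 of_bool_def .
qed

lemma even_fibres_of_pairing:
  fixes f :: "4 \<Rightarrow> 'a"
  assumes "f 1 = f 2 \<and> f 3 = f 4 \<or> f 1 = f 3 \<and> f 2 = f 4 \<or> f 2 = f 3 \<and> f 1 = f 4"
  shows "even (card {j. f j = f i})"
  using assms unfolding card_filter_4 by (elim disjE) (auto simp: of_bool_def)

text \<open>If every class of a partition of four points has at least two elements, the class sizes
  are 4 or 2 + 2, hence all even.\<close>

lemma exists_singleton_fibre:
  fixes f :: "4 \<Rightarrow> 'a"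
  assumes "odd (card {j. f j = f i})"
  shows "\<exists>k. \<forall>j. f j = f k \<longrightarrow> j = k"
proof (rule ccontr)
  assume "\<not> ?thesis"
  then have *: "\<exists>j. f j = f k \<and> j \<noteq> k" for k by blast
  have ex: "(\<exists>j :: 4. P j) \<longleftrightarrow> P 1 \<or> P 2 \<or> P 3 \<or> P 4" for P
    using forall_4[of "\<lambda>j. \<not> P j"] by blast
  have "f 1 = f 2 \<and> f 3 = f 4 \<or> f 1 = f 3 \<and> f 2 = f 4 \<or> f 2 = f 3 \<and> f 1 = f 4"
  proof -
    have "f 2 = f 1 \<or> f 3 = f 1 \<or> f 4 = f 1" using *[of 1] unfolding ex by simp
    moreover have "f 1 = f 2 \<or> f 3 = f 2 \<or> f 4 = f 2" using *[of 2] unfolding ex by simp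
    moreover have "f 1 = f 3 \<or> f 2 = f 3 \<or> f 4 = f 3" using *[of 3] unfolding ex by simp
    moreover have "f 1 = f 4 \<or> f 2 = f 4 \<or> f 3 = f 4" using *[of 4] unfolding ex by simp
    ultimately show ?thesis by (smt (verit))
  qed
  then show False using even_fibres_of_pairing[of f i] assms by blast
qed

text \<open>
  The first and third elementary symmetric functions of the \<open>x j\<close> vanish, so their multiset is
  symmetric under negation.
\<close>

lemma sums_vanish_imp_pairing:
  fixes x a :: "4 \<Rightarrow> int"
  assumes p: "Factorial_Ring.prime p"
    and x: "\<And>j. [s * a j * (x j)\<^sup>2 = 1] (mod int p)"
    and sum: "int p dvd (\<Sum>j\<in>UNIV. x j)" and sum': "int p dvd (\<Sum>j\<in>UNIV. a j * x j)"
  shows "[a 1 = a 2] (mod int p) \<and> [a 3 = a 4] (mod int p) \<or>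
    [a 1 = a 3] (mod int p) \<and> [a 2 = a 4] (mod int p) \<or>
    [a 2 = a 3] (mod int p) \<and> [a 1 = a 4] (mod int p)"
proof -
  define e where "e j = s * a j * (x j)\<^sup>2" for j
  have e: "[e j = 1] (mod int p)" for j using x by (simp add: e_def)
  have sum4: "int p dvd x 1 + x 2 + x 3 + x 4" using sum by (simp add: sum_4)
  \<comment> \<open>Since a_j = 1 / (s x_j^2), this multiplier turns the weighted sum into the third
    elementary symmetric function of the x_j.\<close>
  have "int p dvd s * x 1 * x 2 * x 3 * x 4 * (a 1 * x 1 + a 2 * x 2 + a 3 * x 3 + a 4 * x 4)"
    using sum' by (simp add: sum_4)
  also have "s * x 1 * x 2 * x 3 * x 4 * (a 1 * x 1 + a 2 * x 2 + a 3 * x 3 + a 4 * x 4) =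
      e 1 * (x 2 * x 3 * x 4) + e 2 * (x 1 * x 3 * x 4) + e 3 * (x 1 * x 2 * x 4) + e 4 * (x 1 * x 2 * x 3)"
    by (simp add: e_def power2_eq_square algebra_simps)
  finally have "int p dvd \<dots>" .
  moreover have "[e 1 * (x 2 * x 3 * x 4) + e 2 * (x 1 * x 3 * x 4) + e 3 * (x 1 * x 2 * x 4) + e 4 * (x 1 * x 2 * x 3) =
      1 * (x 2 * x 3 * x 4) + 1 * (x 1 * x 3 * x 4) + 1 * (x 1 * x 2 * x 4) + 1 * (x 1 * x 2 * x 3)] (mod int p)"
    by (intro cong_add cong_mult e cong_refl)
  ultimately have e3: "int p dvd 1 * (x 2 * x 3 * x 4) + 1 * (x 1 * x 3 * x 4) + 1 * (x 1 * x 2 * x 4) + 1 * (x 1 * x 2 * x 3)"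
    by (rule cong_dvd_transfer[rotated])
  \<comment> \<open>Modulo the sum of all four, this product is minus the third elementary symmetric
    function.\<close>
  have "(x 1 + x 2) * (x 1 + x 3) * (x 2 + x 3) = (x 1 + x 2 + x 3 + x 4) * (x 1 * x 2 + x 1 * x 3 + x 2 * x 3)
      - (1 * (x 2 * x 3 * x 4) + 1 * (x 1 * x 3 * x 4) + 1 * (x 1 * x 2 * x 4) + 1 * (x 1 * x 2 * x 3))"
    by (simp add: algebra_simps)
  moreover have "int p dvd \<dots>"
    by (intro dvd_diff e3 dvd_mult2 sum4)
  ultimately have "int p dvd (x 1 + x 2) * (x 1 + x 3) * (x 2 + x 3)" by (simp only:)
  then have cases: "int p dvd x 1 + x 2 \<or> int p dvd x 1 + x 3 \<or> int p dvd x 2 + x 3"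
    using p by (auto simp: prime_dvd_mult_iff)
  \<comment> \<open>Opposite values have equal squares, and x_j^2 determines a_j.\<close>
  have opp: "[a i = a j] (mod int p)" if "int p dvd x i + x j" for i j
  proof -
    have "int p dvd (x i + x j) * (x i - x j)" using that by (rule dvd_mult2)
    then have "[(x j)\<^sup>2 = (x i)\<^sup>2] (mod int p)"
      by (subst cong_sym_eq) (simp add: cong_iff_dvd_diff power2_eq_square algebra_simps)
    then have "[s * a j * (x i)\<^sup>2 = s * a j * (x j)\<^sup>2] (mod int p)"
      by (rule cong_mult[OF cong_refl cong_sym])
    then have "[s * a j * (x i)\<^sup>2 = s * a i * (x i)\<^sup>2] (mod int p)"
      by (rule cong_trans[OF cong_trans[OF _ x] cong_sym[OF x]])
    then have "[(s * (x i)\<^sup>2) * a j = (s * (x i)\<^sup>2) * a i] (mod int p)"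
      by (simp only: ac_simps)
    note eq = this
    have "[(s * (x i)\<^sup>2) * a i = 1] (mod int p)"
      using x[of i] by (simp only: ac_simps)
    then have "\<not> int p dvd s * (x i)\<^sup>2" by (rule not_dvd_of_cong_1(1)[OF p])
    from cong_cancel_prime[OF p this eq] show ?thesis by (rule cong_sym)
  qed
  have compl: "int p dvd x k + x l"
    if "int p dvd x i + x j" "x i + x j + (x k + x l) = x 1 + x 2 + x 3 + x 4" for i j k l
  proof -
    have "x k + x l = (x 1 + x 2 + x 3 + x 4) - (x i + x j)" using that(2) by simp
    moreover have "int p dvd (x 1 + x 2 + x 3 + x 4) - (x i + x j)"
      by (rule dvd_diff[OF sum4 that(1)])
    ultimately show ?thesis by (simp only:)
  qed
  from cases show ?thesis
  proof (elim disjE)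
    assume *: "int p dvd x 1 + x 2"
    then have "int p dvd x 3 + x 4" by (rule compl) simp
    with * show ?thesis using opp by blast
  next
    assume *: "int p dvd x 1 + x 3"
    then have "int p dvd x 2 + x 4" by (rule compl) simp
    with * show ?thesis using opp by blast
  next
    assume *: "int p dvd x 2 + x 3"
    then have "int p dvd x 1 + x 4" by (rule compl) simp
    with * show ?thesis using opp by blast
  qed
qed

section \<open>Equations for r\<close>

definition relation_roots :: "nat \<Rightarrow> int set \<Rightarrow> (int \<Rightarrow> int \<Rightarrow> int) \<Rightarrow> int set" where
  "relation_roots p B c = {r \<in> {0..<int p}. \<exists>s v. (\<forall>x\<in>B. [s * (x + r) * (v x)\<^sup>2 = 1] (mod int p)) \<and>
    int p dvd (\<Sum>x\<in>B. \<Sum>y\<in>B. c x y * (x + r) * v x * v y)}"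

text \<open>With \<open>f j\<close> the residue of \<open>b j\<close>, this is the coefficient of
  \<open>v y\<close> after the unknowns sharing the residue y have been merged.\<close>

definition fibre_sum :: "('n::finite \<Rightarrow> int) \<Rightarrow> ('n \<Rightarrow> int) \<Rightarrow> int \<Rightarrow> int" where
  "fibre_sum f \<epsilon> y = (\<Sum>j | f j = y. \<epsilon> j)"

lemma sum_by_fibres:
  fixes f :: "'n::finite \<Rightarrow> int"
  shows "(\<Sum>j\<in>UNIV. \<epsilon> j * g (f j)) = (\<Sum>y\<in>range f. fibre_sum f \<epsilon> y * g y)"
proof -
  have "(\<Sum>j\<in>UNIV. \<epsilon> j * g (f j)) = (\<Sum>y\<in>range f. \<Sum>j\<in>{j. j \<in> UNIV \<and> f j = y}. \<epsilon> j * g (f j))"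
    by (rule sum.group[symmetric]) auto
  also have "\<dots> = (\<Sum>y\<in>range f. fibre_sum f \<epsilon> y * g y)"
    unfolding fibre_sum_def sum_distrib_right by (intro sum.cong) auto
  finally show ?thesis .
qed

lemma sign_vectors_values:
  assumes "\<epsilon> \<in> sign_vectors"
  shows "\<bar>\<epsilon> j\<bar> = 1" "(\<epsilon> j)\<^sup>2 = 1"
proof -
  have "\<epsilon> j = 1 \<or> \<epsilon> j = -1" using assms by (simp add: sign_vectors_iff)
  then show "\<bar>\<epsilon> j\<bar> = 1" "(\<epsilon> j)\<^sup>2 = 1" by auto
qed

lemma abs_fibre_sum_le:
  fixes f :: "4 \<Rightarrow> int"
  assumes "\<epsilon> \<in> sign_vectors"
  shows "\<bar>fibre_sum f \<epsilon> y\<bar> \<le> 4"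
proof -
  have "\<bar>fibre_sum f \<epsilon> y\<bar> \<le> (\<Sum>j | f j = y. \<bar>\<epsilon> j\<bar>)"
    unfolding fibre_sum_def by (rule sum_abs)
  also have "\<dots> \<le> (\<Sum>j\<in>UNIV. \<bar>\<epsilon> j\<bar>)"
    by (rule sum_mono2) auto
  also have "\<dots> = (\<Sum>j\<in>(UNIV::4 set). 1)"
    using assms by (simp add: sign_vectors_values)
  also have "\<dots> = 4" by simp
  finally show ?thesis .
qed

lemma fibre_sum_singleton:
  assumes "\<And>j. f j = f k \<Longrightarrow> j = k"
  shows "fibre_sum f \<epsilon> (f k) = \<epsilon> k"
proof -
  have "{j. f j = f k} = {k}" using assms by auto
  then show ?thesis by (simp add: fibre_sum_def)
qed

lemma card_range_singleton_fibre:
  fixes f :: "4 \<Rightarrow> int"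
  assumes "\<And>j. f j = f k \<Longrightarrow> j = k"
  shows "card (range f) \<in> {2, 3, 4}"
proof -
  have "card (range f) \<le> card (UNIV :: 4 set)" by (rule card_image_le) simp
  then have le: "card (range f) \<le> 4" by simp
  obtain j where "j \<noteq> k" by (metis one_neq_zero)
  then have "f j \<noteq> f k" using assms by blast
  then have "card {f j, f k} = 2" by simp
  moreover have "card {f j, f k} \<le> card (range f)" by (rule card_mono) auto
  ultimately show ?thesis using le by auto
qed

text \<open>Brings a product of a weighted and an unweighted linear form into the double sum with
  symmetric coefficients m x * m y to which \<open>card_relation_roots_le\<close> applies.\<close>

lemma sum_product_form:
  fixes m v :: "'b \<Rightarrow> 'a::comm_ring"
  shows "(\<Sum>x\<in>B. \<Sum>y\<in>B. (m x * m y) * a x * v x * v y) =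
    (\<Sum>x\<in>B. m x * (a x * v x)) * (\<Sum>y\<in>B. m y * v y)"
  unfolding sum_product by (intro sum.cong refl) (simp only: ac_simps)

lemma card_UN_sign_vectors_le:
  fixes A :: "(4 \<Rightarrow> int) \<Rightarrow> 'a set"
  assumes "\<And>\<epsilon>. \<epsilon> \<in> sign_vectors \<Longrightarrow> card (A \<epsilon>) \<le> k" "\<And>\<epsilon>. finite (A \<epsilon>)"
    and "S \<subseteq> (\<Union>\<epsilon>\<in>sign_vectors. A \<epsilon>)"
  shows "card S \<le> 16 * k"
proof -
  have "card S \<le> card (\<Union>\<epsilon>\<in>sign_vectors. A \<epsilon>)"
    using assms(2,3) by (intro card_mono finite_UN_I) auto
  also have "\<dots> \<le> (\<Sum>\<epsilon>\<in>sign_vectors. card (A \<epsilon>))"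
    by (rule card_UN_le) simp
  also have "\<dots> \<le> (\<Sum>\<epsilon>\<in>(sign_vectors :: (4 \<Rightarrow> int) set). k)"
    by (rule sum_mono) (rule assms(1))
  also have "\<dots> = 16 * k" by (simp add: card_sign_vectors)
  finally show ?thesis .
qed

lemma linear_form_by_fibres:
  fixes b :: "4 \<Rightarrow> int" and p :: nat
  defines "f \<equiv> \<lambda>j. b j mod int p"
  assumes x: "\<And>j. [x j = \<epsilon> j * v (f j)] (mod int p)"
  shows "[(\<Sum>j\<in>UNIV. \<eta> j * x j) = (\<Sum>y\<in>range f. fibre_sum f (\<lambda>j. \<epsilon> j * \<eta> j) y * v y)] (mod int p)"
    and "[(\<Sum>j\<in>UNIV. \<eta> j * ((r + b j) * x j)) = (\<Sum>y\<in>range f. fibre_sum f (\<lambda>j. \<epsilon> j * \<eta> j) y * ((y + r) * v y))] (mod int p)"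
proof -
  have b: "[r + b j = f j + r] (mod int p)" for j
    unfolding f_def by (simp add: cong_def mod_simps add.commute)
  have "[(\<Sum>j\<in>UNIV. \<eta> j * x j) = (\<Sum>j\<in>UNIV. \<eta> j * (\<epsilon> j * v (f j)))] (mod int p)"
    by (intro cong_sum cong_mult x cong_refl)
  also have "(\<Sum>j\<in>UNIV. \<eta> j * (\<epsilon> j * v (f j))) = (\<Sum>j\<in>UNIV. (\<epsilon> j * \<eta> j) * v (f j))"
    by (intro sum.cong refl) (simp only: ac_simps)
  also have "\<dots> = (\<Sum>y\<in>range f. fibre_sum f (\<lambda>j. \<epsilon> j * \<eta> j) y * v y)"
    by (rule sum_by_fibres)
  finally show "[(\<Sum>j\<in>UNIV. \<eta> j * x j) = (\<Sum>y\<in>range f. fibre_sum f (\<lambda>j. \<epsilon> j * \<eta> j) y * v y)] (mod int p)" .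
  have "[(\<Sum>j\<in>UNIV. \<eta> j * ((r + b j) * x j)) = (\<Sum>j\<in>UNIV. \<eta> j * ((f j + r) * (\<epsilon> j * v (f j))))] (mod int p)"
    by (intro cong_sum cong_mult x b cong_refl)
  also have "(\<Sum>j\<in>UNIV. \<eta> j * ((f j + r) * (\<epsilon> j * v (f j)))) = (\<Sum>j\<in>UNIV. (\<epsilon> j * \<eta> j) * ((f j + r) * v (f j)))"
    by (intro sum.cong refl) (simp only: ac_simps)
  also have "\<dots> = (\<Sum>y\<in>range f. fibre_sum f (\<lambda>j. \<epsilon> j * \<eta> j) y * ((y + r) * v y))"
    by (rule sum_by_fibres)
  finally show "[(\<Sum>j\<in>UNIV. \<eta> j * ((r + b j) * x j)) =
      (\<Sum>y\<in>range f. fibre_sum f (\<lambda>j. \<epsilon> j * \<eta> j) y * ((y + r) * v y))] (mod int p)" .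
qed

lemma int_small_dvd_imp_zero:
  fixes x :: int
  assumes "int p dvd x" "\<bar>x\<bar> < int p"
  shows "x = 0"
  using assms zdvd_imp_le[of "int p" "\<bar>x\<bar>"] by fastforce

text \<open>For p > 64 these bounds keep the sum of squares from vanishing modulo p. The lower bound
  comes from the isolated residue, the upper one is 4 * 4^2.\<close>

lemma sum_squares_bounds:
  fixes m :: "'b \<Rightarrow> int"
  assumes "finite B" "card B \<le> 4" "y \<in> B" "(m y)\<^sup>2 = 1" "\<And>x. \<bar>m x\<bar> \<le> 4"
  shows "1 \<le> (\<Sum>x\<in>B. (m x)\<^sup>2)" "(\<Sum>x\<in>B. (m x)\<^sup>2) \<le> 64"
proof -
  have "(m y)\<^sup>2 \<le> (\<Sum>x\<in>B. (m x)\<^sup>2)"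
    using assms(1,3) by (intro member_le_sum) auto
  then show "1 \<le> (\<Sum>x\<in>B. (m x)\<^sup>2)" using assms(4) by simp
  have "(m x)\<^sup>2 \<le> 16" for x
    using assms(5)[of x] abs_le_square_iff[of "m x" 4] by simp
  then have "(\<Sum>x\<in>B. (m x)\<^sup>2) \<le> int (card B) * 16"
    by (intro sum_bounded_above)
  then show "(\<Sum>x\<in>B. (m x)\<^sup>2) \<le> 64" using assms(2) by linarith
qed

text \<open>The diagonal coefficient is the sum of the squares of the fibre sums, between 1 and 64,
  so the relation is nontrivial modulo p for every choice of signs. The bound is 16 sign vectors
  times 16 roots.\<close>

lemma card_zero_sum_roots_le:
  fixes b :: "4 \<Rightarrow> int"
  assumes p: "Factorial_Ring.prime p" "p > 5000"
    and k: "\<And>j. b j mod int p = b k mod int p \<Longrightarrow> j = k"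
  shows "card {r \<in> {0..<int p}. \<exists>s x. (\<forall>j. [s * (r + b j) * (x j)\<^sup>2 = 1] (mod int p)) \<and>
    int p dvd (\<Sum>j\<in>UNIV. (r + b j) * x j)} \<le> 256"
proof -
  define f where "f = (\<lambda>j. b j mod int p)"
  have "card {r \<in> {0..<int p}. \<exists>s x. (\<forall>j. [s * (r + b j) * (x j)\<^sup>2 = 1] (mod int p)) \<and>
    int p dvd (\<Sum>j\<in>UNIV. (r + b j) * x j)} \<le> 16 * 16"
  proof (rule card_UN_sign_vectors_le)
    show "finite (relation_roots p (range f) (\<lambda>y z. fibre_sum f \<epsilon> y * fibre_sum f \<epsilon> z))" for \<epsilon>
      unfolding relation_roots_def by (rule finite_subset[of _ "{0..<int p}"]) auto
  next
    fix \<epsilon> :: "4 \<Rightarrow> int" assume \<epsilon>: "\<epsilon> \<in> sign_vectors"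
    let ?m = "fibre_sum f \<epsilon>"
    have fk: "?m (f k) = \<epsilon> k" using k by (intro fibre_sum_singleton) (simp add: f_def)
    have "card (range f) \<in> {2, 3, 4}"
      using k by (intro card_range_singleton_fibre[of f k]) (simp add: f_def)
    moreover have "range f \<subseteq> {0..<int p}" using p by (auto simp: f_def)
    moreover have "\<not> int p dvd (\<Sum>y\<in>range f. ?m y * ?m y)"
    proof
      assume dvd: "int p dvd (\<Sum>y\<in>range f. ?m y * ?m y)"
      have "1 \<le> (\<Sum>y\<in>range f. (?m y)\<^sup>2)" "(\<Sum>y\<in>range f. (?m y)\<^sup>2) \<le> 64"
        using sum_squares_bounds[of "range f" "f k" ?m] fk sign_vectors_values[OF \<epsilon>]
          \<open>card (range f) \<in> {2, 3, 4}\<close> abs_fibre_sum_le[OF \<epsilon>] by auto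
      then show False
        using int_small_dvd_imp_zero[OF dvd] p(2) by (auto simp: power2_eq_square)
    qed
    ultimately show "card (relation_roots p (range f) (\<lambda>y z. ?m y * ?m z)) \<le> 16"
      unfolding relation_roots_def using p
      by (intro card_relation_roots_le) auto
  next
    show "{r \<in> {0..<int p}. \<exists>s x. (\<forall>j. [s * (r + b j) * (x j)\<^sup>2 = 1] (mod int p)) \<and>
        int p dvd (\<Sum>j\<in>UNIV. (r + b j) * x j)}
      \<subseteq> (\<Union>\<epsilon>\<in>sign_vectors. relation_roots p (range f) (\<lambda>y z. fibre_sum f \<epsilon> y * fibre_sum f \<epsilon> z))"
    proof safe
      fix r s x
      assume r: "r \<in> {0..<int p}" and x: "\<forall>j. [s * (r + b j) * (x j)\<^sup>2 = 1] (mod int p)"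
        and sum: "int p dvd (\<Sum>j\<in>UNIV. (r + b j) * x j)"
      obtain \<epsilon> v where \<epsilon>: "\<epsilon> \<in> sign_vectors" and xv: "\<And>j. [x j = \<epsilon> j * v (f j)] (mod int p)"
        and v: "\<forall>y\<in>range f. [s * (y + r) * (v y)\<^sup>2 = 1] (mod int p)"
        using solution_grouping[OF p(1), of s r b x] x unfolding f_def by blast
      have "[(\<Sum>j\<in>UNIV. 1 * ((r + b j) * x j)) =
          (\<Sum>y\<in>range f. fibre_sum f (\<lambda>j. \<epsilon> j * 1) y * ((y + r) * v y))] (mod int p)"
        using xv unfolding f_def by (rule linear_form_by_fibres(2))
      then have "int p dvd (\<Sum>y\<in>range f. fibre_sum f \<epsilon> y * ((y + r) * v y))"
        using sum by (simp add: cong_dvd_iff)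
      \<comment> \<open>The linear relation is multiplied by the unweighted form with the same
        coefficients, to make it quadratic.\<close>
      then have "int p dvd (\<Sum>y\<in>range f. \<Sum>z\<in>range f.
          fibre_sum f \<epsilon> y * fibre_sum f \<epsilon> z * (y + r) * v y * v z)"
        unfolding sum_product_form by (rule dvd_mult2)
      then have "r \<in> relation_roots p (range f) (\<lambda>y z. fibre_sum f \<epsilon> y * fibre_sum f \<epsilon> z)"
        unfolding relation_roots_def using r v by blast
      then show "r \<in> (\<Union>\<epsilon>\<in>sign_vectors. relation_roots p (range f) (\<lambda>y z. fibre_sum f \<epsilon> y * fibre_sum f \<epsilon> z))"
        using \<epsilon> by blast
    qed
  qed
  then show ?thesis by simp
qed

text \<open>
  Off-diagonal vanishing in the row of \<open>x0\<close> makes \<open>m\<close> proportional to \<open>n\<close> on the remaining points.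
  With $M = \sum m^2$ and $N = \sum n^2$ this yields $(M - 1) N^2 = M^2 (N - 1)$, that is,
  $(M - N)(M + N - M N) = 0$, first modulo \<open>p\<close> and then, by size, over the integers.
\<close>

lemma vanishing_coefficients:
  fixes m n :: "int \<Rightarrow> int"
  assumes p: "Factorial_Ring.prime p" "p > 5000" and h: "\<not> int p dvd h" "\<not> int p dvd h'"
    and B: "finite B" "card B \<le> 4" "x0 \<in> B"
    and m: "(m x0)\<^sup>2 = 1" "\<And>x. \<bar>m x\<bar> \<le> 4" and n: "(n x0)\<^sup>2 = 1" "\<And>x. \<bar>n x\<bar> \<le> 4"
    and diag: "int p dvd (\<Sum>x\<in>B. h' * (m x * m x) + h * (n x * n x))"
    and off: "\<And>x y. x \<in> B \<Longrightarrow> y \<in> B \<Longrightarrow> x \<noteq> y \<Longrightarrow> int p dvd h' * (m x * m y) + h * (n x * n y)"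
  shows "int p dvd h + h'" "\<And>x. x \<in> B \<Longrightarrow> m x = m x0 * n x0 * n x"
proof -
  define \<sigma> where "\<sigma> = m x0 * n x0"
  have \<sigma>2: "\<sigma>\<^sup>2 = 1" using m n by (simp add: \<sigma>_def power_mult_distrib)
  then have \<sigma>: "\<sigma> = 1 \<or> \<sigma> = -1" by (simp add: power2_eq_1_iff)
  define M where "M = (\<Sum>x\<in>B. (m x)\<^sup>2)"
  define N where "N = (\<Sum>x\<in>B. (n x)\<^sup>2)"
  have MN: "1 \<le> M" "M \<le> 64" "1 \<le> N" "N \<le> 64"
    unfolding M_def N_def
    using sum_squares_bounds[of B x0 m] sum_squares_bounds[of B x0 n] B m n by simp_all
  have D: "int p dvd h' * M + h * N"
    using diag by (simp add: M_def N_def sum.distrib sum_distrib_left power2_eq_square)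
  have lin: "int p dvd h' * m x + h * \<sigma> * n x" if "x \<in> B" "x \<noteq> x0" for x
  proof -
    have "int p dvd m x0 * (h' * (m x0 * m x) + h * (n x0 * n x))"
      using off[of x0 x] that B(3) by (intro dvd_mult) auto
    also have "m x0 * (h' * (m x0 * m x) + h * (n x0 * n x)) = h' * ((m x0)\<^sup>2 * m x) + h * \<sigma> * n x"
      by (simp add: \<sigma>_def power2_eq_square algebra_simps)
    finally show ?thesis using m(1) by simp
  qed
  have "int p dvd (\<Sum>x\<in>B - {x0}. h'\<^sup>2 * (m x)\<^sup>2 - h\<^sup>2 * (n x)\<^sup>2)"
  proof (rule dvd_sum)
    fix x assume "x \<in> B - {x0}"
    then have "int p dvd (h' * m x + h * \<sigma> * n x) * (h' * m x - h * \<sigma> * n x)"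
      using lin by (intro dvd_mult2) auto
    also have "(h' * m x + h * \<sigma> * n x) * (h' * m x - h * \<sigma> * n x) = h'\<^sup>2 * (m x)\<^sup>2 - h\<^sup>2 * \<sigma>\<^sup>2 * (n x)\<^sup>2"
      by (simp add: power2_eq_square algebra_simps)
    finally show "int p dvd h'\<^sup>2 * (m x)\<^sup>2 - h\<^sup>2 * (n x)\<^sup>2" using \<sigma>2 by simp
  qed
  moreover have "(\<Sum>x\<in>B - {x0}. (m x)\<^sup>2) = M - 1" "(\<Sum>x\<in>B - {x0}. (n x)\<^sup>2) = N - 1"
    using B m(1) n(1) by (simp_all add: M_def N_def sum_diff1)
  ultimately have S: "int p dvd h'\<^sup>2 * (M - 1) - h\<^sup>2 * (N - 1)"
    by (simp add: sum_subtractf flip: sum_distrib_left)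
  \<comment> \<open>The diagonal condition gives h'^2 M^2 = h^2 N^2 modulo p. Inserting this in N^2
    times the preceding relation removes h and leaves h'^2 (N^2 (M - 1) - M^2 (N - 1)), which
    factors.\<close>
  have "int p dvd N\<^sup>2 * (h'\<^sup>2 * (M - 1) - h\<^sup>2 * (N - 1)) - (N - 1) * (h' * M - h * N) * (h' * M + h * N)"
    by (intro dvd_diff dvd_mult S D)
  also have "N\<^sup>2 * (h'\<^sup>2 * (M - 1) - h\<^sup>2 * (N - 1)) - (N - 1) * (h' * M - h * N) * (h' * M + h * N) =
      h'\<^sup>2 * ((M - N) * (M + N - M * N))"
    by (simp add: power2_eq_square algebra_simps)
  finally have "int p dvd M - N \<or> int p dvd M + N - M * N"
    using p(1) h(2) by (simp add: prime_dvd_mult_iff prime_dvd_power_iff)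
  then have "M = N"
  proof
    assume "int p dvd M - N"
    from int_small_dvd_imp_zero[OF this] show "M = N" using MN p(2) by linarith
  next
    assume *: "int p dvd M + N - M * N"
    \<comment> \<open>These bounds give |M + N - M N| <= 4096, which the threshold 5000 for p is
      chosen to exceed. For positive M, N the value 0 forces M = N = 2.\<close>
    have "0 \<le> M * N" "M * N \<le> 64 * 64" using MN mult_mono[of M 64 N 64] by auto
    with int_small_dvd_imp_zero[OF *] have "M + N - M * N = 0" using MN p(2) by linarith
    then have "(M - 1) * (N - 1) = 1" by (simp add: algebra_simps)
    then show "M = N" using MN by (auto simp: zmult_eq_1_iff)
  qed
  with D have "int p dvd M * (h + h')" by (simp add: algebra_simps)
  moreover have "\<not> int p dvd M"
    using int_small_dvd_imp_zero[of p M] MN p(2) by linarith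
  ultimately show hh: "int p dvd h + h'" using p(1) by (simp add: prime_dvd_mult_iff)
  show "m x = m x0 * n x0 * n x" if x: "x \<in> B" for x
  proof (cases "x = x0")
    case True
    then show ?thesis using n(1) by (simp add: power2_eq_square mult.assoc)
  next
    case False
    have "int p dvd (h' * m x + h * \<sigma> * n x) - (h + h') * (\<sigma> * n x)"
      using lin[OF x False] hh by (intro dvd_diff dvd_mult2)
    also have "(h' * m x + h * \<sigma> * n x) - (h + h') * (\<sigma> * n x) = h' * (m x - \<sigma> * n x)"
      by (simp add: algebra_simps)
    finally have "int p dvd m x - \<sigma> * n x" using p(1) h(2) by (simp add: prime_dvd_mult_iff)
    then have "m x - \<sigma> * n x = 0"
    proof (rule int_small_dvd_imp_zero)
      show "\<bar>m x - \<sigma> * n x\<bar> < int p" using m(2)[of x] n(2)[of x] \<sigma> p(2) by auto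
    qed
    then show ?thesis by (simp add: \<sigma>_def)
  qed
qed

text \<open>The bound is 16 * 16 * 16: signs from merging equal residues, signs from comparing x
  with x', and roots of the resolvent.\<close>

lemma card_critical_roots_le:
  fixes b :: "4 \<Rightarrow> int"
  assumes p: "Factorial_Ring.prime p" "p > 5000"
    and k: "\<And>j. b j mod int p = b k mod int p \<Longrightarrow> j = k"
    and h: "\<not> int p dvd h" "\<not> int p dvd h'"
  shows "card {r \<in> {0..<int p}. \<exists>s s' x x'. (\<forall>j. [s * (r + b j) * (x j)\<^sup>2 = 1] (mod int p)) \<and>
    (\<forall>j. [s' * (r + b j) * (x' j)\<^sup>2 = 1] (mod int p)) \<and>
    int p dvd h + (\<Sum>j\<in>UNIV. (r + b j) * x j) \<and> int p dvd h' + (\<Sum>j\<in>UNIV. (r + b j) * x' j) \<and>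
    int p dvd s * (\<Sum>j\<in>UNIV. x j) + s' * (\<Sum>j\<in>UNIV. x' j) \<and> \<not> [s = s'] (mod int p)} \<le> 4096"
    (is "card ?S \<le> 4096")
proof -
  define f where "f = (\<lambda>j. b j mod int p)"
  define B where "B = range f"
  define m where "m \<epsilon> = fibre_sum f \<epsilon>" for \<epsilon>
  define n where "n \<epsilon> \<eta> = fibre_sum f (\<lambda>j. \<epsilon> j * \<eta> j)" for \<epsilon> \<eta>
  define c where "c \<epsilon> \<eta> y z = h' * (m \<epsilon> y * m \<epsilon> z) + h * (n \<epsilon> \<eta> y * n \<epsilon> \<eta> z)" for \<epsilon> \<eta> y z
  define vanish where "vanish \<epsilon> \<eta> \<longleftrightarrow> int p dvd (\<Sum>y\<in>B. c \<epsilon> \<eta> y y) \<and>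
    (\<forall>y\<in>B. \<forall>z\<in>B. y \<noteq> z \<longrightarrow> int p dvd c \<epsilon> \<eta> y z)" for \<epsilon> \<eta>
  \<comment> \<open>Where all coefficients vanish, the relation does not restrict r.
    \<open>T\<close> is set to be empty there, and such sign vectors are shown to be incompatible
    with s and s' being distinct.\<close>
  define T where "T \<epsilon> \<eta> = (if vanish \<epsilon> \<eta> then {} else relation_roots p B (c \<epsilon> \<eta>))" for \<epsilon> \<eta>
  have cardB: "card B \<in> {2, 3, 4}"
    unfolding B_def using k by (intro card_range_singleton_fibre[of f k]) (simp add: f_def)
  have finB: "finite B" by (simp add: B_def)
  have subB: "B \<subseteq> {0..<int p}" using p by (auto simp: B_def f_def)
  have finT: "finite (T \<epsilon> \<eta>)" for \<epsilon> \<eta>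
    unfolding T_def relation_roots_def by (auto intro: finite_subset[of _ "{0..<int p}"])
  have cardT: "card (T \<epsilon> \<eta>) \<le> 16" for \<epsilon> \<eta>
  proof (cases "vanish \<epsilon> \<eta>")
    case False
    have "card (relation_roots p B (c \<epsilon> \<eta>)) \<le> 16"
      unfolding relation_roots_def
    proof (rule card_relation_roots_le[OF p(1) _ subB cardB])
      show "\<not> (int p dvd (\<Sum>x\<in>B. c \<epsilon> \<eta> x x) \<and> (\<forall>x\<in>B. \<forall>y\<in>B. x \<noteq> y \<longrightarrow> int p dvd c \<epsilon> \<eta> x y))"
        using False unfolding vanish_def .
    qed (use p(2) in \<open>simp_all add: c_def mult.commute\<close>)
    then show ?thesis using False by (simp add: T_def)
  qed (simp add: T_def)
  have "?S \<subseteq> (\<Union>\<epsilon>\<in>sign_vectors. \<Union>\<eta>\<in>sign_vectors. T \<epsilon> \<eta>)"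
  proof safe
    fix r s s' x x'
    assume r: "r \<in> {0..<int p}"
      and x: "\<forall>j. [s * (r + b j) * (x j)\<^sup>2 = 1] (mod int p)"
      and x': "\<forall>j. [s' * (r + b j) * (x' j)\<^sup>2 = 1] (mod int p)"
      and hx: "int p dvd h + (\<Sum>j\<in>UNIV. (r + b j) * x j)"
      and hx': "int p dvd h' + (\<Sum>j\<in>UNIV. (r + b j) * x' j)"
      and ss': "int p dvd s * (\<Sum>j\<in>UNIV. x j) + s' * (\<Sum>j\<in>UNIV. x' j)"
      and ne: "\<not> [s = s'] (mod int p)"
    obtain \<tau> \<eta> where \<eta>: "\<eta> \<in> sign_vectors" and ratio: "\<And>j. [x' j = \<tau> * \<eta> j * x j] (mod int p)"
      and \<tau>: "[s' * \<tau>\<^sup>2 = s] (mod int p)"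
      using solution_ratio[OF p(1), of s "\<lambda>j. r + b j" x s' x'] x x' by blast
    obtain \<epsilon> v where \<epsilon>: "\<epsilon> \<in> sign_vectors" and xv: "\<And>j. [x j = \<epsilon> j * v (f j)] (mod int p)"
      and v: "\<forall>y\<in>B. [s * (y + r) * (v y)\<^sup>2 = 1] (mod int p)"
      using solution_grouping[OF p(1), of s r b x] x unfolding f_def B_def by blast
    have s: "\<not> int p dvd s"
      using not_dvd_of_cong_1(1)[OF p(1), of "s * (r + b 1)" "(x 1)\<^sup>2"] x by auto
    define P where "P = (\<Sum>j\<in>UNIV. (r + b j) * x j)"
    define Q where "Q = (\<Sum>j\<in>UNIV. \<eta> j * ((r + b j) * x j))"
    define X0 where "X0 = (\<Sum>j\<in>UNIV. x j)"
    define Y0 where "Y0 = (\<Sum>j\<in>UNIV. \<eta> j * x j)"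
    define P' where "P' = (\<Sum>y\<in>B. m \<epsilon> y * ((y + r) * v y))"
    define Q' where "Q' = (\<Sum>y\<in>B. n \<epsilon> \<eta> y * ((y + r) * v y))"
    define X' where "X' = (\<Sum>y\<in>B. m \<epsilon> y * v y)"
    define Y' where "Y' = (\<Sum>y\<in>B. n \<epsilon> \<eta> y * v y)"
    note forms = linear_form_by_fibres[where x = x and \<epsilon> = \<epsilon> and v = v and b = b and p = p,
      OF xv[unfolded f_def], folded f_def B_def]
    have P': "[P = P'] (mod int p)" and X': "[X0 = X'] (mod int p)"
      using forms(2)[of "\<lambda>_. 1" r] forms(1)[of "\<lambda>_. 1"]
      by (simp_all add: P_def P'_def X0_def X'_def m_def)
    have Q': "[Q = Q'] (mod int p)" and Y': "[Y0 = Y'] (mod int p)"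
      using forms(2)[of \<eta> r] forms(1)[of \<eta>]
      by (simp_all add: Q_def Q'_def Y0_def Y'_def n_def)
    have "[(\<Sum>j\<in>UNIV. (r + b j) * x' j) = (\<Sum>j\<in>UNIV. (r + b j) * (\<tau> * \<eta> j * x j))] (mod int p)"
      by (intro cong_sum cong_mult ratio cong_refl)
    also have "(\<Sum>j\<in>UNIV. (r + b j) * (\<tau> * \<eta> j * x j)) = \<tau> * Q"
      unfolding Q_def sum_distrib_left by (intro sum.cong refl) (simp only: ac_simps)
    finally have hQ: "int p dvd h' + \<tau> * Q"
      using hx' by (meson cong_add_lcancel cong_dvd_transfer)
    have "[(\<Sum>j\<in>UNIV. x' j) = (\<Sum>j\<in>UNIV. \<tau> * \<eta> j * x j)] (mod int p)"
      by (intro cong_sum ratio)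
    also have "(\<Sum>j\<in>UNIV. \<tau> * \<eta> j * x j) = \<tau> * Y0"
      unfolding Y0_def sum_distrib_left by (intro sum.cong refl) (simp only: ac_simps)
    finally have "[\<tau> * (s * X0 + s' * (\<Sum>j\<in>UNIV. x' j)) = \<tau> * (s * X0 + s' * (\<tau> * Y0))] (mod int p)"
      by (intro cong_mult cong_add cong_refl)
    moreover have "[s * (\<tau> * X0) + s' * \<tau>\<^sup>2 * Y0 = s * (\<tau> * X0) + s * Y0] (mod int p)"
      by (intro cong_mult cong_add cong_refl \<tau>)
    moreover have "\<tau> * (s * X0 + s' * (\<tau> * Y0)) = s * (\<tau> * X0) + s' * \<tau>\<^sup>2 * Y0"
      by (simp add: power2_eq_square algebra_simps)
    ultimately have "[\<tau> * (s * X0 + s' * (\<Sum>j\<in>UNIV. x' j)) = s * (\<tau> * X0) + s * Y0] (mod int p)"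
      using cong_trans by simp
    moreover have "int p dvd \<tau> * (s * X0 + s' * (\<Sum>j\<in>UNIV. x' j))"
      using ss' by (simp add: X0_def)
    ultimately have "int p dvd s * (\<tau> * X0) + s * Y0" by (rule cong_dvd_transfer)
    then have "int p dvd s * (\<tau> * X0 + Y0)" by (simp only: distrib_left)
    then have XY: "int p dvd \<tau> * X0 + Y0" using s p(1) by (simp add: prime_dvd_mult_iff)
    have hP: "int p dvd h + P" using hx by (simp add: P_def)
    show "r \<in> (\<Union>\<epsilon>\<in>sign_vectors. \<Union>\<eta>\<in>sign_vectors. T \<epsilon> \<eta>)"
    proof (cases "vanish \<epsilon> \<eta>")
      case False
      \<comment> \<open>The multipliers P X0, Q Y0 and P Q are chosen so that the ratio of the two
        solutions cancels from the three critical equations.\<close>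
      have "int p dvd (h' + \<tau> * Q) * (P * X0) + (h + P) * (Q * Y0) - P * Q * (\<tau> * X0 + Y0)"
        by (intro dvd_diff dvd_add dvd_mult2 dvd_mult[OF XY] hP hQ)
      also have "(h' + \<tau> * Q) * (P * X0) + (h + P) * (Q * Y0) - P * Q * (\<tau> * X0 + Y0) =
          h' * (P * X0) + h * (Q * Y0)"
        by (simp add: algebra_simps)
      finally have "int p dvd h' * (P * X0) + h * (Q * Y0)" .
      moreover have "[h' * (P * X0) + h * (Q * Y0) = h' * (P' * X') + h * (Q' * Y')] (mod int p)"
        by (intro cong_add cong_mult cong_refl P' X' Q' Y')
      ultimately have "int p dvd h' * (P' * X') + h * (Q' * Y')"
        by (rule cong_dvd_transfer[rotated])
      also have "h' * (P' * X') + h * (Q' * Y') = (\<Sum>y\<in>B. \<Sum>z\<in>B. c \<epsilon> \<eta> y z * (y + r) * v y * v z)"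
        unfolding P'_def X'_def Q'_def Y'_def sum_product_form[symmetric] c_def
        by (simp add: sum_distrib_left distrib_right sum.distrib mult.assoc)
      finally have "r \<in> relation_roots p B (c \<epsilon> \<eta>)"
        unfolding relation_roots_def using r v by blast
      then have "r \<in> T \<epsilon> \<eta>" using False by (simp add: T_def)
      then show ?thesis using \<epsilon> \<eta> by blast
    next
      case True
      have fib: "m \<epsilon> (f k) = \<epsilon> k" "n \<epsilon> \<eta> (f k) = \<epsilon> k * \<eta> k"
        unfolding m_def n_def using k by (intro fibre_sum_singleton; simp add: f_def)+
      have sgn: "(\<lambda>j. \<epsilon> j * \<eta> j) \<in> sign_vectors"
        using \<epsilon> \<eta> unfolding sign_vectors_iff by (metis mult_1 mult_minus1 minus_minus)
      define \<sigma> where "\<sigma> = m \<epsilon> (f k) * n \<epsilon> \<eta> (f k)"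
      have \<sigma>: "\<sigma>\<^sup>2 = 1"
        using sign_vectors_values(2)[OF \<epsilon>] sign_vectors_values(2)[OF \<eta>]
        by (simp add: \<sigma>_def fib power_mult_distrib)
      have "int p dvd h + h' \<and> (\<forall>y\<in>B. m \<epsilon> y = m \<epsilon> (f k) * n \<epsilon> \<eta> (f k) * n \<epsilon> \<eta> y)"
      proof -
        have off: "int p dvd h' * (m \<epsilon> y * m \<epsilon> z) + h * (n \<epsilon> \<eta> y * n \<epsilon> \<eta> z)"
          if "y \<in> B" "z \<in> B" "y \<noteq> z" for y z
          using True that unfolding vanish_def c_def by blast
        have diag: "int p dvd (\<Sum>y\<in>B. h' * (m \<epsilon> y * m \<epsilon> y) + h * (n \<epsilon> \<eta> y * n \<epsilon> \<eta> y))"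
          using True unfolding vanish_def c_def by blast
        have m1: "(m \<epsilon> (f k))\<^sup>2 = 1" "(n \<epsilon> \<eta> (f k))\<^sup>2 = 1"
          using sign_vectors_values(2)[OF \<epsilon>] sign_vectors_values(2)[OF \<eta>]
          by (simp_all add: fib power_mult_distrib)
        have bd: "\<bar>m \<epsilon> y\<bar> \<le> 4" "\<bar>n \<epsilon> \<eta> y\<bar> \<le> 4" for y
          unfolding m_def n_def using abs_fibre_sum_le \<epsilon> sgn by blast+
        have B4: "card B \<le> 4" "f k \<in> B" using cardB by (auto simp: B_def)
        show ?thesis
          using vanishing_coefficients[where m = "m \<epsilon>" and n = "n \<epsilon> \<eta>" and B = B and ?x0.0 = "f k",
              OF p h finB B4(1,2) m1(1) bd(1) m1(2) bd(2) diag off] by blast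
      qed
      then have hh: "int p dvd h + h'" and mn: "\<And>y. y \<in> B \<Longrightarrow> m \<epsilon> y = \<sigma> * n \<epsilon> \<eta> y"
        by (auto simp: \<sigma>_def)
      have "P' = \<sigma> * Q'"
        unfolding P'_def Q'_def sum_distrib_left by (intro sum.cong refl) (simp only: mn mult.assoc)
      then have "[P = \<sigma> * Q'] (mod int p)" using P' by simp
      then have PQ: "[P = \<sigma> * Q] (mod int p)"
        by (rule cong_trans) (intro cong_mult cong_refl cong_sym[OF Q'])
      \<comment> \<open>With h' = -h and P = \<sigma> Q, the stationarity conditions in s and s'
        give (\<sigma> + \<tau>) Q = 0. As h' is nonzero, so is Q; hence \<tau>^2 = 1 and s =
        s'.\<close>
      have "int p dvd (h + P) + (h' + \<tau> * Q) - (h + h')"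
        by (intro dvd_diff dvd_add hP hQ hh)
      then have "int p dvd P + \<tau> * Q" by (simp add: algebra_simps)
      moreover have "[P + \<tau> * Q = \<sigma> * Q + \<tau> * Q] (mod int p)"
        by (intro cong_add PQ cong_refl)
      ultimately have "int p dvd \<sigma> * Q + \<tau> * Q"
        by (rule cong_dvd_transfer[rotated])
      then have "int p dvd (\<sigma> + \<tau>) * Q" by (simp only: distrib_right)
      moreover have "\<not> int p dvd Q"
      proof
        assume "int p dvd Q"
        then have "int p dvd \<tau> * Q" by (rule dvd_mult)
        with hQ have "int p dvd h'" by (simp add: dvd_add_left_iff)
        with h(2) show False ..
      qed
      ultimately have "int p dvd \<sigma> + \<tau>" using p(1) by (simp add: prime_dvd_mult_iff)
      then have "int p dvd (\<sigma> + \<tau>) * (\<tau> - \<sigma>)" by (rule dvd_mult2)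
      then have "[\<tau>\<^sup>2 = \<sigma>\<^sup>2] (mod int p)"
        by (simp add: cong_iff_dvd_diff power2_eq_square algebra_simps)
      then have "[s' * \<tau>\<^sup>2 = s' * 1] (mod int p)"
        unfolding \<sigma> by (intro cong_mult cong_refl)
      then have "[s = s'] (mod int p)"
        using cong_trans[OF cong_sym[OF \<tau>], of "s' * 1"] by simp
      with ne show ?thesis ..
    qed
  qed
  then have "card ?S \<le> 16 * 256"
  proof (rule card_UN_sign_vectors_le[rotated 2])
    fix \<epsilon>
    have "card (\<Union>\<eta>\<in>sign_vectors. T \<epsilon> \<eta>) \<le> 16 * 16"
      by (rule card_UN_sign_vectors_le[of "T \<epsilon>"]) (auto simp: cardT finT)
    then show "card (\<Union>\<eta>\<in>sign_vectors. T \<epsilon> \<eta>) \<le> 256" by simp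
  qed (simp add: finT)
  then show ?thesis by simp
qed

section \<open>Choices of s for fixed r\<close>

lemma card_linear_cong_le:
  assumes "Factorial_Ring.prime p" "\<not> int p dvd a"
  shows "card {s \<in> {0..<int p}. [a * s = c] (mod int p)} \<le> 1"
proof -
  have "s = s'" if "s \<in> {0..<int p}" "s' \<in> {0..<int p}" "[a * s = c] (mod int p)" "[a * s' = c] (mod int p)" for s s'
  proof -
    have "[a * s = a * s'] (mod int p)" by (rule cong_trans[OF that(3) cong_sym[OF that(4)]])
    then have "[s = s'] (mod int p)" by (rule cong_cancel_prime[OF assms])
    then show ?thesis using that(1,2) by (simp add: cong_def)
  qed
  moreover have "finite {s \<in> {0..<int p}. [a * s = c] (mod int p)}"
    by (rule finite_subset[of _ "{0..<int p}"]) auto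
  ultimately show ?thesis unfolding One_nat_def by (subst card_le_Suc0_iff_eq) auto
qed

text \<open>Relative to one solution (s0, x0), every other is x = \<tau> \<eta> x0 with s \<tau>^2 =
  s0. Then h = -\<tau> Q, and squaring gives h^2 s = s0 Q^2: one s for each sign vector.\<close>

lemma card_sum_solutions_le:
  fixes a :: "4 \<Rightarrow> int"
  assumes p: "Factorial_Ring.prime p" and h: "\<not> int p dvd h"
  shows "card {s \<in> {0..<int p}. \<exists>x. (\<forall>j. [s * a j * (x j)\<^sup>2 = 1] (mod int p)) \<and>
    int p dvd h + (\<Sum>j\<in>UNIV. a j * x j)} \<le> 16" (is "card ?S \<le> 16")
proof (cases "?S = {}")
  case False
  then obtain s0 x0 where x0: "\<And>j. [s0 * a j * (x0 j)\<^sup>2 = 1] (mod int p)" by blast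
  define Q where "Q \<eta> = (\<Sum>j\<in>UNIV. \<eta> j * (a j * x0 j))" for \<eta>
  have "\<not> int p dvd h\<^sup>2" using p h by (simp add: prime_dvd_power_iff)
  then have "card {s \<in> {0..<int p}. [h\<^sup>2 * s = s0 * (Q \<eta>)\<^sup>2] (mod int p)} \<le> 1" for \<eta>
    by (rule card_linear_cong_le[OF p])
  moreover have "?S \<subseteq> (\<Union>\<eta>\<in>sign_vectors. {s \<in> {0..<int p}. [h\<^sup>2 * s = s0 * (Q \<eta>)\<^sup>2] (mod int p)})"
  proof
    fix s assume "s \<in> ?S"
    then obtain x where s: "s \<in> {0..<int p}" and x: "\<And>j. [s * a j * (x j)\<^sup>2 = 1] (mod int p)"
      and hx: "int p dvd h + (\<Sum>j\<in>UNIV. a j * x j)" by blast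
    obtain \<tau> \<eta> where \<eta>: "\<eta> \<in> sign_vectors" and ratio: "\<And>j. [x j = \<tau> * \<eta> j * x0 j] (mod int p)"
      and \<tau>: "[s * \<tau>\<^sup>2 = s0] (mod int p)"
      using solution_ratio[OF p, of s0 a x0 s x] x0 x by blast
    have "[(\<Sum>j\<in>UNIV. a j * x j) = (\<Sum>j\<in>UNIV. a j * (\<tau> * \<eta> j * x0 j))] (mod int p)"
      by (intro cong_sum cong_mult ratio cong_refl)
    also have "(\<Sum>j\<in>UNIV. a j * (\<tau> * \<eta> j * x0 j)) = \<tau> * Q \<eta>"
      unfolding Q_def sum_distrib_left by (intro sum.cong refl) (simp only: ac_simps)
    finally have eq: "[(\<Sum>j\<in>UNIV. a j * x j) = \<tau> * Q \<eta>] (mod int p)" .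
    have "int p dvd h + \<tau> * Q \<eta>"
      by (rule cong_dvd_transfer[OF cong_add[OF cong_refl eq] hx])
    then have "int p dvd (h + \<tau> * Q \<eta>) * (h - \<tau> * Q \<eta>) * s" by (intro dvd_mult2)
    then have "[h\<^sup>2 * s = (s * \<tau>\<^sup>2) * (Q \<eta>)\<^sup>2] (mod int p)"
      by (simp add: cong_iff_dvd_diff power2_eq_square algebra_simps)
    then have "[h\<^sup>2 * s = s0 * (Q \<eta>)\<^sup>2] (mod int p)"
      by (rule cong_trans) (intro cong_mult cong_refl \<tau>)
    then show "s \<in> (\<Union>\<eta>\<in>sign_vectors. {s \<in> {0..<int p}. [h\<^sup>2 * s = s0 * (Q \<eta>)\<^sup>2] (mod int p)})"
      using s \<eta> by blast
  qed
  moreover have "finite {s \<in> {0..<int p}. [h\<^sup>2 * s = s0 * (Q \<eta>)\<^sup>2] (mod int p)}" for \<eta>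
    by (rule finite_subset[of _ "{0..<int p}"]) auto
  ultimately have "card ?S \<le> 16 * 1" by (intro card_UN_sign_vectors_le)
  then show ?thesis by simp
next
  case True
  then have "card ?S = 0" by (simp only: card.empty)
  then show ?thesis by simp
qed

text \<open>As for the weighted sum, but now s \<tau> Q = -h, so that s0 Q^2 s = h^2. This again is
  linear in s, and has no solution if its coefficient is divisible by p.\<close>

lemma card_weighted_sum_solutions_le:
  fixes a :: "4 \<Rightarrow> int"
  assumes p: "Factorial_Ring.prime p" and h: "\<not> int p dvd h"
  shows "card {s \<in> {0..<int p}. \<exists>x. (\<forall>j. [s * a j * (x j)\<^sup>2 = 1] (mod int p)) \<and>
    int p dvd s * (\<Sum>j\<in>UNIV. x j) + h} \<le> 16" (is "card ?S \<le> 16")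
proof (cases "?S = {}")
  case False
  then obtain s0 x0 where x0: "\<And>j. [s0 * a j * (x0 j)\<^sup>2 = 1] (mod int p)" by blast
  define Q where "Q \<eta> = (\<Sum>j\<in>UNIV. \<eta> j * x0 j)" for \<eta>
  define L where "L \<eta> = {s \<in> {0..<int p}. [(s0 * (Q \<eta>)\<^sup>2) * s = h\<^sup>2] (mod int p)}" for \<eta>
  have h2: "\<not> int p dvd h\<^sup>2" using p h by (simp add: prime_dvd_power_iff)
  have "card (L \<eta>) \<le> 1" for \<eta>
  proof (cases "int p dvd s0 * (Q \<eta>)\<^sup>2")
    case True
    have "\<not> [(s0 * (Q \<eta>)\<^sup>2) * s = h\<^sup>2] (mod int p)" for s
    proof
      assume "[(s0 * (Q \<eta>)\<^sup>2) * s = h\<^sup>2] (mod int p)"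
      then have "int p dvd h\<^sup>2" using True by (rule cong_dvd_transfer[OF _ dvd_mult2])
      with h2 show False ..
    qed
    then have "L \<eta> = {}" by (simp add: L_def)
    then show ?thesis by simp
  next
    case False
    then show ?thesis unfolding L_def by (rule card_linear_cong_le[OF p])
  qed
  moreover have "?S \<subseteq> (\<Union>\<eta>\<in>sign_vectors. L \<eta>)"
  proof
    fix s assume "s \<in> ?S"
    then obtain x where s: "s \<in> {0..<int p}" and x: "\<And>j. [s * a j * (x j)\<^sup>2 = 1] (mod int p)"
      and hx: "int p dvd s * (\<Sum>j\<in>UNIV. x j) + h" by blast
    obtain \<tau> \<eta> where \<eta>: "\<eta> \<in> sign_vectors" and ratio: "\<And>j. [x j = \<tau> * \<eta> j * x0 j] (mod int p)"
      and \<tau>: "[s * \<tau>\<^sup>2 = s0] (mod int p)"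
      using solution_ratio[OF p, of s0 a x0 s x] x0 x by blast
    have "[(\<Sum>j\<in>UNIV. x j) = (\<Sum>j\<in>UNIV. \<tau> * \<eta> j * x0 j)] (mod int p)"
      by (intro cong_sum ratio)
    also have "(\<Sum>j\<in>UNIV. \<tau> * \<eta> j * x0 j) = \<tau> * Q \<eta>"
      unfolding Q_def sum_distrib_left by (intro sum.cong refl) (simp only: ac_simps)
    finally have eq: "[(\<Sum>j\<in>UNIV. x j) = \<tau> * Q \<eta>] (mod int p)" .
    have "int p dvd s * (\<tau> * Q \<eta>) + h"
      by (rule cong_dvd_transfer[OF cong_add[OF cong_mult[OF cong_refl eq] cong_refl] hx])
    then have "int p dvd (s * (\<tau> * Q \<eta>) + h) * (s * (\<tau> * Q \<eta>) - h)" by (rule dvd_mult2)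
    then have eq': "[((s * \<tau>\<^sup>2) * (Q \<eta>)\<^sup>2) * s = h\<^sup>2] (mod int p)"
      by (simp add: cong_iff_dvd_diff power2_eq_square algebra_simps)
    have "[((s * \<tau>\<^sup>2) * (Q \<eta>)\<^sup>2) * s = (s0 * (Q \<eta>)\<^sup>2) * s] (mod int p)"
      by (intro cong_mult cong_refl \<tau>)
    from cong_trans[OF cong_sym[OF this] eq'] show "s \<in> (\<Union>\<eta>\<in>sign_vectors. L \<eta>)"
      using s \<eta> unfolding L_def by blast
  qed
  moreover have "finite (L \<eta>)" for \<eta>
    unfolding L_def by (rule finite_subset[of _ "{0..<int p}"]) auto
  ultimately have "card ?S \<le> 16 * 1" by (intro card_UN_sign_vectors_le)
  then show ?thesis by simp
next
  case True
  then have "card ?S = 0" by (simp only: card.empty)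
  then show ?thesis by simp
qed

lemma card_inverse_square_roots_le:
  assumes p: "Factorial_Ring.prime p"
  shows "card (inverse_square_roots p a) \<le> 2"
proof (cases "inverse_square_roots p a = {}")
  case False
  then obtain y where y: "[a * y\<^sup>2 = 1] (mod int p)" by (auto simp: inverse_square_roots_def)
  have "inverse_square_roots p a \<subseteq> {y mod int p, (- y) mod int p}"
  proof
    fix x assume "x \<in> inverse_square_roots p a"
    then have x: "x \<in> {0..<int p}" "[a * x\<^sup>2 = 1] (mod int p)" by (auto simp: inverse_square_roots_def)
    have "[a * x\<^sup>2 = a * y\<^sup>2] (mod int p)" by (rule cong_trans[OF x(2) cong_sym[OF y]])
    then have "[x\<^sup>2 = y\<^sup>2] (mod int p)"
      by (rule cong_cancel_prime[OF p not_dvd_of_cong_1(1)[OF p y]])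
    from square_cong_imp_sign[OF p this] show "x \<in> {y mod int p, (- y) mod int p}"
      using x(1) by (auto simp: cong_def)
  qed
  then have "card (inverse_square_roots p a) \<le> card {y mod int p, (- y) mod int p}"
    by (rule card_mono[rotated]) simp
  also have "\<dots> \<le> 2" by (simp add: card_insert_if)
  finally show ?thesis .
qed simp

lemma card_root_tuples_le:
  fixes b :: "4 \<Rightarrow> int"
  assumes "Factorial_Ring.prime p"
  shows "card (root_tuples p b r s) \<le> 16"
proof -
  have "card (root_tuples p b r s) = (\<Prod>j\<in>UNIV. card (inverse_square_roots p (s * (r + b j))))"
    unfolding root_tuples_def by (rule card_PiE) simp
  also have "\<dots> \<le> (\<Prod>j\<in>(UNIV::4 set). 2)"
    using card_inverse_square_roots_le[OF assms] by (intro prod_mono) auto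
  also have "\<dots> = 16" by simp
  finally show ?thesis .
qed

lemma root_tuples_cong:
  "x \<in> root_tuples p b r s \<Longrightarrow> [s * (r + b j) * (x j)\<^sup>2 = 1] (mod int p)"
  by (auto simp: root_tuples_def inverse_square_roots_def PiE_iff)

lemma card_Sigma_le:
  assumes "finite A" "card A \<le> m" "\<And>x. x \<in> A \<Longrightarrow> finite (B x)" "\<And>x. x \<in> A \<Longrightarrow> card (B x) \<le> n"
  shows "card (Sigma A B) \<le> m * n"
proof -
  have "card (Sigma A B) = (\<Sum>x\<in>A. card (B x))" using assms by (intro card_SigmaI) auto
  also have "\<dots> \<le> card A * n" using assms(4) sum_bounded_above[of A "\<lambda>x. card (B x)" n] by simp
  also have "\<dots> \<le> m * n" using assms(2) by simp
  finally show ?thesis .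
qed

section \<open>The total number of critical points\<close>

lemma finite_critical_points: "finite (critical_points p b h h')"
proof -
  have "critical_points p b h h' \<subseteq> (SIGMA z : {0..<int p} \<times> {0..<int p} \<times> {0..<int p}.
      root_tuples p b (fst z) (fst (snd z)) \<times> root_tuples p b (fst z) (snd (snd z)))"
    by (auto simp: critical_points_def critical_tuples_def)
  then show ?thesis by (rule finite_subset) (intro finite_SigmaI; simp)
qed

lemma card_critical_points_swap:
  "card (critical_points p b h h') \<le> card (critical_points p b h' h)"
proof (rule card_inj_on_le)
  show "inj_on (\<lambda>((r, s, s'), (x, x')). ((r, s', s), (x', x))) (critical_points p b h h')"
    by (auto simp: inj_on_def)
  show "(\<lambda>((r, s, s'), (x, x')). ((r, s', s), (x', x))) ` critical_points p b h h' \<subseteq> critical_points p b h' h"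
    by (auto simp: critical_points_def cong_sym_eq add.commute)
qed (rule finite_critical_points)

lemma card_critical_points_trivial:
  fixes b :: "4 \<Rightarrow> int"
  assumes p: "Factorial_Ring.prime p"
  shows "card (critical_points p b h h') \<le> p ^ 3 * 256"
proof -
  let ?W = "SIGMA z : {0..<int p} \<times> {0..<int p} \<times> {0..<int p}.
      root_tuples p b (fst z) (fst (snd z)) \<times> root_tuples p b (fst z) (snd (snd z))"
  have "critical_points p b h h' \<subseteq> ?W"
    by (auto simp: critical_points_def critical_tuples_def)
  moreover have "finite ?W" by (intro finite_SigmaI; simp)
  ultimately have "card (critical_points p b h h') \<le> card ?W" by (rule card_mono[rotated])
  also have "\<dots> \<le> p ^ 3 * 256"
  proof (rule card_Sigma_le)
    fix z
    show "card (root_tuples p b (fst z) (fst (snd z)) \<times> root_tuples p b (fst z) (snd (snd z))) \<le> 256"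
      using mult_le_mono[OF card_root_tuples_le[OF p, of b "fst z" "fst (snd z)"]
          card_root_tuples_le[OF p, of b "fst z" "snd (snd z)"]]
      by (simp add: card_cartesian_product)
  qed (simp_all add: card_cartesian_product power3_eq_cube)
  finally show ?thesis .
qed

text \<open>There are 2^12 values of r; for each of them 16 values each of s and s', because neither
  h nor h' vanishes; and then 16 tuples each for x and x'.\<close>

lemma card_critical_points_generic:
  fixes b :: "4 \<Rightarrow> int"
  assumes p: "Factorial_Ring.prime p" "p > 5000"
    and k: "\<And>j. b j mod int p = b k mod int p \<Longrightarrow> j = k"
    and h: "\<not> int p dvd h" "\<not> int p dvd h'"
  shows "card (critical_points p b h h') \<le> 2 ^ 28"
proof -
  define R where "R = {r \<in> {0..<int p}. \<exists>s s' x x'. (\<forall>j. [s * (r + b j) * (x j)\<^sup>2 = 1] (mod int p)) \<and>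
    (\<forall>j. [s' * (r + b j) * (x' j)\<^sup>2 = 1] (mod int p)) \<and>
    int p dvd h + (\<Sum>j\<in>UNIV. (r + b j) * x j) \<and> int p dvd h' + (\<Sum>j\<in>UNIV. (r + b j) * x' j) \<and>
    int p dvd s * (\<Sum>j\<in>UNIV. x j) + s' * (\<Sum>j\<in>UNIV. x' j) \<and> \<not> [s = s'] (mod int p)}"
  define S where "S g r = {s \<in> {0..<int p}. \<exists>x. (\<forall>j. [s * (r + b j) * (x j)\<^sup>2 = 1] (mod int p)) \<and>
    int p dvd g + (\<Sum>j\<in>UNIV. (r + b j) * x j)}" for g r
  define W where "W = (SIGMA r : R. SIGMA z : S h r \<times> S h' r.
    root_tuples p b r (fst z) \<times> root_tuples p b r (snd z))"
  have fin: "finite R" "finite (S g r)" for g r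
    unfolding R_def S_def by (rule finite_subset[of _ "{0..<int p}"]; auto)+
  have "card (critical_points p b h h') \<le> card W"
  proof (rule card_inj_on_le)
    show "inj_on (\<lambda>((r, z), xs). (r, z, xs)) (critical_points p b h h')"
      by (auto simp: inj_on_def)
    show "(\<lambda>((r, z), xs). (r, z, xs)) ` critical_points p b h h' \<subseteq> W"
    proof safe
      fix r s s' x x' assume "((r, s, s'), x, x') \<in> critical_points p b h h'"
      then have mem: "r \<in> {0..<int p}" "s \<in> {0..<int p}" "s' \<in> {0..<int p}" "\<not> [s = s'] (mod int p)"
        "x \<in> root_tuples p b r s" "x' \<in> root_tuples p b r s'"
        "int p dvd h + (\<Sum>j\<in>UNIV. (r + b j) * x j)" "int p dvd h' + (\<Sum>j\<in>UNIV. (r + b j) * x' j)"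
        "int p dvd s * (\<Sum>j\<in>UNIV. x j) + s' * (\<Sum>j\<in>UNIV. x' j)"
        by (auto simp: critical_points_def critical_tuples_def)
      note sol = root_tuples_cong[OF mem(5)] root_tuples_cong[OF mem(6)]
      have "r \<in> R" unfolding R_def using mem sol by blast
      moreover have "s \<in> S h r" "s' \<in> S h' r" unfolding S_def using mem sol by blast+
      ultimately show "(r, (s, s'), x, x') \<in> W" unfolding W_def using mem by auto
    qed
    show "finite W" unfolding W_def using fin by (intro finite_SigmaI; simp)
  qed
  also have "\<dots> \<le> 4096 * (256 * 256)"
    unfolding W_def
  proof (intro card_Sigma_le)
    show "card R \<le> 4096" unfolding R_def using card_critical_roots_le[OF p k h] .
    fix r
    have "card (S h r) \<le> 16" "card (S h' r) \<le> 16"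
      unfolding S_def by (rule card_sum_solutions_le[OF p(1)]; fact)+
    from mult_le_mono[OF this] show "card (S h r \<times> S h' r) \<le> 256"
      by (simp add: card_cartesian_product)
    fix z
    show "card (root_tuples p b r (fst z) \<times> root_tuples p b r (snd z)) \<le> 256"
      using mult_le_mono[OF card_root_tuples_le[OF p(1), of b r "fst z"]
          card_root_tuples_le[OF p(1), of b r "snd z"]]
      by (simp add: card_cartesian_product)
  qed (use fin in \<open>auto intro!: finite_SigmaI\<close>)
  finally show ?thesis by simp
qed

text \<open>As h = 0 gives no bound for s, the choices are made in the order r, s', x', s, x, with
  at most 256, l, 16, 16 and 16 options. Stationarity in r bounds s once s' and x' are known. The
  parameter l allows 16 if h' is nonzero and the trivial p if h' = 0.\<close>

lemma card_critical_points_zero: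
  fixes b :: "4 \<Rightarrow> int"
  assumes p: "Factorial_Ring.prime p" "p > 5000"
    and k: "\<And>j. b j mod int p = b k mod int p \<Longrightarrow> j = k"
    and unpaired: "\<not> ([b 1 = b 2] (mod int p) \<and> [b 3 = b 4] (mod int p) \<or>
      [b 1 = b 3] (mod int p) \<and> [b 2 = b 4] (mod int p) \<or>
      [b 2 = b 3] (mod int p) \<and> [b 1 = b 4] (mod int p))"
    and h: "int p dvd h"
    and l: "\<And>r. card {s \<in> {0..<int p}. \<exists>x. (\<forall>j. [s * (r + b j) * (x j)\<^sup>2 = 1] (mod int p)) \<and>
      int p dvd h' + (\<Sum>j\<in>UNIV. (r + b j) * x j)} \<le> l"
  shows "card (critical_points p b h h') \<le> 2 ^ 20 * l"
proof -
  define R where "R = {r \<in> {0..<int p}. \<exists>s x. (\<forall>j. [s * (r + b j) * (x j)\<^sup>2 = 1] (mod int p)) \<and>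
    int p dvd (\<Sum>j\<in>UNIV. (r + b j) * x j)}"
  define S where "S r = {s \<in> {0..<int p}. \<exists>x. (\<forall>j. [s * (r + b j) * (x j)\<^sup>2 = 1] (mod int p)) \<and>
    int p dvd h' + (\<Sum>j\<in>UNIV. (r + b j) * x j)}" for r
  \<comment> \<open>Nondivisibility of g is part of the set so that the bound 16 holds for every g:
    for g divisible by p the set is empty.\<close>
  define S' where "S' r g = {s \<in> {0..<int p}. \<not> int p dvd g \<and>
    (\<exists>x. (\<forall>j. [s * (r + b j) * (x j)\<^sup>2 = 1] (mod int p)) \<and> int p dvd s * (\<Sum>j\<in>UNIV. x j) + g)}" for r g
  define W where "W = (SIGMA r : R. SIGMA s' : S r. SIGMA x' : root_tuples p b r s'.
    SIGMA s : S' r (s' * (\<Sum>j\<in>UNIV. x' j)). root_tuples p b r s)"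
  have fin: "finite R" "finite (S r)" "finite (S' r g)" for r g
    unfolding R_def S_def S'_def by (rule finite_subset[of _ "{0..<int p}"]; auto)+
  have "card (critical_points p b h h') \<le> card W"
  proof (rule card_inj_on_le)
    show "inj_on (\<lambda>((r, s, s'), x, x'). (r, s', x', s, x)) (critical_points p b h h')"
      by (auto simp: inj_on_def)
    show "(\<lambda>((r, s, s'), x, x'). (r, s', x', s, x)) ` critical_points p b h h' \<subseteq> W"
    proof safe
      fix r s s' x x' assume "((r, s, s'), x, x') \<in> critical_points p b h h'"
      then have mem: "r \<in> {0..<int p}" "s \<in> {0..<int p}" "s' \<in> {0..<int p}"
        "x \<in> root_tuples p b r s" "x' \<in> root_tuples p b r s'"
        "int p dvd h + (\<Sum>j\<in>UNIV. (r + b j) * x j)" "int p dvd h' + (\<Sum>j\<in>UNIV. (r + b j) * x' j)"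
        "int p dvd s * (\<Sum>j\<in>UNIV. x j) + s' * (\<Sum>j\<in>UNIV. x' j)"
        by (auto simp: critical_points_def critical_tuples_def)
      note sol = root_tuples_cong[OF mem(4)] root_tuples_cong[OF mem(5)]
      have sum: "int p dvd (\<Sum>j\<in>UNIV. (r + b j) * x j)"
        using mem(6) h by (simp add: dvd_add_right_iff)
      have "r \<in> R" unfolding R_def using mem(1) sol(1) sum by blast
      moreover have "s' \<in> S r" unfolding S_def using mem sol(2) by blast
      \<comment> \<open>Otherwise stationarity in r would make the unweighted sum of the x j vanish
        together with the weighted one, and the b j would pair up.\<close>
      moreover have "\<not> int p dvd s' * (\<Sum>j\<in>UNIV. x' j)"
      proof
        assume "int p dvd s' * (\<Sum>j\<in>UNIV. x' j)"
        with mem(8) have "int p dvd s * (\<Sum>j\<in>UNIV. x j)" by (simp add: dvd_add_left_iff)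
        moreover have "\<not> int p dvd s"
          using not_dvd_of_cong_1(1)[OF p(1) sol(1)[of 1]] by auto
        ultimately have "int p dvd (\<Sum>j\<in>UNIV. x j)" using p(1) by (simp add: prime_dvd_mult_iff)
        from sums_vanish_imp_pairing[OF p(1) sol(1) this sum] unpaired show False
          by (simp only: cong_add_lcancel)
      qed
      then have "s \<in> S' r (s' * (\<Sum>j\<in>UNIV. x' j))"
        unfolding S'_def using mem sol(1) by blast
      ultimately show "(r, s', x', s, x) \<in> W" unfolding W_def using mem by auto
    qed
    show "finite W" unfolding W_def using fin by (intro finite_SigmaI; simp)
  qed
  also have "\<dots> \<le> 256 * (l * (16 * (16 * 16)))"
    unfolding W_def
  proof (intro card_Sigma_le)
    show "card R \<le> 256" unfolding R_def by (rule card_zero_sum_roots_le[OF p k])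
    show "card (S r) \<le> l" for r unfolding S_def by (rule l)
    show "card (root_tuples p b r s) \<le> 16" for r s by (rule card_root_tuples_le[OF p(1)])
    then show "card (root_tuples p b r s) \<le> 16" for r s .
    show "card (S' r g) \<le> 16" for r g
    proof (cases "int p dvd g")
      case False
      from card_weighted_sum_solutions_le[OF p(1) False, of "\<lambda>j. r + b j"] False
      show ?thesis by (simp add: S'_def)
    qed (simp add: S'_def)
  qed (use fin in \<open>auto intro!: finite_SigmaI\<close>)
  finally show ?thesis by simp
qed

lemma card_critical_points_le:
  fixes b :: "int ^ 4"
  assumes p: "Factorial_Ring.prime p" and b: "reduce_vec p b \<notin> diag_variety p"
  shows "card (critical_points p (($) b) h h') \<le>
    10 ^ 14 * (if int p dvd h \<and> int p dvd h' then p else 1)"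
proof (cases "p > 5000")
  case False
  have "card (critical_points p (($) b) h h') \<le> p ^ 3 * 256"
    by (rule card_critical_points_trivial[OF p])
  \<comment> \<open>Small primes determine the constant: this is 3.2 * 10^13, whereas the counts for
    p > 5000 are at most 2^28, or 2^20 p if h and h' both vanish.\<close>
  also have "\<dots> \<le> 5000 ^ 3 * 256"
    using False by (intro mult_le_mono power_mono) auto
  also have "\<dots> \<le> 10 ^ 14 * 1" by simp
  also have "\<dots> \<le> 10 ^ 14 * (if int p dvd h \<and> int p dvd h' then p else 1)"
    using prime_gt_0_nat[OF p] by (intro mult_le_mono) auto
  finally show ?thesis .
next
  case True
  define f where "f j = b $ j mod int p" for j
  have "reduce_vec p b \<in> affine_space (residue_ring (int p))"
    using prime_gt_0_nat[OF p] by (auto simp: affine_space_def reduce_vec_def residue_ring_def)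
  then obtain i where odd: "odd (card {j. f j = f i})"
    using b by (auto simp: diag_variety_def reduce_vec_def f_def)
  then obtain k where k: "\<And>j. f j = f k \<Longrightarrow> j = k"
    using exists_singleton_fibre by blast
  have unpaired: "\<not> ([b $ 1 = b $ 2] (mod int p) \<and> [b $ 3 = b $ 4] (mod int p) \<or>
      [b $ 1 = b $ 3] (mod int p) \<and> [b $ 2 = b $ 4] (mod int p) \<or>
      [b $ 2 = b $ 3] (mod int p) \<and> [b $ 1 = b $ 4] (mod int p))"
    using even_fibres_of_pairing[of f i] odd unfolding f_def cong_def by blast
  have k': "b $ j mod int p = b $ k mod int p \<Longrightarrow> j = k" for j
    using k[of j] by (simp add: f_def)
  have one: "card (critical_points p (($) b) h h') \<le> 2 ^ 20 * 16"
    if "int p dvd h" "\<not> int p dvd h'" for h h'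
    by (rule card_critical_points_zero[OF p True k' unpaired that(1) card_sum_solutions_le[OF p that(2)]])
  consider "int p dvd h \<and> int p dvd h'" | "int p dvd h" "\<not> int p dvd h'"
    | "\<not> int p dvd h" "int p dvd h'" | "\<not> int p dvd h" "\<not> int p dvd h'" by blast
  then show ?thesis
  proof cases
    case 1
    have "card (critical_points p (($) b) h h') \<le> 2 ^ 20 * p"
    proof (rule card_critical_points_zero[OF p True _ unpaired])
      show "card {s \<in> {0..<int p}. \<exists>x. (\<forall>j. [s * (r + b $ j) * (x j)\<^sup>2 = 1] (mod int p)) \<and>
          int p dvd h' + (\<Sum>j\<in>UNIV. (r + b $ j) * x j)} \<le> p" (is "card ?T \<le> p") for r
      proof -
        have "?T \<subseteq> {0..<int p}" by blast
        from card_mono[OF _ this] show ?thesis by simp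
      qed
    qed (use 1 k' in auto)
    then show ?thesis using 1 by simp
  next
    case 2
    then show ?thesis using one[of h h'] by simp
  next
    case 3
    then show ?thesis using one[of h' h] card_critical_points_swap[of p "($) b" h h'] by simp
  next
    case 4
    then show ?thesis
      using card_critical_points_generic[where b = "($) b", OF p True k' 4] by simp
  qed
qed

theorem theorem4p6:
  shows "\<exists>(C :: nat) (K :: real). \<forall>p :: nat. Factorial_Ring.prime p \<longrightarrow>
    (\<exists>(V4 :: (int ^ 4) set) (V2 :: int ^ 4 \<Rightarrow> (int ^ 2) set).
       (\<exists>d P. d \<le> C \<and> nonzero_homogeneous (residue_ring (int p)) d P \<and>
              V4 = zero_set (residue_ring (int p)) P) \<and>
       (\<forall>b \<in> affine_space (residue_ring (int p)).
          \<exists>\<L>. finite \<L> \<and> card \<L> \<le> C \<and>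
              (\<forall>L\<in>\<L>. nonzero_homogeneous (residue_ring (int p)) 1 L) \<and>
              V2 b = (\<Union>L\<in>\<L>. zero_set (residue_ring (int p)) L)) \<and>
       (\<forall>(b :: int ^ 4) (h :: int ^ 2). reduce_vec p b \<notin> diag_variety p \<longrightarrow>
          norm (frakS1 b h (p ^ 2)) \<le> K *
            (if \<forall>i. [h $ i = 0] (mod int p) then real p ^ 4
             else if (reduce_vec p b, reduce_vec p h) \<in> V4 \<times> V2 (reduce_vec p b) then real p ^ 4
             else real p ^ 3)))"
proof (intro exI allI impI conjI)
  fix p :: nat
  assume p: "Factorial_Ring.prime p"
  let ?R = "residue_ring (int p)"
  \<comment> \<open>The constant 1 is a nonzero homogeneous polynomial of degree 0, and the empty
    family of linear forms gives an empty \<open>V2 b\<close>; so C = 0 works and the middle case of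
    the bound never occurs.\<close>
  let ?P = "ring.indexed_const ?R \<one>\<^bsub>?R\<^esub> :: 4 multiset \<Rightarrow> int"
  interpret residues "int p" ?R
    using prime_gt_1_nat[OF p] by unfold_locales auto
  show "(0::nat) \<le> 0" by simp
  have "?P \<in> indexed_pset UNIV (carrier ?R)"
    by (rule indexed_pset.indexed_const) simp
  moreover have "\<one>\<^bsub>?R\<^esub> \<noteq> \<zero>\<^bsub>?R\<^esub>"
    by (simp add: residue_ring_def)
  ultimately show "nonzero_homogeneous ?R 0 ?P"
    unfolding nonzero_homogeneous_def
    by (auto simp: indexed_const_def fun_eq_iff split: if_splits)
  show "zero_set ?R ?P = zero_set ?R ?P" ..
  show "\<forall>b\<in>affine_space ?R. \<exists>\<L>. finite \<L> \<and> card \<L> \<le> 0 \<and>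
      (\<forall>L\<in>\<L>. nonzero_homogeneous ?R 1 L) \<and>
      (\<lambda>b. {}) b = (\<Union>L\<in>\<L>. zero_set ?R (L :: 2 multiset \<Rightarrow> int))"
    by (intro ballI exI[of _ "{}"]) simp
  fix b :: "int ^ 4" and h :: "int ^ 2"
  assume b: "reduce_vec p b \<notin> diag_variety p"
  have dvd: "(\<forall>i. [h $ i = 0] (mod int p)) \<longleftrightarrow> int p dvd h $ 1 \<and> int p dvd h $ 2"
    by (simp add: forall_2 cong_0_iff)
  have "norm (frakS1 b h (p\<^sup>2)) \<le> real p ^ 3 * card (critical_points p (($) b) (h $ 1) (h $ 2))"
    by (rule norm_frakS1_le[OF p])
  also have "\<dots> \<le> real p ^ 3 * real (10 ^ 14 * (if int p dvd h $ 1 \<and> int p dvd h $ 2 then p else 1))"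
    by (intro mult_left_mono of_nat_mono card_critical_points_le p b) simp
  also have "\<dots> = 10 ^ 14 * (if \<forall>i. [h $ i = 0] (mod int p) then real p ^ 4 else real p ^ 3)"
    unfolding dvd by (simp add: power4_eq_xxxx power3_eq_cube)
  finally show "norm (frakS1 b h (p\<^sup>2)) \<le> 10 ^ 14 *
      (if \<forall>i. [h $ i = 0] (mod int p) then real p ^ 4
       else if (reduce_vec p b, reduce_vec p h) \<in> zero_set ?R ?P \<times> (\<lambda>b. {}) (reduce_vec p b) then real p ^ 4
       else real p ^ 3)" by (auto split: if_splits)
qed

end
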